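(* Let $N\ge1$ be an integer, $c>0$, and let $a<0<b$ be real numbers. The pseudo-density of $X_{ab}$ is given by $$\mathbb{P}\{X_{ab}\in\mathrm{d}z\}/\mathrm{d}z=\sum_{j=0}^{N-1}(-1)^j\,\mathbf{I}_{ab,j}^-\,\delta_a^{(j)}(z)+\sum_{j=0}^{N-1}(-1)^j\,\mathbf{I}_{ab,j}^+\,\delta_b^{(j)}(z),$$ where $$\mathbf{I}_{ab,j}^-=\left(\frac{b}{b-a}\right)^{N}\frac{a^j}{j!}\sum_{k=0}^{N-j-1}\binom{k+N-1}{k}\left(\frac{-a}{b-a}\right)^{k},\qquad \mathbf{I}_{ab,j}^+=\left(\frac{-a}{b-a}\right)^{N}\frac{(-b)^j}{j!}\sum_{k=0}^{N-j-1}\binom{k+N-1}{k}\left(\frac{b}{b-a}\right)^{k}.$$ In particular, $$\mathbb{P}\{\tau_a^-<\tau_b^+\}=\mathbf{I}_{ab,0}^-,\qquad\mathbb{P}\{\tau_b^+<\tau_a^-\}=\mathbf{I}_{ab,0}^+.$$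
   Context: $\delta_x^{(j)}$ is the $j$th derivative of the Dirac distribution at $x$, acting on test functions $\phi$ by $\langle\delta_x^{(j)},\phi\rangle=(-1)^j\phi^{(j)}(x)$. Pseudo-Brownian motion: $(X_t)_{t\ge0}$ is the pseudo-process (driven by a signed measure of total mass one, and understood as a limit of step processes associated with its observations on dyadic times) with independent stationary increments and $\mathbb{E}(\mathrm{e}^{\mathrm{i}uX_t})=\mathrm{e}^{-ctu^{2N}}$. The first overshooting and exit times are $\tau_a^-=\inf\{t\ge0:X_t\le a\}$, $\tau_b^+=\inf\{t\ge0:X_t\ge b\}$, $\tau_{ab}=\inf\{t\ge0:X_t\notin(a,b)\}$ ($\inf\emptyset=+\infty$), and $X_{ab}=X_{\tau_{ab}}$. The pseudo-density of $X_{ab}$ is the Schwartz distribution whose Fourier transform is $\mu\mapsto\mathbb{E}\big(\mathrm{e}^{\mathrm{i}\mu X_{ab}}1_{\{\tau_{ab}<+\infty\}}\big)$. This Fourier transform is obtained as the limit as $\varepsilon\to0^+$ of that of the exit location from $(a,b)$ of the normalized pseudo-random walk $X_t^\varepsilon=\varepsilon S_{\lfloor t/\varepsilon^{2N}\rfloor}$, where $S_0=0$, $S_n=U_1+\dots+U_n$ and the $U_n$ are independent identically distributed pseudo-random variables with $\mathbb{P}\{U_n=k\}=\delta_{k0}+(-1)^{k-1}c\binom{2N}{k+N}$ for $k\in\{-N,\dots,N\}$ ($\delta_{k0}$ being the Kronecker symbol).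
   Formalization: In I^-_{ab,j} the factor a^j/j! is corrected to (-a)^j/j!. As printed the formula is false for every N ≥ 2 (e.g. N=2, a=-1, b=1 gives a distribution not symmetric under z → -z, though X and the interval are); for N=1 the two agree. *)

theory Defs
  imports "HOL-Analysis.Analysis"
begin

section \<open>Pseudo-Brownian motion observed on dyadic times\<close>

text \<open>
  \<open>p t\<close> is the density of the signed measure that plays the role of the law of \<open>X\<^sub>t\<close>:
  \<open>E (exp (\<i> u X\<^sub>t)) = exp (- c t u^(2N))\<close>.  For \<open>u = 0\<close> this says that the total mass is one.  The
  Fourier transform determines the signed measure, and hence \<open>p t\<close> up to a null set.
\<close>

definition pseudo_brownian :: "nat \<Rightarrow> real \<Rightarrow> (real \<Rightarrow> real \<Rightarrow> real) \<Rightarrow> bool" where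
  "pseudo_brownian N c p \<longleftrightarrow>
     (\<forall>t>0. integrable lborel (p t) \<and>
        (\<forall>u. (LINT x|lborel. exp (\<i> * complex_of_real (u * x)) * complex_of_real (p t x))
              = complex_of_real (exp (- (c * t * u ^ (2 * N))))))"

text \<open>
  For \<open>N \<ge> 2\<close> there is no signed measure of finite total variation on path space, so only functionals of finitely
  many observations have an expectation outright.  \<open>obs_expect q k F\<close> is the pseudo-expectation of
  \<open>F (x 0, x 1, \<dots>)\<close> where \<open>x 0 = 0\<close> and the \<open>k\<close> increments \<open>x (i + 1) - x i = y i\<close>, \<open>i < k\<close>, are
  independent with the common signed density \<open>q\<close>.  It is meant for \<open>F\<close> that only look at
  \<open>x 0, \<dots>, x k\<close>: the coordinates \<open>y i\<close> with \<open>i \<ge> k\<close> carry no information.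
\<close>

definition obs_expect :: "(real \<Rightarrow> real) \<Rightarrow> nat \<Rightarrow> ((nat \<Rightarrow> real) \<Rightarrow> complex) \<Rightarrow> complex" where
  "obs_expect q k F =
     (LINT y|PiM {..<k} (\<lambda>_. lborel).
        F (\<lambda>j. \<Sum>i<j. y i) * complex_of_real (\<Prod>i<k. q (y i)))"

text \<open>The step path that takes the value \<open>x k\<close> on \<open>[k / 2^n, (k + 1) / 2^n)\<close>.\<close>

definition step_path :: "nat \<Rightarrow> (nat \<Rightarrow> real) \<Rightarrow> real \<Rightarrow> real" where
  "step_path n x t = x (nat \<lfloor>2 ^ n * t\<rfloor>)"

definition hitting_time :: "real set \<Rightarrow> (real \<Rightarrow> real) \<Rightarrow> ereal" where
  "hitting_time A \<omega> = (INF t\<in>{t. 0 \<le> t \<and> \<omega> t \<in> A}. ereal t)"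

definition tau_minus :: "real \<Rightarrow> (real \<Rightarrow> real) \<Rightarrow> ereal" where
  "tau_minus a = hitting_time {..a}"

definition tau_plus :: "real \<Rightarrow> (real \<Rightarrow> real) \<Rightarrow> ereal" where
  "tau_plus b = hitting_time {b..}"

definition tau_exit :: "real \<Rightarrow> real \<Rightarrow> (real \<Rightarrow> real) \<Rightarrow> ereal" where
  "tau_exit a b = hitting_time (- {a<..<b})"

definition exit_location :: "real \<Rightarrow> real \<Rightarrow> (real \<Rightarrow> real) \<Rightarrow> real" where
  "exit_location a b \<omega> = \<omega> (real_of_ereal (tau_exit a b \<omega>))"

text \<open>
  \<open>E (Z 1\<^bsub>{T < \<infinity>}\<^esub>) = v\<close> for a stopping time \<open>T\<close> and a functional \<open>Z\<close> of the path that on \<open>{T < \<infinity>}\<close>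
  is determined by the path up to time \<open>T\<close>.  For the \<open>n\<close>-th step process (the observations of \<open>X\<close>
  at the times \<open>k / 2^n\<close>) the expectation is the sum over \<open>k\<close> of \<open>E (Z 1\<^bsub>{T = k/2^n}\<^esub>)\<close>, each of which
  involves finitely many observations; the expectation for \<open>X\<close> is the limit as \<open>n\<close> tends to infinity.
\<close>

definition has_stopped_expectation ::
  "(real \<Rightarrow> real \<Rightarrow> real) \<Rightarrow> ((real \<Rightarrow> real) \<Rightarrow> ereal) \<Rightarrow> ((real \<Rightarrow> real) \<Rightarrow> complex) \<Rightarrow> complex \<Rightarrow> bool"
where
  "has_stopped_expectation p T Z v \<longleftrightarrow>
     (\<exists>E. (\<forall>n. (\<lambda>k. obs_expect (p (1 / 2 ^ n)) k
                     (\<lambda>x. if T (step_path n x) = ereal (real k / 2 ^ n)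
                          then Z (step_path n x) else 0)) sums E n)
          \<and> E \<longlonglongrightarrow> v)"

definition has_exit_char :: "(real \<Rightarrow> real \<Rightarrow> real) \<Rightarrow> real \<Rightarrow> real \<Rightarrow> real \<Rightarrow> complex \<Rightarrow> bool" where
  "has_exit_char p a b \<mu> v \<longleftrightarrow>
     has_stopped_expectation p (tau_exit a b)
       (\<lambda>\<omega>. exp (\<i> * complex_of_real (\<mu> * exit_location a b \<omega>))) v"

text \<open>
  In the next two definitions the event is split according to the value of the smaller of the two
  times; the larger one may be infinite.
\<close>

definition has_prob_minus_first :: "(real \<Rightarrow> real \<Rightarrow> real) \<Rightarrow> real \<Rightarrow> real \<Rightarrow> real \<Rightarrow> bool" where
  "has_prob_minus_first p a b r \<longleftrightarrow>
     has_stopped_expectation p (tau_minus a)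
       (\<lambda>\<omega>. if tau_minus a \<omega> < tau_plus b \<omega> then 1 else 0) (complex_of_real r)"

definition has_prob_plus_first :: "(real \<Rightarrow> real \<Rightarrow> real) \<Rightarrow> real \<Rightarrow> real \<Rightarrow> real \<Rightarrow> bool" where
  "has_prob_plus_first p a b r \<longleftrightarrow>
     has_stopped_expectation p (tau_plus b)
       (\<lambda>\<omega>. if tau_plus b \<omega> < tau_minus a \<omega> then 1 else 0) (complex_of_real r)"


section \<open>Tempered distributions on the real line\<close>

definition nth_deriv :: "nat \<Rightarrow> (real \<Rightarrow> complex) \<Rightarrow> real \<Rightarrow> complex" where
  "nth_deriv j = (\<lambda>f x. vector_derivative f (at x)) ^^ j"

definition schwartz :: "(real \<Rightarrow> complex) \<Rightarrow> bool" where
  "schwartz \<phi> \<longleftrightarrow>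
     (\<forall>j x. nth_deriv j \<phi> differentiable (at x)) \<and>
     (\<forall>m j. bounded (range (\<lambda>x. complex_of_real (x ^ m) * nth_deriv j \<phi> x)))"

text \<open>
  A functional is a total function; only its values on Schwartz functions are meaningful.
\<close>

definition tempered_distribution :: "((real \<Rightarrow> complex) \<Rightarrow> complex) \<Rightarrow> bool" where
  "tempered_distribution D \<longleftrightarrow>
     (\<forall>\<phi> \<psi>. schwartz \<phi> \<longrightarrow> schwartz \<psi> \<longrightarrow> D (\<lambda>x. \<phi> x + \<psi> x) = D \<phi> + D \<psi>) \<and>
     (\<forall>s \<phi>. schwartz \<phi> \<longrightarrow> D (\<lambda>x. s * \<phi> x) = s * D \<phi>) \<and>
     (\<exists>C m. \<forall>\<phi>. schwartz \<phi> \<longrightarrow>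
        norm (D \<phi>) \<le> C * (\<Sum>i\<le>m. \<Sum>j\<le>m. SUP x. \<bar>x\<bar> ^ i * norm (nth_deriv j \<phi> x)))"

definition fourier :: "(real \<Rightarrow> complex) \<Rightarrow> real \<Rightarrow> complex" where
  "fourier \<phi> z = (LINT \<mu>|lborel. exp (\<i> * complex_of_real (\<mu> * z)) * \<phi> \<mu>)"

text \<open>
  The Fourier transform of \<open>D\<close> is the function \<open>\<Phi>\<close>, formally \<open>\<Phi> \<mu> = \<langle>D, exp (\<i> \<mu> \<cdot>)\<rangle>\<close>; this is defined
  by duality.
\<close>

definition has_fourier_transform :: "((real \<Rightarrow> complex) \<Rightarrow> complex) \<Rightarrow> (real \<Rightarrow> complex) \<Rightarrow> bool" where
  "has_fourier_transform D \<Phi> \<longleftrightarrow>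
     (\<forall>\<phi>. schwartz \<phi> \<longrightarrow>
        integrable lborel (\<lambda>\<mu>. \<Phi> \<mu> * \<phi> \<mu>) \<and>
        D (fourier \<phi>) = (LINT \<mu>|lborel. \<Phi> \<mu> * \<phi> \<mu>))"

definition dirac_deriv :: "real \<Rightarrow> nat \<Rightarrow> (real \<Rightarrow> complex) \<Rightarrow> complex" where
  "dirac_deriv x j \<phi> = (- 1) ^ j * nth_deriv j \<phi> x"

definition is_exit_pseudo_density ::
  "(real \<Rightarrow> real \<Rightarrow> real) \<Rightarrow> real \<Rightarrow> real \<Rightarrow> ((real \<Rightarrow> complex) \<Rightarrow> complex) \<Rightarrow> bool" where
  "is_exit_pseudo_density p a b D \<longleftrightarrow>
     tempered_distribution D \<and>
     (\<exists>\<Phi>. (\<forall>\<mu>. has_exit_char p a b \<mu> (\<Phi> \<mu>)) \<and> has_fourier_transform D \<Phi>)"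


section \<open>The coefficients\<close>

text \<open>
  \<open>I_minus\<close> contains \<open>(- a) ^ j\<close>, so that exchanging \<open>a\<close> and \<open>b\<close> turns it into \<open>I_plus\<close>, as the
  symmetry of the process requires.  With \<open>a ^ j\<close> in its place the distribution
  \<open>\<Sum>j<N. (-1)^j I_minus j \<delta>\<^sub>a^(j) + \<Sum>j<N. (-1)^j I_plus j \<delta>\<^sub>b^(j)\<close> would not be invariant under
  reflection for \<open>N \<ge> 2\<close> and \<open>b = - a\<close>.
\<close>

definition I_minus :: "nat \<Rightarrow> real \<Rightarrow> real \<Rightarrow> nat \<Rightarrow> real" where
  "I_minus N a b j =
     (b / (b - a)) ^ N * ((- a) ^ j / fact j) *
     (\<Sum>k<N - j. real ((k + N - 1) choose k) * (- a / (b - a)) ^ k)"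

definition I_plus :: "nat \<Rightarrow> real \<Rightarrow> real \<Rightarrow> nat \<Rightarrow> real" where
  "I_plus N a b j =
     (- a / (b - a)) ^ N * ((- b) ^ j / fact j) *
     (\<Sum>k<N - j. real ((k + N - 1) choose k) * (b / (b - a)) ^ k)"

end

theory Submission
  imports Defs "HOL-Probability.Probability" "HOL-Computational_Algebra.Polynomial"
begin

text \<open>
  Let \<open>q\<close> be the law of the increment of \<open>X\<close> over a dyadic step of length \<open>t\<close>; its transform is
  \<open>exp (- c t u^(2N))\<close>.  For a function \<open>f\<close> of the exit place let \<open>u x\<close> be the pseudo-expectation of \<open>f\<close>
  at the exit from \<open>(a, b)\<close> of the walk started in \<open>x\<close>.  Then \<open>u = f\<close> outside \<open>(a, b)\<close>, and \<open>u\<close> equals its mean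
  \<open>avg q u\<close> after one step inside.  As \<open>t\<close> tends to \<open>0\<close>, the operator \<open>(1 - avg q) / t\<close> approaches
  \<open>c (- 1)^N\<close> times the derivative of order \<open>2N\<close>.  So \<open>u\<close> should converge to the function \<open>g\<close> that
  is \<open>f\<close> outside, a polynomial of degree less than \<open>2N\<close> inside, and \<open>N - 1\<close> times continuously differentiable across
  \<open>a\<close> and \<open>b\<close>: the two-point Hermite interpolation.  Its value at \<open>0\<close> is the combination of the derivatives
  \<open>f^(j)(a)\<close> and \<open>f^(j)(b)\<close>, \<open>j < N\<close>, with the coefficients \<open>I_minus\<close> and \<open>I_plus\<close> (\<open>hermite_interpolation\<close>).  The
  choice \<open>f = exp (\<i> \<mu> \<cdot>)\<close> gives the Fourier transform of the exit distribution, and the indicator of a half line gives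
  the probability of leaving through \<open>b\<close>.

  For \<open>N \<ge> 2\<close> the law \<open>q\<close> is signed and there is no maximum principle.  It is replaced by Plancherel's theorem: the
  quadratic form of \<open>1 - avg q\<close> has the nonnegative symbol \<open>gap = 1 - exp (- c t u^(2N))\<close>.  A function supported in
  \<open>(a, b)\<close> has half of its energy away from the zero of this symbol (\<open>Poincare_fourier\<close>).  Hence the killed step is a
  contraction of \<open>L\<^sup>2\<close>, and the sum over the exit step converges to \<open>u\<close> (\<open>exit_solution\<close>).

  The difference \<open>w = u - g\<close> vanishes outside \<open>(a, b)\<close>, and its energy is minus the pairing of \<open>w\<close> with the defect
  \<open>g - avg q g\<close> (\<open>energy_identity\<close>).  Up to a term that disappears in the limit, the transform of the defect is
  \<open>gap / u^(2N)\<close> times a combination of \<open>u^j exp (\<i> u a)\<close> and \<open>u^j exp (\<i> u b)\<close> with \<open>j < N\<close>: only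
  derivatives of \<open>g\<close> of order at least \<open>N\<close> jump (\<open>defect_exp\<close>, \<open>defect_right_half_line\<close>).  The pairing with \<open>w\<close> is thus
  made of derivatives at \<open>a\<close> and \<open>b\<close>, of order below \<open>N\<close>, of \<open>w\<close> smoothed at the scale \<open>h = t^(1/(2N))\<close>.  They are small
  because \<open>w\<close> vanishes on one side of each end point.  Smoothing with a one-sided kernel would make them exactly \<open>0\<close>, and
  comparing the two kernels yields a factor \<open>sqrt h\<close> (\<open>boundary_estimate\<close>).  It follows that the energy of \<open>w\<close> is
  \<open>o(t)\<close>.  One more step of smoothing bounds the value at a point by the energy divided by \<open>t\<close>
  (\<open>norm_avg_q_le_energy\<close>), and so \<open>u 0\<close> converges to \<open>g 0\<close> (\<open>exit_value_tendsto\<close>).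

  A tempered distribution is determined by its transform because every Schwartz function is the transform of a
  Schwartz function (\<open>schwartz_eq_fourier\<close>).
\<close>

section \<open>Translations in \<open>L\<^sup>1\<close> and the Riemann-Lebesgue lemma\<close>

text \<open>Since \<open>U\<close> and its translate have the same measure, their symmetric difference has twice the measure of
  the part of \<open>U\<close> that the translate misses.  Every point of the open set \<open>U\<close> eventually leaves that part.\<close>

lemma translation_L1_open:
  fixes U :: "real set" and X :: "nat \<Rightarrow> real"
  assumes U: "open U" and fin: "emeasure lborel U < \<infinity>" and X: "X \<longlonglongrightarrow> 0"
  shows "(\<lambda>n. LINT x|lborel. \<bar>indicator U (x + X n) - indicator U x :: real\<bar>) \<longlonglongrightarrow> 0"
proof -
  have [measurable]: "U \<in> sets borel" using U by simp
  have i1: "integrable lborel (indicator U :: real \<Rightarrow> real)"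
    using fin by (simp add: integrable_indicator_iff)
  have i2: "integrable lborel (\<lambda>x. indicator U (x + X n) :: real)" for n
    using lborel_integrable_real_affine[OF i1, of 1 "X n"] by (simp add: add.commute)
  have i3: "integrable lborel (\<lambda>x. indicator U x * indicator U (x + X n) :: real)" for n
    by (rule Bochner_Integration.integrable_bound[OF i1]) (auto simp: indicator_def)
  have shift: "(LINT x|lborel. indicator U (x + X n) :: real) = (LINT x|lborel. indicator U x)" for n
    using lborel_integral_real_affine[of 1 "indicator U :: real \<Rightarrow> real" "X n"] by (simp add: add.commute)
  have "(\<lambda>n. LINT x|lborel. indicator U x * indicator U (x + X n) :: real)
          \<longlonglongrightarrow> (LINT x|lborel. indicator U x)"
  proof (rule integral_dominated_convergence[where w = "indicator U"])
    have "(\<lambda>n. indicator U x * indicator U (x + X n) :: real) \<longlonglongrightarrow> indicator U x" for x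
    proof (cases "x \<in> U")
      case True
      have "(\<lambda>n. x + X n) \<longlonglongrightarrow> x + 0" by (intro tendsto_intros X)
      with True U have "\<forall>\<^sub>F n in sequentially. x + X n \<in> U"
        by (auto dest: topological_tendstoD)
      then show ?thesis
        using True by (intro tendsto_eventually) (auto elim: eventually_mono)
    qed simp
    then show "AE x in lborel. (\<lambda>n. indicator U x * indicator U (x + X n) :: real) \<longlonglongrightarrow> indicator U x"
      by simp
  qed (use i1 in \<open>auto simp: indicator_def\<close>)
  then have "(\<lambda>n. 2 * (LINT x|lborel. indicator U x) - 2 * (LINT x|lborel. indicator U x * indicator U (x + X n) :: real))
     \<longlonglongrightarrow> 2 * (LINT x|lborel. indicator U x) - 2 * (LINT x|lborel. indicator U x)"
    by (intro tendsto_intros)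
  moreover have "(LINT x|lborel. \<bar>indicator U (x + X n) - indicator U x :: real\<bar>) =
      2 * (LINT x|lborel. indicator U x) - 2 * (LINT x|lborel. indicator U x * indicator U (x + X n))" for n
  proof -
    have "(LINT x|lborel. \<bar>indicator U (x + X n) - indicator U x :: real\<bar>) =
      (LINT x|lborel. indicator U (x + X n) + indicator U x - 2 * (indicator U x * indicator U (x + X n)))"
      by (rule Bochner_Integration.integral_cong) (auto simp: indicator_def)
    then show ?thesis using i1 i2 i3 shift[of n] by simp
  qed
  ultimately show ?thesis by simp
qed

text \<open>Outer regularity reduces a measurable set to an open one.\<close>

lemma translation_L1_indicator:
  fixes A :: "real set" and X :: "nat \<Rightarrow> real"
  assumes A[measurable]: "A \<in> sets lborel" and fin: "emeasure lborel A < \<infinity>" and X: "X \<longlonglongrightarrow> 0"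
  shows "(\<lambda>n. LINT x|lborel. \<bar>indicator A (x + X n) - indicator A x :: real\<bar>) \<longlonglongrightarrow> 0"
proof (rule LIMSEQ_I)
  have A'[measurable]: "A \<in> sets borel" using A by simp
  fix \<epsilon> :: real assume \<epsilon>: "\<epsilon> > 0"
  have "A \<in> sets borel" using A by simp
  then obtain U where U: "open U" "A \<subseteq> U" "emeasure lborel (U - A) < ennreal (\<epsilon> / 3)"
    using outer_regular_lborel[of A "\<epsilon> / 3"] \<epsilon> by auto
  define D where "D = U - A"
  have [measurable]: "U \<in> sets borel" using U by simp
  have finD: "emeasure lborel D < \<infinity>"
    using U(3) unfolding D_def by (metis ennreal_less_top less_trans infinity_ennreal_def)
  have "emeasure lborel U \<le> emeasure lborel A + emeasure lborel D"
    using emeasure_subadditive[of A lborel D] U(2) A by (simp add: D_def Un_absorb1)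
  also have "\<dots> < \<infinity>" using fin finD by simp
  finally have finU: "emeasure lborel U < \<infinity>" .
  have D[measurable]: "D \<in> sets borel" unfolding D_def using A by simp
  have iA: "integrable lborel (indicator A :: real \<Rightarrow> real)" "integrable lborel (indicator U :: real \<Rightarrow> real)"
     "integrable lborel (indicator D :: real \<Rightarrow> real)"
    using fin finU finD A' D by (auto simp: integrable_indicator_iff)
  have iX: "integrable lborel (\<lambda>x. indicator B (x + X n) :: real)" if "integrable lborel (indicator B :: real \<Rightarrow> real)" for n B
    using lborel_integrable_real_affine[OF that, of 1 "X n"] by (simp add: add.commute)
  have sX: "(LINT x|lborel. indicator D (x + X n) :: real) = measure lborel D" for n
    using lborel_integral_real_affine[of 1 "indicator D :: real \<Rightarrow> real" "X n"] by (simp add: add.commute)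
  have mD: "measure lborel D < \<epsilon> / 3"
    using U(3) finD \<epsilon> unfolding D_def[symmetric]
    by (metis emeasure_eq_ennreal_measure ennreal_less_iff infinity_ennreal_def less_irrefl measure_nonneg)
  obtain N where N: "\<And>n. n \<ge> N \<Longrightarrow> (LINT x|lborel. \<bar>indicator U (x + X n) - indicator U x :: real\<bar>) < \<epsilon> / 3"
    using translation_L1_open[OF U(1) finU X] \<epsilon> by (fastforce simp: LIMSEQ_iff dest!: spec[of _ "\<epsilon>/3"])
  have "norm ((LINT x|lborel. \<bar>indicator A (x + X n) - indicator A x :: real\<bar>) - 0) < \<epsilon>" if "n \<ge> N" for n
  proof -
    have "(LINT x|lborel. \<bar>indicator A (x + X n) - indicator A x :: real\<bar>) \<le>
      (LINT x|lborel. \<bar>indicator U (x + X n) - indicator U x :: real\<bar> + indicator D (x + X n) + indicator D x)"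
      using U(2)
      by (intro integral_mono integrable_abs Bochner_Integration.integrable_add Bochner_Integration.integrable_diff iA iX)
         (auto simp: D_def indicator_def)
    also have "\<dots> = (LINT x|lborel. \<bar>indicator U (x + X n) - indicator U x :: real\<bar>) + 2 * measure lborel D"
      using iA iX sX[of n] by simp
    also have "\<dots> < \<epsilon>" using N[OF that] mD by simp
    finally show ?thesis by simp
  qed
  then show "\<exists>no. \<forall>n\<ge>no. norm ((LINT x|lborel. \<bar>indicator A (x + X n) - indicator A x :: real\<bar>) - 0) < \<epsilon>"
    by blast
qed

text \<open>All continuity properties below come from this one: continuity of averages and correlations, and the
  decay of transforms.\<close>

proposition translation_L1_tendsto:
  fixes f :: "real \<Rightarrow> 'a :: {banach, second_countable_topology}" and X :: "nat \<Rightarrow> real"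
  assumes f: "integrable lborel f" and X: "X \<longlonglongrightarrow> 0"
  shows "(\<lambda>n. LINT x|lborel. norm (f (x + X n) - f x)) \<longlonglongrightarrow> 0"
  using f
proof (induction rule: integrable_induct)
  case (base A c)
  have "(\<lambda>n. (LINT x|lborel. \<bar>indicator A (x + X n) - indicator A x :: real\<bar>) * norm c) \<longlonglongrightarrow> 0 * norm c"
    by (intro tendsto_intros translation_L1_indicator base X)
  then show ?case
    by (simp flip: scaleR_diff_left)
next
  case (add f g)
  have sh: "integrable lborel (\<lambda>x. h (x + X n))" if "integrable lborel h" for h :: "real \<Rightarrow> 'a" and n
    using lborel_integrable_real_affine[OF that, of 1 "X n"] by (simp add: add.commute)
  have lim: "(\<lambda>n. (LINT x|lborel. norm (f (x + X n) - f x)) + (LINT x|lborel. norm (g (x + X n) - g x))) \<longlonglongrightarrow> 0"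
    using tendsto_add[OF add.IH] by simp
  show ?case
  proof (rule tendsto_sandwich[OF _ _ tendsto_const lim])
    show "\<forall>\<^sub>F n in sequentially. (LINT x|lborel. norm (f (x + X n) + g (x + X n) - (f x + g x))) \<le>
       (LINT x|lborel. norm (f (x + X n) - f x)) + (LINT x|lborel. norm (g (x + X n) - g x))"
    proof (intro always_eventually allI)
      fix n
      have "(LINT x|lborel. norm (f (x + X n) + g (x + X n) - (f x + g x))) \<le>
         (LINT x|lborel. norm (f (x + X n) - f x) + norm (g (x + X n) - g x))"
        using sh[OF add.hyps(1), of n] sh[OF add.hyps(2), of n] add.hyps
        by (intro integral_mono Bochner_Integration.integrable_add integrable_norm Bochner_Integration.integrable_diff)
           (auto simp: add_diff_add intro: norm_triangle_ineq)
      also have "\<dots> = (LINT x|lborel. norm (f (x + X n) - f x)) + (LINT x|lborel. norm (g (x + X n) - g x))"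
        using sh[OF add.hyps(1), of n] sh[OF add.hyps(2), of n] add.hyps
        by (intro Bochner_Integration.integral_add integrable_norm Bochner_Integration.integrable_diff)
      finally show "(LINT x|lborel. norm (f (x + X n) + g (x + X n) - (f x + g x))) \<le> \<dots>" .
    qed
  qed (simp add: always_eventually)
next
  case (lim f s)
  have sh: "integrable lborel (\<lambda>x. h (x + X n))" if "integrable lborel h" for h :: "real \<Rightarrow> 'a" and n
    using lborel_integrable_real_affine[OF that, of 1 "X n"] by (simp add: add.commute)
  have [measurable]: "f \<in> borel_measurable borel" "\<And>i. s i \<in> borel_measurable borel"
    using lim.hyps(1)[THEN borel_measurable_integrable] lim.hyps(4) by (auto dest: borel_measurable_integrable)
  have conv: "(\<lambda>i. LINT x|lborel. norm (s i x - f x)) \<longlonglongrightarrow> (LINT x::real|lborel. (0::real))"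
  proof (rule integral_dominated_convergence[where w = "\<lambda>x. 3 * norm (f x)" and f = "\<lambda>x. 0" and s = "\<lambda>i x. norm (s i x - f x)"])
    show "AE x in lborel. (\<lambda>i. norm (s i x - f x)) \<longlonglongrightarrow> 0"
      using lim.hyps(2) by (auto intro!: AE_I2 tendsto_norm_zero simp: LIM_zero_iff)
    show "AE x in lborel. norm (norm (s i x - f x)) \<le> 3 * norm (f x)" for i
      using lim.hyps(3)[of _ i] by (auto intro!: AE_I2 order_trans[OF norm_triangle_ineq4])
  qed (use lim.hyps in auto)
  show ?case
  proof (rule LIMSEQ_I)
    fix \<epsilon> :: real assume \<epsilon>: "\<epsilon> > 0"
    then obtain i where i: "(LINT x|lborel. norm (s i x - f x)) < \<epsilon> / 3"
      using conv by (fastforce simp: LIMSEQ_iff dest!: spec[of _ "\<epsilon>/3"])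
    obtain N where N: "\<And>n. n \<ge> N \<Longrightarrow> (LINT x|lborel. norm (s i (x + X n) - s i x)) < \<epsilon> / 3"
      using lim.IH[of i] \<epsilon> by (fastforce simp: LIMSEQ_iff dest!: spec[of _ "\<epsilon>/3"])
    have "norm ((LINT x|lborel. norm (f (x + X n) - f x)) - 0) < \<epsilon>" if "n \<ge> N" for n
    proof -
      note ii = lim.hyps(1)[of i] lim.hyps(4) sh[OF lim.hyps(1)[of i], of n] sh[OF lim.hyps(4), of n]
      have d: "norm (f y - f x) \<le> norm (s i y - f y) + norm (s i y - s i x) + norm (s i x - f x)" for x y
      proof -
        have "f y - f x = (f y - s i y) + (s i y - s i x) + (s i x - f x)" by simp
        also have "norm \<dots> \<le> norm (f y - s i y) + norm (s i y - s i x) + norm (s i x - f x)"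
          by (intro norm_triangle_le add_right_mono norm_triangle_ineq)
        finally show ?thesis by (simp only: norm_minus_commute[of "f y" "s i y"])
      qed
      have "(LINT x|lborel. norm (f (x + X n) - f x)) \<le>
        (LINT x|lborel. norm (s i (x + X n) - f (x + X n)) + norm (s i (x + X n) - s i x) + norm (s i x - f x))"
        using ii by (intro integral_mono Bochner_Integration.integrable_add integrable_norm Bochner_Integration.integrable_diff d)
      also have "\<dots> = (LINT x|lborel. norm (s i (x + X n) - f (x + X n))) + (LINT x|lborel. norm (s i (x + X n) - s i x)) + (LINT x|lborel. norm (s i x - f x))"
        using ii by simp
      also have "(LINT x|lborel. norm (s i (x + X n) - f (x + X n))) = (LINT x|lborel. norm (s i x - f x))"
        using lborel_integral_real_affine[of 1 "\<lambda>x. norm (s i x - f x)" "X n"] by (simp add: add.commute)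
      finally show ?thesis using N[OF that] i by simp
    qed
    then show "\<exists>no. \<forall>n\<ge>no. norm ((LINT x|lborel. norm (f (x + X n) - f x)) - 0) < \<epsilon>" by blast
  qed
qed

abbreviation iexp_neg :: "real \<Rightarrow> complex" where
  "iexp_neg x \<equiv> exp (- \<i> * complex_of_real x)"

lemma integrable_exp_i:
  fixes f :: "real \<Rightarrow> complex"
  assumes "integrable lborel f"
  shows "integrable lborel (\<lambda>x. iexp (x * u) * f x)"
proof (rule Bochner_Integration.integrable_bound[OF assms])
  have [measurable]: "f \<in> borel_measurable borel" using assms by (auto dest: borel_measurable_integrable)
  show "(\<lambda>x. iexp (x * u) * f x) \<in> borel_measurable lborel" by measurable
qed (simp add: norm_mult)

lemma fourier_borel [measurable]:
  assumes [measurable]: "f \<in> borel_measurable borel"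
  shows "fourier f \<in> borel_measurable borel"
  unfolding fourier_def by measurable

lemma norm_fourier_le: "norm (fourier f u) \<le> (LINT x|lborel. norm (f x))"
  unfolding fourier_def
  by (rule order_trans[OF integral_norm_bound]) (simp add: norm_mult)

lemma fourier_add:
  "integrable lborel f \<Longrightarrow> integrable lborel g \<Longrightarrow> fourier (\<lambda>x. f x + g x) u = fourier f u + fourier g u"
  using integrable_exp_i[of f u] integrable_exp_i[of g u] unfolding fourier_def by (simp add: distrib_left)

lemma fourier_diff:
  "integrable lborel f \<Longrightarrow> integrable lborel g \<Longrightarrow> fourier (\<lambda>x. f x - g x) u = fourier f u - fourier g u"
  using integrable_exp_i[of f u] integrable_exp_i[of g u] unfolding fourier_def by (simp add: right_diff_distrib)

lemma fourier_cmult: "fourier (\<lambda>x. c * f x) u = c * fourier f u"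
  unfolding fourier_def by (simp add: mult.left_commute)

lemma fourier_cnj: "fourier (\<lambda>x. cnj (f x)) u = cnj (fourier f (- u))"
  unfolding fourier_def by (simp flip: Bochner_Integration.integral_cnj add: exp_cnj)

lemma fourier_uminus: "fourier (\<lambda>x. f (- x)) u = fourier f (- u)"
  unfolding fourier_def
  using lborel_integral_real_affine[of "-1" "\<lambda>x. iexp (x * - u) * f x" 0] by simp

lemma fourier_shift: "fourier (\<lambda>x. f (x + y)) u = iexp_neg (y * u) * fourier f u"
proof -
  have "fourier f u = (LINT x|lborel. iexp ((x + y) * u) * f (x + y))"
    unfolding fourier_def
    using lborel_integral_real_affine[of 1 "\<lambda>x. iexp (x * u) * f x" y]
    by (simp add: add.commute)
  also have "\<dots> = (LINT x|lborel. iexp (y * u) * (iexp (x * u) * f (x + y)))"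
    by (rule Bochner_Integration.integral_cong) (simp_all add: algebra_simps flip: exp_add)
  also have "\<dots> = iexp (y * u) * fourier (\<lambda>x. f (x + y)) u"
    by (simp add: fourier_def)
  finally show ?thesis by (simp add: exp_minus)
qed

lemma integrable_shift:
  fixes f :: "real \<Rightarrow> 'a :: {banach, second_countable_topology}"
  shows "integrable lborel f \<Longrightarrow> integrable lborel (\<lambda>x. f (x + y))"
  using lborel_integrable_real_affine[of f 1 y] by (simp add: add.commute)

lemma integral_shift:
  fixes f :: "real \<Rightarrow> 'a :: {banach, second_countable_topology}"
  shows "(LINT x|lborel. f (x + y)) = (LINT x|lborel. f x)"
  using lborel_integral_real_affine[of 1 f y] by (simp add: add.commute)

text \<open>Shifting by half a period of the oscillating factor changes its sign, so that the
  transform is bounded by an \<open>L\<^sup>1\<close> modulus of continuity.\<close>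

lemma Riemann_Lebesgue:
  assumes f: "integrable lborel f"
  shows "(\<lambda>n. fourier f (real n + r)) \<longlonglongrightarrow> 0"
proof -
  define X where "X n = pi / (real n + r)" for n
  have X: "X \<longlonglongrightarrow> 0" unfolding X_def by real_asymp
  have bound: "norm (fourier f (real n + r)) \<le> (LINT x|lborel. norm (f (x + X n) - f x)) / 2" if "real n + r \<noteq> 0" for n
  proof -
    have "fourier (\<lambda>x. f (x + X n)) (real n + r) = - fourier f (real n + r)"
      using that by (simp add: fourier_shift X_def) (simp add: exp_minus)
    then have "2 * fourier f (real n + r) = - fourier (\<lambda>x. f (x + X n) - f x) (real n + r)"
      using f by (simp add: fourier_diff integrable_shift)
    then have "norm (2 * fourier f (real n + r)) \<le> (LINT x|lborel. norm (f (x + X n) - f x))"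
      by (simp only: norm_minus_cancel norm_fourier_le)
    then show ?thesis by (simp add: norm_mult)
  qed
  have "\<forall>\<^sub>F n in sequentially. real n + r \<noteq> 0"
  proof -
    have "\<forall>\<^sub>F n in sequentially. real n + r > 0" by real_asymp
    then show ?thesis by eventually_elim simp
  qed
  then have "\<forall>\<^sub>F n in sequentially. norm (fourier f (real n + r)) \<le> (LINT x|lborel. norm (f (x + X n) - f x)) / 2"
    by eventually_elim (rule bound)
  moreover have "(\<lambda>n. (LINT x|lborel. norm (f (x + X n) - f x)) / 2) \<longlonglongrightarrow> 0"
    using tendsto_divide[OF translation_L1_tendsto[OF f X] tendsto_const, of 2] by simp
  ultimately show ?thesis
    by (rule Lim_null_comparison)
qed

lemma std_normal_fourier:
  "fourier (\<lambda>x. complex_of_real (std_normal_density x)) u = complex_of_real (exp (- u\<^sup>2 / 2))"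
proof -
  have "fourier (\<lambda>x. complex_of_real (std_normal_density x)) u = char std_normal_distribution u"
    unfolding fourier_def char_def
    by (subst integral_density)
       (auto simp: scaleR_conv_of_real mult_ac intro!: Bochner_Integration.integral_cong)
  then show ?thesis by (simp add: char_std_normal_distribution)
qed

text \<open>The functions to which Plancherel is applied are bounded and integrable; this class is closed under
  averaging and avoids \<open>L\<^sup>2\<close> limits.\<close>

definition L1_bdd :: "(real \<Rightarrow> complex) \<Rightarrow> bool" where
  "L1_bdd f \<longleftrightarrow> integrable lborel f \<and> bounded (range f)"

section \<open>Fourier inversion and Plancherel\<close>

abbreviation sq_norm :: "(real \<Rightarrow> complex) \<Rightarrow> real" where
  "sq_norm f \<equiv> LINT x|lborel. (norm (f x))\<^sup>2"

lemma borel_measurable_cnj [measurable (raw)]: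
  "f \<in> borel_measurable M \<Longrightarrow> (\<lambda>x. cnj (f x)) \<in> borel_measurable M"
  by (rule borel_measurable_continuous_on[OF continuous_on_cnj[OF continuous_on_id]])

lemma L1_bddD:
  assumes "L1_bdd f"
  shows "integrable lborel f" "f \<in> borel_measurable borel" "\<exists>B. \<forall>x. norm (f x) \<le> B"
  using assms by (auto simp: L1_bdd_def bounded_iff dest: borel_measurable_integrable)

lemma L1_bddI:
  "integrable lborel f \<Longrightarrow> (\<And>x. norm (f x) \<le> B) \<Longrightarrow> L1_bdd f"
  by (auto simp: L1_bdd_def bounded_iff)

lemma L1_bdd_integrable_bounded_mult:
  fixes f g :: "real \<Rightarrow> complex"
  assumes "integrable lborel f" "g \<in> borel_measurable borel" "\<And>x. norm (g x) \<le> B"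
  shows "integrable lborel (\<lambda>x. f x * g x)"
proof -
  have [measurable]: "f \<in> borel_measurable borel" "g \<in> borel_measurable borel"
    using assms(1,2) by (auto dest: borel_measurable_integrable)
  have "norm (f x * g x) \<le> norm (B * norm (f x))" for x
  proof -
    have "0 \<le> B" using assms(3)[of x] by (rule order_trans[OF norm_ge_zero])
    then show ?thesis using mult_right_mono[OF assms(3)[of x], of "norm (f x)"]
      by (simp add: norm_mult mult.commute)
  qed
  then show ?thesis
    by (rule Bochner_Integration.integrable_bound[of _ "\<lambda>x. B * norm (f x)", rotated 2, OF AE_I2])
       (use assms(1) in simp_all)
qed

text \<open>The mean of \<open>f\<close> after one step with density \<open>q\<close> from \<open>x\<close>.  With \<open>q = cnj \<circ> g\<close> it is the correlation of
  \<open>f\<close> with \<open>g\<close>.\<close>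

definition avg :: "(real \<Rightarrow> complex) \<Rightarrow> (real \<Rightarrow> complex) \<Rightarrow> real \<Rightarrow> complex" where
  "avg q f x = (LINT y|lborel. f (x + y) * q y)"

lemma avg_borel [measurable]:
  assumes [measurable]: "f \<in> borel_measurable borel" "q \<in> borel_measurable borel"
  shows "avg q f \<in> borel_measurable borel"
  unfolding avg_def by measurable

lemma avg_alt: "avg q f x = (LINT z|lborel. f z * q (z - x))"
  unfolding avg_def
  using lborel_integral_real_affine[of 1 "\<lambda>z. f z * q (z - x)" x] by simp

lemma avg_integrand_integrable:
  fixes f q :: "real \<Rightarrow> complex"
  assumes q: "integrable lborel q" and f: "f \<in> borel_measurable borel" "\<And>x. norm (f x) \<le> B"
  shows "integrable lborel (\<lambda>y. f (x + y) * q y)"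
  using L1_bdd_integrable_bounded_mult[OF q, of "\<lambda>y. f (x + y)" B] f by (simp add: mult.commute)

lemma norm_avg_le:
  fixes f q :: "real \<Rightarrow> complex"
  assumes q: "integrable lborel q" and f: "f \<in> borel_measurable borel" "\<And>x. norm (f x) \<le> B"
  shows "norm (avg q f x) \<le> B * (LINT y|lborel. norm (q y))"
proof -
  have "norm (avg q f x) \<le> (LINT y|lborel. norm (f (x + y) * q y))"
    unfolding avg_def by (rule integral_norm_bound)
  also have "\<dots> \<le> (LINT y|lborel. B * norm (q y))"
    using avg_integrand_integrable[OF q f] q f
    by (intro integral_mono integrable_norm) (auto simp: norm_mult intro: mult_right_mono)
  finally show ?thesis by simp
qed

text \<open>The translation is moved to the integrable factor \<open>q\<close>, which is how averaging makes a discontinuous \<open>f\<close>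
  continuous.\<close>

lemma avg_isCont:
  fixes f q :: "real \<Rightarrow> complex"
  assumes q: "integrable lborel q" and f: "f \<in> borel_measurable borel" "\<And>x. norm (f x) \<le> B"
  shows "isCont (avg q f) x"
  unfolding continuous_at_sequentially
proof (intro allI impI)
  fix X :: "nat \<Rightarrow> real" assume X: "X \<longlonglongrightarrow> x"
  have [measurable]: "f \<in> borel_measurable borel" "q \<in> borel_measurable borel"
    using q f by (auto dest: borel_measurable_integrable)
  define Y where "Y n = x - X n" for n
  have Y: "Y \<longlonglongrightarrow> 0"
    unfolding Y_def using tendsto_diff[OF tendsto_const X, of x] by simp
  define q' where "q' z = q (z - x)" for z
  have q': "integrable lborel q'"
    unfolding q'_def using integrable_shift[OF q, of "-x"] by simp
  have "norm (avg q f (X n) - avg q f x) \<le> B * (LINT z|lborel. norm (q' (z + Y n) - q' z))" for n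
  proof -
    have i: "integrable lborel (\<lambda>z. q' (z + Y n))" using integrable_shift[OF q'] .
    have i1: "integrable lborel (\<lambda>z. f z * q' (z + Y n))" "integrable lborel (\<lambda>z. f z * q' z)"
      using L1_bdd_integrable_bounded_mult[OF i f] L1_bdd_integrable_bounded_mult[OF q' f]
      by (simp_all add: mult.commute)
    have "avg q f (X n) - avg q f x = (LINT z|lborel. f z * q' (z + Y n)) - (LINT z|lborel. f z * q' z)"
      unfolding avg_alt q'_def Y_def by (simp add: algebra_simps)
    also have "\<dots> = (LINT z|lborel. f z * (q' (z + Y n) - q' z))"
      using i1 by (simp add: right_diff_distrib)
    also have "norm \<dots> \<le> (LINT z|lborel. norm (f z * (q' (z + Y n) - q' z)))"
      by (rule integral_norm_bound)
    also have "\<dots> \<le> (LINT z|lborel. B * norm (q' (z + Y n) - q' z))"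
    proof (intro integral_mono)
      have "integrable lborel (\<lambda>z. f z * q' (z + Y n) - f z * q' z)" using i1 by (rule Bochner_Integration.integrable_diff)
      then show "integrable lborel (\<lambda>z. norm (f z * (q' (z + Y n) - q' z)))" by (simp add: right_diff_distrib)
      show "integrable lborel (\<lambda>z. B * norm (q' (z + Y n) - q' z))"
        using i q' by (intro integrable_mult_right integrable_norm Bochner_Integration.integrable_diff)
    qed (auto simp: norm_mult f(2) intro: mult_right_mono)
    finally show ?thesis by simp
  qed
  moreover have "(\<lambda>n. B * (LINT z|lborel. norm (q' (z + Y n) - q' z))) \<longlonglongrightarrow> B * 0"
    by (intro tendsto_intros translation_L1_tendsto q' Y)
  ultimately have "(\<lambda>n. avg q f (X n) - avg q f x) \<longlonglongrightarrow> 0"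
    by (rule_tac Lim_null_comparison[where g = "\<lambda>n. B * (LINT z|lborel. norm (q' (z + Y n) - q' z))"]) simp_all
  then show "((avg q f) \<circ> X) \<longlonglongrightarrow> avg q f x"
    by (simp add: LIM_zero_iff comp_def)
qed

lemma avg_pair_integrable:
  fixes f q :: "real \<Rightarrow> complex"
  assumes q: "integrable lborel q" and f: "integrable lborel f"
  shows "integrable (lborel \<Otimes>\<^sub>M lborel) (\<lambda>(y, x). iexp (x * u) * (f (x + y) * q y))"
proof -
  have [measurable]: "f \<in> borel_measurable borel" "q \<in> borel_measurable borel"
    using q f by (auto dest: borel_measurable_integrable)
  show ?thesis
  proof (rule lborel_pair.Fubini_integrable)
    show "AE y in lborel. integrable lborel (\<lambda>x. case (y, x) of (y, x) \<Rightarrow> iexp (x * u) * (f (x + y) * q y))"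
      using integrable_exp_i[OF integrable_mult_left[OF integrable_shift[OF f]]] by simp
    show "integrable lborel (\<lambda>y. LINT x|lborel. norm (case (y, x) of (y, x) \<Rightarrow> iexp (x * u) * (f (x + y) * q y)))"
    proof -
      have "(LINT x|lborel. norm (iexp (x * u) * (f (x + y) * q y))) = (LINT x|lborel. norm (f x)) * norm (q y)" for y
        using integral_shift[of "\<lambda>x. norm (f x)" y] by (simp add: norm_mult)
      then show ?thesis using q by simp
    qed
  qed measurable
qed

lemma avg_integrable:
  fixes f q :: "real \<Rightarrow> complex"
  assumes q: "integrable lborel q" and f: "integrable lborel f"
  shows "integrable lborel (avg q f)"
proof -
  have "integrable lborel (\<lambda>x. LINT y|lborel. iexp (x * 0) * (f (x + y) * q y))"
    using lborel_pair.integrable_snd[OF avg_pair_integrable[OF q f, of 0]] by simp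
  then show ?thesis by (simp add: avg_def[abs_def])
qed

text \<open>The argument \<open>- u\<close> reflects that \<open>avg\<close> is a correlation and not a convolution.\<close>

lemma fourier_avg:
  fixes f q :: "real \<Rightarrow> complex"
  assumes q: "integrable lborel q" and f: "integrable lborel f"
  shows "fourier (avg q f) u = fourier f u * fourier q (- u)"
proof -
  have "fourier (avg q f) u = (LINT x|lborel. LINT y|lborel. iexp (x * u) * (f (x + y) * q y))"
    unfolding fourier_def avg_def by simp
  also have "\<dots> = (LINT y|lborel. LINT x|lborel. iexp (x * u) * (f (x + y) * q y))"
    by (rule lborel_pair.Fubini_integral[OF avg_pair_integrable[OF q f]])
  also have "\<dots> = (LINT y|lborel. fourier (\<lambda>x. f (x + y)) u * q y)"
    unfolding fourier_def by (simp flip: mult.assoc)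
  also have "\<dots> = (LINT y|lborel. fourier f u * (iexp (y * (- u)) * q y))"
    by (intro Bochner_Integration.integral_cong) (simp_all add: fourier_shift)
  also have "\<dots> = fourier f u * fourier q (- u)"
    unfolding fourier_def by simp
  finally show ?thesis .
qed

lemma L1_bdd_avg:
  assumes "integrable lborel q" "L1_bdd f"
  shows "L1_bdd (avg q f)"
proof -
  obtain B where "\<And>x. norm (f x) \<le> B" using L1_bddD[OF assms(2)] by auto
  then show ?thesis
    using norm_avg_le[OF assms(1), of f B] avg_integrable[OF assms(1), of f] L1_bddD[OF assms(2)]
    by (intro L1_bddI[where B = "B * (LINT y|lborel. norm (q y))"]) auto
qed

lemma gaussian_pair_integrable:
  fixes F :: "real \<Rightarrow> complex"
  assumes F: "integrable lborel F" and s: "s > (0::real)"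
  shows "integrable (lborel \<Otimes>\<^sub>M lborel)
    (\<lambda>(x, u). complex_of_real (exp (- (s * u)\<^sup>2 / 2)) * (iexp (x * u) * F x))"
    and gaussian_integrable: "integrable lborel (\<lambda>u. exp (- (s * u)\<^sup>2 / 2))"
proof -
  have [measurable]: "F \<in> borel_measurable borel" using F by (auto dest: borel_measurable_integrable)
  have "integrable lborel (\<lambda>u. sqrt (2 * pi) * std_normal_density u)" by simp
  then have "integrable lborel (\<lambda>u::real. exp (- u\<^sup>2 / 2))" by (simp add: std_normal_density_def)
  then show g: "integrable lborel (\<lambda>u. exp (- (s * u)\<^sup>2 / 2))"
    using lborel_integrable_real_affine[of "\<lambda>u. exp (- u\<^sup>2 / 2)" s 0] s by simp
  show "integrable (lborel \<Otimes>\<^sub>M lborel)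
    (\<lambda>(x, u). complex_of_real (exp (- (s * u)\<^sup>2 / 2)) * (iexp (x * u) * F x))"
  proof (rule lborel_pair.Fubini_integrable)
    show "AE x in lborel. integrable lborel (\<lambda>u. case (x, u) of (x, u) \<Rightarrow>
       complex_of_real (exp (- (s * u)\<^sup>2 / 2)) * (iexp (x * u) * F x))"
    proof (intro AE_I2)
      fix x
      have "integrable lborel (\<lambda>u. F x * (iexp (u * x) * complex_of_real (exp (- (s * u)\<^sup>2 / 2))))"
        by (intro integrable_mult_right integrable_exp_i integrable_of_real g)
      then show "integrable lborel (\<lambda>u. case (x, u) of (x, u) \<Rightarrow>
         complex_of_real (exp (- (s * u)\<^sup>2 / 2)) * (iexp (x * u) * F x))"
        by (simp add: mult_ac)
    qed
    have "(LINT u|lborel. norm (complex_of_real (exp (- (s * u)\<^sup>2 / 2)) * (iexp (x * u) * F x)))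
       = (LINT u|lborel. exp (- (s * u)\<^sup>2 / 2)) * norm (F x)" for x
      by (simp add: norm_mult)
    then show "integrable lborel (\<lambda>x. LINT u|lborel. norm (case (x, u) of (x, u) \<Rightarrow>
         complex_of_real (exp (- (s * u)\<^sup>2 / 2)) * (iexp (x * u) * F x)))"
      using F by simp
  qed measurable
qed

text \<open>The Gaussian is its own transform, so damping the transform of \<open>F\<close> is averaging \<open>F\<close> around \<open>0\<close> at scale
  \<open>s\<close>.\<close>

lemma gaussian_damped_fourier:
  fixes F :: "real \<Rightarrow> complex"
  assumes F: "integrable lborel F" and s: "s > 0"
  shows "(LINT u|lborel. complex_of_real (exp (- (s * u)\<^sup>2 / 2)) * fourier F u)
     = 2 * pi * (LINT y|lborel. complex_of_real (std_normal_density y) * F (s * y))"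
proof -
  have e: "exp (- u\<^sup>2 / 2) = sqrt (2 * pi) * std_normal_density u" for u :: real
    by (simp add: std_normal_density_def)
  have inner: "(LINT u|lborel. complex_of_real (exp (- (s * u)\<^sup>2 / 2)) * iexp (x * u))
     = complex_of_real (2 * pi / s * std_normal_density (x / s))" for x
  proof -
    have "complex_of_real (exp (- (x / s)\<^sup>2 / 2)) = (LINT v|lborel. iexp (v * (x / s)) * complex_of_real (std_normal_density v))"
      using std_normal_fourier[of "x / s"] by (simp add: fourier_def)
    also have "\<dots> = s * (LINT u|lborel. iexp (x * u) * complex_of_real (std_normal_density (s * u)))"
      using s by (subst lborel_integral_real_affine[of s _ 0]) (auto simp: scaleR_conv_of_real mult_ac)
    finally have 1: "complex_of_real (exp (- (x / s)\<^sup>2 / 2)) =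
       s * (LINT u|lborel. iexp (x * u) * complex_of_real (std_normal_density (s * u)))" .
    have "(LINT u|lborel. complex_of_real (exp (- (s * u)\<^sup>2 / 2)) * iexp (x * u))
      = (LINT u|lborel. sqrt (2 * pi) * (iexp (x * u) * complex_of_real (std_normal_density (s * u))))"
      unfolding e by (intro Bochner_Integration.integral_cong) (auto simp: mult_ac)
    also have "\<dots> = sqrt (2 * pi) * (LINT u|lborel. iexp (x * u) * complex_of_real (std_normal_density (s * u)))"
      by simp
    also have "\<dots> = sqrt (2 * pi) * (complex_of_real (exp (- (x / s)\<^sup>2 / 2)) / s)"
      using 1 s by (simp add: field_simps)
    also have "\<dots> = complex_of_real (sqrt (2 * pi) * sqrt (2 * pi) / s * std_normal_density (x / s))"
      unfolding e by (simp only: of_real_mult of_real_divide times_divide_eq_left times_divide_eq_right mult.assoc)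
    also have "sqrt (2 * pi) * sqrt (2 * pi) = 2 * pi" by (simp only: real_sqrt_mult_self) simp
    finally show ?thesis .
  qed
  have "(LINT u|lborel. complex_of_real (exp (- (s * u)\<^sup>2 / 2)) * fourier F u) =
    (LINT u|lborel. LINT x|lborel. complex_of_real (exp (- (s * u)\<^sup>2 / 2)) * (iexp (x * u) * F x))"
    unfolding fourier_def by simp
  also have "\<dots> = (LINT x|lborel. LINT u|lborel. complex_of_real (exp (- (s * u)\<^sup>2 / 2)) * (iexp (x * u) * F x))"
    by (rule lborel_pair.Fubini_integral[OF gaussian_pair_integrable(1)[OF F s]])
  also have "\<dots> = (LINT x|lborel. complex_of_real (2 * pi / s * std_normal_density (x / s)) * F x)"
    unfolding inner[symmetric] by (simp flip: mult.assoc)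
  also have "\<dots> = 2 * pi / s * (LINT x|lborel. complex_of_real (std_normal_density (x / s)) * F x)"
    by (simp only: of_real_mult mult.assoc Bochner_Integration.integral_mult_right_zero)
  also have "(LINT x|lborel. complex_of_real (std_normal_density (x / s)) * F x) =
     s * (LINT y|lborel. complex_of_real (std_normal_density y) * F (s * y))"
    using s by (subst lborel_integral_real_affine[of s _ 0]) (auto simp: scaleR_conv_of_real)
  finally show ?thesis using s by simp
qed

lemma gaussian_mean_tendsto:
  fixes F :: "real \<Rightarrow> complex"
  assumes F: "L1_bdd F" and cont: "isCont F 0"
  shows "(\<lambda>n. LINT y|lborel. complex_of_real (std_normal_density y) * F (1 / real (Suc n) * y)) \<longlonglongrightarrow> F 0"
proof -
  obtain B where B: "\<And>x. norm (F x) \<le> B" and [measurable]: "F \<in> borel_measurable borel"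
    using L1_bddD[OF F] by auto
  have "(\<lambda>n. LINT y|lborel. complex_of_real (std_normal_density y) * F (1 / real (Suc n) * y))
       \<longlonglongrightarrow> (LINT y|lborel. complex_of_real (std_normal_density y) * F 0)"
  proof (rule integral_dominated_convergence[where w = "\<lambda>y. B * std_normal_density y"])
    have "(\<lambda>n. F (1 / real (Suc n) * y)) \<longlonglongrightarrow> F 0" for y
    proof (rule isCont_tendsto_compose[OF cont])
      show "(\<lambda>n. 1 / real (Suc n) * y) \<longlonglongrightarrow> 0" by real_asymp
    qed
    then show "AE y in lborel. (\<lambda>n. complex_of_real (std_normal_density y) * F (1 / real (Suc n) * y))
        \<longlonglongrightarrow> complex_of_real (std_normal_density y) * F 0"
      by (intro AE_I2 tendsto_intros)
    show "AE y in lborel. norm (complex_of_real (std_normal_density y) * F (1 / real (Suc n) * y)) \<le> B * std_normal_density y" for n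
      by (intro AE_I2) (simp add: norm_mult mult.commute[of B] mult_left_mono[OF B])
  qed auto
  then show ?thesis by simp
qed

text \<open>Both sides of the damped identity converge as the damping is removed, the left one because the
  transform is integrable, the right one because \<open>F\<close> is continuous at \<open>0\<close>.\<close>

proposition fourier_inversion_0:
  fixes F :: "real \<Rightarrow> complex"
  assumes F: "L1_bdd F" and cont: "isCont F 0" and int: "integrable lborel (fourier F)"
  shows "(LINT u|lborel. fourier F u) = 2 * pi * F 0"
proof (rule LIMSEQ_unique)
  let ?s = "\<lambda>n. 1 / real (Suc n)"
  have [measurable]: "F \<in> borel_measurable borel" using L1_bddD[OF F] by auto
  show "(\<lambda>n. LINT u|lborel. complex_of_real (exp (- (?s n * u)\<^sup>2 / 2)) * fourier F u) \<longlonglongrightarrow> (LINT u|lborel. fourier F u)"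
  proof (rule integral_dominated_convergence[where w = "\<lambda>u. norm (fourier F u)"])
    have "(\<lambda>n. exp (- (?s n * u)\<^sup>2 / 2)) \<longlonglongrightarrow> exp (- (0 * u)\<^sup>2 / 2)" for u :: real
      by (intro tendsto_intros) (real_asymp, simp)
    then have "(\<lambda>n. complex_of_real (exp (- (?s n * u)\<^sup>2 / 2)) * fourier F u) \<longlonglongrightarrow> complex_of_real (exp (- (0 * u)\<^sup>2 / 2)) * fourier F u" for u
      by (rule tendsto_mult[OF tendsto_of_real tendsto_const])
    then show "AE u in lborel. (\<lambda>n. complex_of_real (exp (- (?s n * u)\<^sup>2 / 2)) * fourier F u) \<longlonglongrightarrow> fourier F u"
      by simp
    show "AE u in lborel. norm (complex_of_real (exp (- (?s n * u)\<^sup>2 / 2)) * fourier F u) \<le> norm (fourier F u)" for n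
      by (auto simp: norm_mult intro!: mult_left_le_one_le)
  qed (use int in auto)
  have "(LINT u|lborel. complex_of_real (exp (- (?s n * u)\<^sup>2 / 2)) * fourier F u) =
      2 * pi * (LINT y|lborel. complex_of_real (std_normal_density y) * F (?s n * y))" for n
    using gaussian_damped_fourier[of F "?s n"] L1_bddD[OF F] by simp
  then show "(\<lambda>n. LINT u|lborel. complex_of_real (exp (- (?s n * u)\<^sup>2 / 2)) * fourier F u) \<longlonglongrightarrow> 2 * pi * F 0"
    by (simp only:) (intro tendsto_intros gaussian_mean_tendsto F cont)
qed

lemma L1_bdd_shift: "L1_bdd F \<Longrightarrow> L1_bdd (\<lambda>x. F (x + y))"
  unfolding L1_bdd_def by (auto intro: integrable_shift elim: bounded_subset)

proposition fourier_inversion: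
  fixes F :: "real \<Rightarrow> complex"
  assumes F: "L1_bdd F" and cont: "isCont F x" and int: "integrable lborel (fourier F)"
  shows "(LINT u|lborel. iexp_neg (x * u) * fourier F u) = 2 * pi * F x"
proof -
  have "integrable lborel (\<lambda>u. iexp (u * (- x)) * fourier F u)"
    by (rule integrable_exp_i[OF int])
  moreover have "fourier (\<lambda>y. F (y + x)) = (\<lambda>u. iexp (u * (- x)) * fourier F u)"
    by (auto simp: fourier_shift mult_ac)
  ultimately have "integrable lborel (fourier (\<lambda>y. F (y + x)))"
    by simp
  moreover have "isCont (\<lambda>y. F (y + x)) 0"
    using isCont_o2[where f = "\<lambda>y. y + x" and a = 0 and g = F] cont by simp
  ultimately have "(LINT u|lborel. fourier (\<lambda>y. F (y + x)) u) = 2 * pi * F (0 + x)"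
    by (intro fourier_inversion_0 L1_bdd_shift F)
  then show ?thesis by (simp add: fourier_shift)
qed

text \<open>The correlation of \<open>f\<close> with \<open>g\<close> is continuous with transform \<open>fourier f * cnj (fourier g)\<close>;
  Parseval is inversion at the origin.\<close>

lemma fourier_correlation:
  assumes "integrable lborel f" "integrable lborel g"
  shows "fourier (avg (\<lambda>y. cnj (g y)) f) u = fourier f u * cnj (fourier g u)"
  using fourier_avg[of "\<lambda>y. cnj (g y)" f u] assms by (simp add: fourier_cnj)

lemma correlation_isCont:
  assumes f: "L1_bdd f" and g: "integrable lborel g"
  shows "isCont (avg (\<lambda>y. cnj (g y)) f) x"
proof -
  obtain B where B: "\<And>x. norm (f x) \<le> B" "f \<in> borel_measurable borel" using L1_bddD[OF f] by auto
  then show ?thesis using g by (intro avg_isCont[where B = B]) auto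
qed

text \<open>The autocorrelation of \<open>f\<close> is bounded and has the nonnegative transform \<open>(norm (fourier f))\<^sup>2\<close>, whose
  Gaussian means therefore increase to a finite limit.\<close>

proposition fourier_square_integrable:
  assumes f: "L1_bdd f"
  shows "integrable lborel (\<lambda>u. (norm (fourier f u))\<^sup>2)"
proof -
  define A where "A = avg (\<lambda>y. cnj (f y)) f"
  let ?s = "\<lambda>n. 1 / real (Suc n)"
  have [measurable]: "f \<in> borel_measurable borel" using L1_bddD[OF f] by auto
  note fi = L1_bddD(1)[OF f]
  have fA: "fourier A u = complex_of_real ((norm (fourier f u))\<^sup>2)" for u
    unfolding A_def using fourier_correlation[OF fi fi] by (simp add: complex_norm_square del: of_real_power)
  have A: "L1_bdd A" "isCont A 0"
    unfolding A_def using f fi by (auto intro!: L1_bdd_avg correlation_isCont)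
  define M where "M = (LINT x|lborel. norm (f x))"
  have bd: "(norm (fourier f u))\<^sup>2 \<le> M\<^sup>2" for u
    unfolding M_def by (intro power_mono norm_fourier_le) auto
  have "(LINT u|lborel. exp (- (?s n * u)\<^sup>2 / 2) * (norm (fourier f u))\<^sup>2) =
     Re (2 * pi * (LINT y|lborel. complex_of_real (std_normal_density y) * A (?s n * y)))" for n
  proof -
    have "complex_of_real (LINT u|lborel. exp (- (?s n * u)\<^sup>2 / 2) * (norm (fourier f u))\<^sup>2) =
      (LINT u|lborel. complex_of_real (exp (- (?s n * u)\<^sup>2 / 2)) * fourier A u)"
      unfolding fA by (simp flip: integral_complex_of_real)
    also have "\<dots> = 2 * pi * (LINT y|lborel. complex_of_real (std_normal_density y) * A (?s n * y))"
      by (rule gaussian_damped_fourier) (use L1_bddD(1)[OF A(1)] in auto)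
    finally have "Re (complex_of_real (LINT u|lborel. exp (- (?s n * u)\<^sup>2 / 2) * (norm (fourier f u))\<^sup>2)) =
       Re (2 * pi * (LINT y|lborel. complex_of_real (std_normal_density y) * A (?s n * y)))"
      by (rule arg_cong)
    then show ?thesis by (simp only: Re_complex_of_real)
  qed
  then have lim: "(\<lambda>n. LINT u|lborel. exp (- (?s n * u)\<^sup>2 / 2) * (norm (fourier f u))\<^sup>2) \<longlonglongrightarrow> Re (2 * pi * A 0)"
    by (simp only:) (intro tendsto_intros gaussian_mean_tendsto A)
  show ?thesis
  proof (rule integrable_monotone_convergence[OF _ _ _ lim])
    show "integrable lborel (\<lambda>u. exp (- (?s n * u)\<^sup>2 / 2) * (norm (fourier f u))\<^sup>2)" for n
    proof (rule Bochner_Integration.integrable_bound[of _ "\<lambda>u. M\<^sup>2 * exp (- (?s n * u)\<^sup>2 / 2)"])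
      show "integrable lborel (\<lambda>u. M\<^sup>2 * exp (- (?s n * u)\<^sup>2 / 2))"
        by (intro integrable_mult_right gaussian_integrable) auto
    qed (use bd in \<open>auto simp: mult.commute intro: mult_right_mono\<close>)
    have "mono (\<lambda>n. exp (- (?s n * u)\<^sup>2 / 2) * (norm (fourier f u))\<^sup>2)" for u
    proof (rule monoI)
      fix m n :: nat assume "m \<le> n"
      then have "?s n \<le> ?s m" by (simp add: frac_le)
      then have "(?s n * \<bar>u\<bar>)\<^sup>2 \<le> (?s m * \<bar>u\<bar>)\<^sup>2"
        by (intro power_mono mult_right_mono) auto
      then have "(?s n * u)\<^sup>2 \<le> (?s m * u)\<^sup>2"
        by (simp only: power_mult_distrib power2_abs)
      then show "exp (- (?s m * u)\<^sup>2 / 2) * (norm (fourier f u))\<^sup>2 \<le> exp (- (?s n * u)\<^sup>2 / 2) * (norm (fourier f u))\<^sup>2"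
        by (intro mult_right_mono) simp_all
    qed
    then show "AE u in lborel. mono (\<lambda>n. exp (- (?s n * u)\<^sup>2 / 2) * (norm (fourier f u))\<^sup>2)" by simp
    have "(\<lambda>n. exp (- (?s n * u)\<^sup>2 / 2)) \<longlonglongrightarrow> exp (- (0 * u)\<^sup>2 / 2)" for u :: real
      by (intro tendsto_intros) (real_asymp, simp)
    then have "(\<lambda>n. exp (- (?s n * u)\<^sup>2 / 2) * (norm (fourier f u))\<^sup>2) \<longlonglongrightarrow> exp (- (0 * u)\<^sup>2 / 2) * (norm (fourier f u))\<^sup>2" for u
      by (rule tendsto_mult[OF _ tendsto_const])
    then show "AE u in lborel. (\<lambda>n. exp (- (?s n * u)\<^sup>2 / 2) * (norm (fourier f u))\<^sup>2) \<longlonglongrightarrow> (norm (fourier f u))\<^sup>2" by simp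
  qed measurable
qed

lemma integrable_mult_L2:
  fixes f g :: "'a \<Rightarrow> complex"
  assumes [measurable]: "f \<in> borel_measurable M" "g \<in> borel_measurable M"
    and f: "integrable M (\<lambda>x. (norm (f x))\<^sup>2)" and g: "integrable M (\<lambda>x. (norm (g x))\<^sup>2)"
  shows "integrable M (\<lambda>x. f x * g x)"
proof (rule Bochner_Integration.integrable_bound[OF Bochner_Integration.integrable_add[OF f g]])
  have "norm (f x) * norm (g x) \<le> (norm (f x))\<^sup>2 + (norm (g x))\<^sup>2" for x
    using sum_squares_bound[of "norm (f x)" "norm (g x)"] mult_nonneg_nonneg[OF norm_ge_zero[of "f x"] norm_ge_zero[of "g x"]]
    by linarith
  then show "AE x in M. norm (f x * g x) \<le> norm ((norm (f x))\<^sup>2 + (norm (g x))\<^sup>2)"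
    by (auto simp: norm_mult)
qed measurable

lemma Cauchy_Schwarz_L2:
  fixes f g :: "'a \<Rightarrow> complex"
  assumes [measurable]: "f \<in> borel_measurable M" "g \<in> borel_measurable M"
    and f: "integrable M (\<lambda>x. (norm (f x))\<^sup>2)" and g: "integrable M (\<lambda>x. (norm (g x))\<^sup>2)"
  shows "(LINT x|M. norm (f x * g x)) \<le> sqrt (LINT x|M. (norm (f x))\<^sup>2) * sqrt (LINT x|M. (norm (g x))\<^sup>2)"
proof -
  define a b m where "a = (LINT x|M. (norm (f x))\<^sup>2)" and "b = (LINT x|M. (norm (g x))\<^sup>2)"
    and "m = (LINT x|M. norm (f x * g x))"
  have fg: "integrable M (\<lambda>x. norm (f x * g x))" using integrable_mult_L2[OF assms] by simp
  have ineq: "0 \<le> a * r\<^sup>2 - 2 * m * r * s + b * s\<^sup>2" for r s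
  proof -
    have "0 \<le> (LINT x|M. (norm (f x) * r - norm (g x) * s)\<^sup>2)" by simp
    also have "\<dots> = (LINT x|M. (norm (f x))\<^sup>2 * r\<^sup>2 - (2 * r * s) * norm (f x * g x) + (norm (g x))\<^sup>2 * s\<^sup>2)"
      by (intro Bochner_Integration.integral_cong) (auto simp: norm_mult power2_eq_square algebra_simps)
    also have "\<dots> = a * r\<^sup>2 - (2 * r * s) * m + b * s\<^sup>2"
      unfolding a_def b_def m_def using f g fg by simp
    finally show ?thesis by (simp add: algebra_simps)
  qed
  have nn: "a \<ge> 0" "b \<ge> 0" "m \<ge> 0" unfolding a_def b_def m_def by auto
  have "m\<^sup>2 \<le> a * b"
  proof (cases "a = 0")
    case True
    have "m = 0"
    proof (rule ccontr)
      assume "m \<noteq> 0"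
      then show False using ineq[of "(b + 1) / (2 * m)" 1] True by simp
    qed
    then show ?thesis using nn by simp
  next
    case False
    have "0 \<le> a * (a * b - m\<^sup>2)"
      using ineq[of m a] by (simp add: power2_eq_square algebra_simps)
    then show ?thesis using False nn by (simp add: zero_le_mult_iff)
  qed
  then have "m \<le> sqrt (a * b)" using nn real_le_rsqrt by blast
  then show ?thesis unfolding a_def b_def m_def by (simp add: real_sqrt_mult)
qed

lemma fourier_mult_cnj_integrable:
  assumes f: "L1_bdd f" and g: "L1_bdd g"
  shows "integrable lborel (\<lambda>u. fourier f u * cnj (fourier g u))"
  using L1_bddD(2)[OF f] L1_bddD(2)[OF g] fourier_square_integrable[OF f] fourier_square_integrable[OF g]
  by (intro integrable_mult_L2) auto

theorem Parseval:
  fixes f g :: "real \<Rightarrow> complex"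
  assumes f: "L1_bdd f" and g: "L1_bdd g"
  shows "(LINT u|lborel. fourier f u * cnj (fourier g u)) = 2 * pi * (LINT x|lborel. f x * cnj (g x))"
proof -
  note fi = L1_bddD(1)[OF f] and gi = L1_bddD(1)[OF g]
  have "(LINT u|lborel. fourier (avg (\<lambda>y. cnj (g y)) f) u) = 2 * pi * avg (\<lambda>y. cnj (g y)) f 0"
  proof (rule fourier_inversion_0)
    have "fourier (avg (\<lambda>y. cnj (g y)) f) = (\<lambda>u. fourier f u * cnj (fourier g u))"
      by (rule ext) (rule fourier_correlation[OF fi gi])
    then show "integrable lborel (fourier (avg (\<lambda>y. cnj (g y)) f))"
      using fourier_mult_cnj_integrable[OF f g] by simp
    show "isCont (avg (\<lambda>y. cnj (g y)) f) 0" by (rule correlation_isCont[OF f gi])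
    show "L1_bdd (avg (\<lambda>y. cnj (g y)) f)" using gi f by (intro L1_bdd_avg) auto
  qed
  then show ?thesis by (simp add: fourier_correlation[OF fi gi] avg_def)
qed

lemma L1_bdd_square_integrable:
  assumes f: "L1_bdd f" shows "integrable lborel (\<lambda>x. (norm (f x))\<^sup>2)"
proof -
  obtain B where B: "\<And>x. norm (f x) \<le> B" "f \<in> borel_measurable borel" using L1_bddD[OF f] by auto
  have "integrable lborel (\<lambda>x. norm (f x * cnj (f x)))"
    using B L1_bddD(1)[OF f] by (intro integrable_norm L1_bdd_integrable_bounded_mult[where B = B]) auto
  then show ?thesis by (simp add: norm_mult power2_eq_square)
qed

corollary Plancherel:
  assumes f: "L1_bdd f"
  shows "sq_norm (fourier f) = 2 * pi * sq_norm f"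
proof -
  have "complex_of_real (sq_norm (fourier f)) = complex_of_real (2 * pi * sq_norm f)"
    using Parseval[OF f f] by (simp flip: complex_norm_square integral_complex_of_real of_real_power)
  then show ?thesis by (simp only: of_real_eq_iff)
qed

section \<open>The boundary layer\<close>

text \<open>The density of minus an exponential variable of mean \<open>h\<close>: averaging with it only looks to the left.\<close>

definition left_exp :: "real \<Rightarrow> real \<Rightarrow> complex" where
  "left_exp h y = (if y \<le> 0 then complex_of_real (exp (y / h) / h) else 0)"

lemma left_exp_borel [measurable]: "left_exp h \<in> borel_measurable borel"
  unfolding left_exp_def[abs_def] by measurable

lemma left_exp_integrable:
  assumes h: "h > 0"
  shows "integrable lborel (left_exp h)"
proof -
  have "emeasure (density lborel (exponential_density (1 / h))) UNIV = 1"
    using prob_space.emeasure_space_1[OF prob_space_exponential_density[of "1 / h"]] h by simp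
  then have "(\<integral>\<^sup>+x. ennreal (exponential_density (1 / h) x) \<partial>lborel) = 1"
    by (simp add: emeasure_density)
  then have "integrable lborel (exponential_density (1 / h))"
    using h by (intro integrableI_nonneg) (auto simp: exponential_density_nonneg)
  then have "integrable lborel (\<lambda>x. complex_of_real (exponential_density (1 / h) (0 + -1 * x)))"
    by (intro integrable_of_real lborel_integrable_real_affine) auto
  moreover have "(\<lambda>x. complex_of_real (exponential_density (1 / h) (0 + -1 * x))) = left_exp h"
    by (auto simp: left_exp_def exponential_density_def fun_eq_iff)
  ultimately show ?thesis by simp
qed

lemma fourier_left_exp:
  assumes h: "h > 0"
  shows "fourier (left_exp h) (- u) = 1 / (1 - \<i> * complex_of_real (h * u))"
proof -
  define z where "z = complex_of_real (1 / h) - \<i> * complex_of_real u"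
  have z: "Re z > 0" "z \<noteq> 0" using h by (auto simp: z_def complex_eq_iff)
  let ?f = "\<lambda>y. exp (z * complex_of_real y) / complex_of_real h"
  let ?F = "\<lambda>y. exp (z * complex_of_real y) / (complex_of_real h * z)"
  have eq: "iexp (y * - u) * left_exp h y = indicator {..0} y *\<^sub>R ?f y" for y
    by (auto simp: left_exp_def z_def indicator_def algebra_simps exp_diff exp_of_real[symmetric] exp_minus field_simps)
  have int: "integrable lborel (\<lambda>y. indicator {..0} y *\<^sub>R ?f y)"
    using integrable_exp_i[OF left_exp_integrable[OF h], of "-u"] by (simp only: eq)
  have AEeq: "AE y in lborel. indicator {..0} y *\<^sub>R ?f y = indicator (einterval (-\<infinity>) 0) y *\<^sub>R ?f y"
    using AE_lborel_singleton[of 0] by eventually_elim (auto simp: indicator_def einterval_def zero_ereal_def)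
  have [measurable]: "einterval (-\<infinity>) 0 \<in> sets borel" by simp
  have int': "set_integrable lborel (einterval (-\<infinity>) 0) ?f"
    unfolding set_integrable_def using int by (subst integrable_cong_AE[OF _ _ AEeq, symmetric]) auto
  have "(LBINT y=-\<infinity>..0. ?f y) = 1 / (complex_of_real h * z) - 0"
  proof (rule interval_integral_FTC_integrable[where F = ?F])
    show "(?F has_vector_derivative ?f y) (at y)" for y
      using z h unfolding has_real_derivative_iff_has_vector_derivative[symmetric]
      by (auto intro!: derivative_eq_intros has_vector_derivative_real_field simp: field_simps)
    show "isCont ?f y" for y by (intro continuous_intros) (use h in auto)
    have "(?F \<longlongrightarrow> ?F 0) (at_left 0)"
      by (intro tendsto_intros) (use h z in auto)
    then show "((?F \<circ> real_of_ereal) \<longlongrightarrow> 1 / (complex_of_real h * z)) (at_left 0)"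
      by (simp add: ereal_tendsto_simps1 zero_ereal_def)
    have "((\<lambda>y. exp (Re z * y) / norm (complex_of_real h * z)) \<longlongrightarrow> 0) at_bot"
      using z h by real_asymp
    then have "(?F \<longlongrightarrow> 0) at_bot"
      by (intro tendsto_norm_zero_cancel[of ?F]) (simp add: norm_divide norm_exp_eq_Re)
    then show "((?F \<circ> real_of_ereal) \<longlongrightarrow> 0) (at_right (- \<infinity>))"
      by (simp add: ereal_tendsto_simps1)
  qed (use int' in auto)
  moreover have "fourier (left_exp h) (- u) = (LBINT y=-\<infinity>..0. ?f y)"
    unfolding fourier_def eq interval_lebesgue_integral_def set_lebesgue_integral_def
    by (simp, rule integral_cong_AE[OF _ _ AEeq]) auto
  ultimately have "fourier (left_exp h) (- u) = 1 / (complex_of_real h * z)" by simp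
  also have "complex_of_real h * z = 1 - \<i> * complex_of_real (h * u)"
    using h by (simp add: z_def algebra_simps)
  finally show ?thesis .
qed

lemma integrable_inverse_1_plus_square_lborel:
  "integrable lborel (\<lambda>x::real. 1 / (1 + x\<^sup>2))" "(LINT x|lborel. 1 / (1 + x\<^sup>2)) = pi"
  using integrable_inverse_1_plus_square LBINT_inverse_1_plus_square
  by (auto simp: set_integrable_def interval_lebesgue_integral_def set_lebesgue_integral_def inverse_eq_divide)

lemma integrable_inverse_1_plus_square_scaled:
  assumes "h > (0::real)"
  shows "integrable lborel (\<lambda>x. 1 / (1 + (h * x)\<^sup>2))" "(LINT x|lborel. 1 / (1 + (h * x)\<^sup>2)) = pi / h"
  using lborel_integrable_real_affine[OF integrable_inverse_1_plus_square_lborel(1), of h 0]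
    lborel_integral_real_affine[of h "\<lambda>x. 1 / (1 + x\<^sup>2)" 0] integrable_inverse_1_plus_square_lborel(2) assms
  by (auto simp: field_simps)

text \<open>At \<open>s = h * u\<close> this is the factor by which averaging with \<open>left_exp h\<close> multiplies transforms.\<close>

abbreviation lag_mult :: "real \<Rightarrow> complex" where
  "lag_mult s \<equiv> 1 / (1 - \<i> * complex_of_real s)"

lemma one_sided_avg_funpow:
  assumes h: "h > 0" and w: "L1_bdd w" "\<And>x. x \<le> a \<Longrightarrow> w x = 0"
  shows "L1_bdd ((avg (left_exp h) ^^ m) w) \<and> (\<forall>x\<le>a. (avg (left_exp h) ^^ m) w x = 0) \<and>
    (\<forall>u. fourier ((avg (left_exp h) ^^ m) w) u = lag_mult (h * u) ^ m * fourier w u)"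
proof (induction m)
  case 0
  then show ?case using w by simp
next
  case (Suc m)
  define v where "v = (avg (left_exp h) ^^ m) w"
  have v: "L1_bdd v" "\<And>x. x \<le> a \<Longrightarrow> v x = 0"
     "\<And>u. fourier v u = lag_mult (h * u) ^ m * fourier w u"
    using Suc unfolding v_def by auto
  have "avg (left_exp h) v x = 0" if "x \<le> a" for x
  proof -
    have "v (x + y) * left_exp h y = 0" for y
      using v(2)[of "x + y"] that by (auto simp: left_exp_def)
    then have "(\<lambda>y. v (x + y) * left_exp h y) = (\<lambda>y. 0)" by (rule ext)
    then show ?thesis by (simp add: avg_def)
  qed
  then show ?case
    using L1_bdd_avg[OF left_exp_integrable[OF h] v(1)]
      fourier_avg[OF left_exp_integrable[OF h] L1_bddD(1)[OF v(1)]] v(3)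
    by (simp flip: v_def add: fourier_left_exp[OF h])
qed

lemma norm_one_minus_i: "norm (1 - \<i> * complex_of_real s) = sqrt (1 + s\<^sup>2)"
  by (simp add: cmod_def)

text \<open>A function that vanishes to the left of \<open>a\<close> stays so under averaging to the left.  The
  \<open>m\<close>-fold average is continuous, so its value at \<open>a\<close>, which the inversion formula expresses
  through the transform, is zero.\<close>

lemma one_sided_fourier_integral_0:
  assumes h: "h > 0" and w: "L1_bdd w" "\<And>x. x \<le> a \<Longrightarrow> w x = 0" and m: "m \<ge> 1"
  shows "integrable lborel (\<lambda>u. iexp_neg (a * u) * (lag_mult (h * u) ^ m * fourier w u)) \<and>
     (LINT u|lborel. iexp_neg (a * u) * (lag_mult (h * u) ^ m * fourier w u)) = 0"
proof -
  obtain n where n: "m = Suc n" using m by (cases m) auto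
  define v where "v = (avg (left_exp h) ^^ n) w"
  define V where "V = avg (left_exp h) v"
  have v: "L1_bdd v" using one_sided_avg_funpow[OF h w, where m = n] unfolding v_def by blast
  have V: "L1_bdd V" "V a = 0" "fourier V = (\<lambda>u. lag_mult (h * u) ^ m * fourier w u)"
    using one_sided_avg_funpow[OF h w, where m = m] unfolding V_def v_def n by auto
  obtain B where B: "\<And>x. norm (v x) \<le> B" "v \<in> borel_measurable borel" using L1_bddD[OF v] by auto
  have "isCont V a" unfolding V_def by (rule avg_isCont[OF left_exp_integrable[OF h] B(2,1)])
  moreover have int: "integrable lborel (fourier V)"
    unfolding V(3)
  proof (rule integrable_mult_L2)
    have [measurable]: "w \<in> borel_measurable borel" using L1_bddD[OF w(1)] by auto
    show "fourier w \<in> borel_measurable lborel" by measurable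
    show "integrable lborel (\<lambda>u. (norm (lag_mult (h * u) ^ m))\<^sup>2)"
    proof (rule Bochner_Integration.integrable_bound[OF integrable_inverse_1_plus_square_scaled(1)[OF h]])
      have "(norm (lag_mult (h * u) ^ m))\<^sup>2 \<le> 1 / (1 + (h * u)\<^sup>2)" for u
      proof -
        have "(norm (lag_mult (h * u) ^ m))\<^sup>2 = (1 / (1 + (h * u)\<^sup>2)) ^ m"
          by (simp only: norm_power norm_divide norm_one_minus_i norm_one power_divide power_mult[symmetric])
             (simp add: mult.commute[of m] power_mult)
        also have "\<dots> \<le> (1 / (1 + (h * u)\<^sup>2)) ^ 1"
          by (rule power_decreasing[OF m]) (simp_all add: divide_le_eq_1 add_pos_nonneg)
        finally show ?thesis by simp
      qed
      then show "AE u in lborel. norm ((norm (lag_mult (h * u) ^ m))\<^sup>2) \<le> norm (1 / (1 + (h * u)\<^sup>2))"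
        by auto
    qed measurable
    show "integrable lborel (\<lambda>u. (norm (fourier w u))\<^sup>2)" by (rule fourier_square_integrable[OF w(1)])
  qed measurable
  ultimately have "(LINT u|lborel. iexp_neg (a * u) * fourier V u) = 0"
    using fourier_inversion[OF V(1)] V(2) by simp
  moreover have "integrable lborel (\<lambda>u. iexp_neg (a * u) * fourier V u)"
    using integrable_exp_i[OF int, of "-a"] by (simp add: mult.commute)
  ultimately show ?thesis unfolding V(3) by simp
qed

text \<open>A factor \<open>u\<close> is traded for one factor \<open>lag_mult\<close>, because \<open>h * u\<close> is an affine function of the
  inverse of \<open>lag_mult (h * u)\<close>.\<close>

lemma one_sided_fourier_moment_0:
  assumes h: "h > 0" and w: "L1_bdd w" "\<And>x. x \<le> a \<Longrightarrow> w x = 0" and m: "j + 1 \<le> m"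
  shows "integrable lborel (\<lambda>u. iexp_neg (a * u) * (complex_of_real u ^ j * lag_mult (h * u) ^ m * fourier w u)) \<and>
     (LINT u|lborel. iexp_neg (a * u) * (complex_of_real u ^ j * lag_mult (h * u) ^ m * fourier w u)) = 0"
  using m
proof (induction j arbitrary: m)
  case 0
  then show ?case using one_sided_fourier_integral_0[OF h w, where m = m] by simp
next
  case (Suc j)
  obtain n where n: "m = Suc n" "j + 1 \<le> n" using Suc.prems by (cases m) auto
  define f where "f m u = iexp_neg (a * u) * (complex_of_real u ^ j * lag_mult (h * u) ^ m * fourier w u)" for m u
  have eq: "iexp_neg (a * u) * (complex_of_real u ^ Suc j * lag_mult (h * u) ^ m * fourier w u)
     = (\<i> / complex_of_real h) * (f n u - f m u)" for u
  proof -
    define z where "z = 1 - \<i> * complex_of_real (h * u)"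
    have z: "z \<noteq> 0" by (auto simp: z_def complex_eq_iff)
    have u: "complex_of_real u = (\<i> / complex_of_real h) * (z - 1)" using h by (simp add: z_def)
    have "complex_of_real u * (1 / z) ^ m = (\<i> / complex_of_real h) * ((1 / z) ^ n - (1 / z) ^ m)"
      unfolding u n using z by (simp add: field_simps)
    then have "complex_of_real u ^ j * (iexp_neg (a * u) * fourier w u) * (complex_of_real u * (1 / z) ^ m) =
      complex_of_real u ^ j * (iexp_neg (a * u) * fourier w u) * ((\<i> / complex_of_real h) * ((1 / z) ^ n - (1 / z) ^ m))"
      by (rule arg_cong)
    then show ?thesis unfolding f_def z_def[symmetric]
      by (simp only: power_Suc right_diff_distrib mult_ac)
  qed
  have "integrable lborel (f n) \<and> integral\<^sup>L lborel (f n) = 0" "integrable lborel (f m) \<and> integral\<^sup>L lborel (f m) = 0"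
    unfolding f_def using Suc.IH[of n] Suc.IH[of m] n Suc.prems by auto
  then show ?case unfolding eq by simp
qed


text \<open>The symbol of the identity minus one step, when the transform of the step is \<open>exp (- r u^(2N))\<close>.\<close>

definition gap :: "nat \<Rightarrow> real \<Rightarrow> real \<Rightarrow> real" where
  "gap N r u = 1 - exp (- (r * u ^ (2 * N)))"

text \<open>Up to the factor \<open>2 * pi\<close>, the inner product of \<open>w - avg q w\<close> with \<open>w\<close>.\<close>

abbreviation gap_energy :: "nat \<Rightarrow> real \<Rightarrow> (real \<Rightarrow> complex) \<Rightarrow> real" where
  "gap_energy N r w \<equiv> LINT u|lborel. gap N r u * (norm (fourier w u))\<^sup>2"

text \<open>The quotient \<open>gap N r u / u ^ (2 * N)\<close> is a cutoff at frequency \<open>1 / h\<close> when \<open>r = c * h ^ (2 * N)\<close>, so that up to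
  the factor \<open>h ^ (2 * N)\<close> and a constant this is the \<open>j\<close>-th derivative at \<open>a\<close> of \<open>w\<close> smoothed at scale \<open>h\<close>.\<close>

abbreviation end_moment :: "nat \<Rightarrow> real \<Rightarrow> nat \<Rightarrow> real \<Rightarrow> (real \<Rightarrow> complex) \<Rightarrow> complex" where
  "end_moment N r j a w \<equiv> LINT u|lborel. iexp_neg (a * u) * (complex_of_real (u ^ j * (gap N r u / u ^ (2 * N))) * fourier w u)"

lemma gap_borel [measurable]: "gap N r \<in> borel_measurable borel"
  unfolding gap_def[abs_def] by measurable

lemma even_power_nonneg: "0 \<le> (u::real) ^ (2 * N)"
  by (rule zero_le_even_power) simp

lemma gap_nonneg: "r \<ge> 0 \<Longrightarrow> 0 \<le> gap N r u"
  by (simp add: gap_def even_power_nonneg)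

lemma gap_le_1: "gap N r u \<le> 1"
  by (simp add: gap_def)

lemma gap_le: "gap N r u \<le> r * u ^ (2 * N)"
  using exp_ge_add_one_self[of "- (r * u ^ (2 * N))"] by (simp add: gap_def)

lemma exp_minus_le_inverse: "(y::real) \<ge> 0 \<Longrightarrow> exp (- y) \<le> 1 / (1 + y)"
  using exp_ge_add_one_self[of y] by (simp add: exp_minus inverse_eq_divide frac_le)

lemma gap_ge: "r \<ge> 0 \<Longrightarrow> r * u ^ (2 * N) / (1 + r * u ^ (2 * N)) \<le> gap N r u"
proof -
  assume r: "r \<ge> 0"
  define y where "y = r * u ^ (2 * N)"
  have y: "y \<ge> 0" using r by (simp add: y_def even_power_nonneg)
  have "y / (1 + y) = 1 - 1 / (1 + y)" using y by (simp add: field_simps)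
  also have "\<dots> \<le> 1 - exp (- y)" using exp_minus_le_inverse[OF y] by simp
  finally show ?thesis by (simp add: gap_def y_def)
qed

lemma gap_approx: "r \<ge> 0 \<Longrightarrow> \<bar>gap N r u - r * u ^ (2 * N)\<bar> \<le> (r * u ^ (2 * N))\<^sup>2"
proof -
  assume r: "r \<ge> 0"
  define y where "y = r * u ^ (2 * N)"
  have y: "y \<ge> 0" using r by (simp add: y_def even_power_nonneg)
  have "1 / (1 + y) \<le> 1 - y + y\<^sup>2"
  proof -
    have "1 \<le> (1 - y + y\<^sup>2) * (1 + y)"
      using y zero_le_power[OF y, of 3] by (simp add: algebra_simps power2_eq_square power3_eq_cube)
    then show ?thesis using y by (simp add: divide_le_eq add_pos_nonneg)
  qed
  then have "exp (- y) \<le> 1 - y + y\<^sup>2" using exp_minus_le_inverse[OF y] by linarith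
  then show ?thesis using gap_le[of N r u] unfolding gap_def y_def[symmetric] by simp
qed

lemma gap_pos: "r > 0 \<Longrightarrow> u \<noteq> 0 \<Longrightarrow> 0 < gap N r u"
  by (simp add: gap_def power_mult)

lemma gap_0: "N \<ge> 1 \<Longrightarrow> gap N r 0 = 0"
  by (simp add: gap_def)

lemma gap_scale: "gap N c (h * u) = gap N (c * h ^ (2 * N)) u"
  by (simp add: gap_def power_mult_distrib mult.assoc)

lemma gap_ge_near:
  assumes c: "c > 0" and u: "\<bar>u\<bar> \<le> 1"
  shows "c / (1 + c) * u ^ (2 * N) \<le> gap N c u"
proof -
  define x where "x = u ^ (2 * N)"
  have x: "0 \<le> x" "x \<le> 1" using u by (auto simp: x_def even_power_nonneg power_mult power_le_one abs_square_le_1)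
  have "c / (1 + c) * x \<le> c * x / (1 + c * x)"
    using c x by (simp, intro frac_le) (auto simp: mult_left_le add_pos_nonneg)
  then show ?thesis using gap_ge[of c u N] c unfolding x_def by linarith
qed

lemma gap_ge_far:
  assumes c: "c > 0" and u: "\<bar>u\<bar> \<ge> 1"
  shows "c / (1 + c) \<le> gap N c u"
proof -
  define x where "x = u ^ (2 * N)"
  have x: "1 \<le> x" using u by (simp add: x_def power_mult one_le_power abs_le_square_iff[of 1 u, simplified])
  have "c \<le> c * x" using c x by simp
  then have "c / (1 + c) \<le> c * x / (1 + c * x)"
    using c by (simp add: field_simps add_pos_pos)
  then show ?thesis using gap_ge[of c u N] c unfolding x_def by linarith
qed

text \<open>The transform of a one-sided kernel whose moments of order \<open>1, \<dots>, N - 1\<close> vanish: near \<open>0\<close> it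
  differs from \<open>1\<close> by \<open>O(s\<^sup>N)\<close>, and it decays like \<open>s\<^sup>-\<^sup>N\<close>.\<close>

definition one_sided_mult :: "nat \<Rightarrow> real \<Rightarrow> complex" where
  "one_sided_mult N s = 1 - (1 - lag_mult s ^ N) ^ N"

lemma one_sided_mult_borel [measurable]: "one_sided_mult N \<in> borel_measurable borel"
  unfolding one_sided_mult_def[abs_def] by measurable

lemma norm_inverse_one_minus_i: "norm (lag_mult s) = 1 / sqrt (1 + s\<^sup>2)"
  by (simp only: norm_divide norm_one norm_one_minus_i)

lemma one_sided_mult_near:
  "norm (1 - one_sided_mult N s) \<le> real N ^ N * \<bar>s\<bar> ^ N"
proof -
  define z where "z = 1 / (1 - \<i> * complex_of_real s)"
  have z1: "norm z \<le> 1" unfolding z_def norm_inverse_one_minus_i by (simp add: divide_le_eq_1 add_pos_nonneg)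
  have "1 - \<i> * complex_of_real s \<noteq> 0" by (auto simp: complex_eq_iff)
  then have "1 - z = - \<i> * complex_of_real s * z" by (simp add: z_def field_simps)
  then have "norm (1 - z) = \<bar>s\<bar> * norm z" by (simp add: norm_mult)
  also have "\<dots> \<le> \<bar>s\<bar>" using z1 by (simp add: mult_left_le)
  finally have "norm (1 - z) \<le> \<bar>s\<bar>" .
  moreover have "norm (1 ^ N - z ^ N) \<le> real N * norm (1 - z)"
    using z1 by (intro norm_power_diff) auto
  ultimately have "norm (1 - z ^ N) \<le> real N * \<bar>s\<bar>"
    by (smt (verit) mult_left_mono of_nat_0_le_iff power_one)
  then have "norm (1 - z ^ N) ^ N \<le> (real N * \<bar>s\<bar>) ^ N" by (intro power_mono) auto
  then show ?thesis by (simp add: one_sided_mult_def z_def norm_power power_mult_distrib)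
qed

lemma one_sided_mult_far:
  assumes s: "\<bar>s\<bar> \<ge> 1"
  shows "norm (one_sided_mult N s) \<le> 2 ^ N * real N / \<bar>s\<bar> ^ N"
proof -
  define x where "x = lag_mult s ^ N"
  have "1 / sqrt (1 + s\<^sup>2) \<le> 1 / \<bar>s\<bar>"
    using s by (intro frac_le) (auto intro: real_le_rsqrt)
  then have xs: "norm x \<le> (1 / \<bar>s\<bar>) ^ N"
    unfolding x_def norm_power norm_inverse_one_minus_i by (intro power_mono) auto
  have "(1 / \<bar>s\<bar>) ^ N \<le> 1" using s by (intro power_le_one) auto
  with xs have x1: "norm x \<le> 1" by linarith
  have "norm ((1 - x) / 2) \<le> 1" using norm_triangle_ineq4[of 1 x] x1 by (simp add: norm_divide)
  then have "norm ((1/2) ^ N - ((1 - x) / 2) ^ N) \<le> real N * norm (1/2 - (1 - x) / 2)"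
    by (intro norm_power_diff) auto
  also have "1/2 - (1 - x) / 2 = x / 2" by (simp add: field_simps)
  also have "(1/2) ^ N - ((1 - x) / 2) ^ N = one_sided_mult N s / 2 ^ N"
    unfolding one_sided_mult_def x_def[symmetric] 
    by (simp only: power_divide power_one) (simp add: diff_divide_distrib)
  finally have "norm (one_sided_mult N s) / 2 ^ N \<le> real N * (norm x / 2)"
    by (simp add: norm_divide norm_power)
  also have "\<dots> \<le> real N * norm x" by (intro mult_left_mono) auto
  also have "\<dots> \<le> real N * (1 / \<bar>s\<bar>) ^ N" using xs by (intro mult_left_mono) auto
  finally show ?thesis by (simp add: field_simps power_divide)
qed

text \<open>\<open>one_sided_mult\<close> is a combination of powers of \<open>lag_mult\<close> with exponents at least \<open>N\<close>, enough to
  absorb \<open>u ^ j\<close> for every \<open>j < N\<close>.\<close>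

lemma one_sided_mult_integral_0:
  assumes h: "h > 0" and w: "L1_bdd w" "\<And>x. x \<le> a \<Longrightarrow> w x = 0" and j: "j < N"
  shows "integrable lborel (\<lambda>u. iexp_neg (a * u) * (complex_of_real u ^ j * one_sided_mult N (h * u) * fourier w u)) \<and>
     (LINT u|lborel. iexp_neg (a * u) * (complex_of_real u ^ j * one_sided_mult N (h * u) * fourier w u)) = 0"
proof -
  define f where "f m u = iexp_neg (a * u) * (complex_of_real u ^ j * lag_mult (h * u) ^ m * fourier w u)" for m u
  define \<beta> where "\<beta> k = - (of_nat (N choose k) * (-1) ^ k :: complex)" for k
  have f: "integrable lborel (f (N * k))" "integral\<^sup>L lborel (f (N * k)) = 0" if "k \<in> {1..N}" for k
  proof -
    have "N * 1 \<le> N * k" using that by (intro mult_le_mono) auto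
    then have "j + 1 \<le> N * k" using j by linarith
    then show "integrable lborel (f (N * k))" "integral\<^sup>L lborel (f (N * k)) = 0"
      using one_sided_fourier_moment_0[OF h w, where m = "N * k" and j = j] unfolding f_def by auto
  qed
  have expand: "one_sided_mult N s = (\<Sum>k\<in>{1..N}. \<beta> k * lag_mult s ^ (N * k))" for s
  proof -
    define z where "z = 1 / (1 - \<i> * complex_of_real s)"
    have "(1 - z ^ N) ^ N = (\<Sum>k\<le>N. of_nat (N choose k) * (- (z ^ N)) ^ k)"
      using binomial_ring[of "- (z ^ N)" 1 N] by (simp add: add.commute)
    also have "\<dots> = 1 + (\<Sum>k\<in>{1..N}. of_nat (N choose k) * (- (z ^ N)) ^ k)"
      unfolding atMost_atLeast0 by (subst sum.atLeast_Suc_atMost) auto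
    also have "(\<Sum>k\<in>{1..N}. of_nat (N choose k) * (- (z ^ N)) ^ k) = - (\<Sum>k\<in>{1..N}. \<beta> k * z ^ (N * k))"
      unfolding sum_negf[symmetric] \<beta>_def
      by (intro sum.cong refl) (simp add: power_minus[of "z ^ N"] power_mult)
    finally show ?thesis by (simp add: one_sided_mult_def z_def)
  qed
  have "(\<lambda>u. iexp_neg (a * u) * (complex_of_real u ^ j * one_sided_mult N (h * u) * fourier w u))
     = (\<lambda>u. \<Sum>k\<in>{1..N}. \<beta> k * f (N * k) u)"
    unfolding expand f_def by (auto simp: sum_distrib_left sum_distrib_right mult_ac intro!: sum.cong)
  moreover have "integrable lborel (\<lambda>u. \<Sum>k\<in>{1..N}. \<beta> k * f (N * k) u)"
    using f by (intro Bochner_Integration.integrable_sum integrable_mult_right) auto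
  moreover have "(LINT u|lborel. (\<Sum>k\<in>{1..N}. \<beta> k * f (N * k) u)) = 0"
    using f by (subst Bochner_Integration.integral_sum) (auto intro!: integrable_mult_right)
  ultimately show ?thesis by simp
qed

text \<open>This is where the order \<open>N\<close> of the one-sided kernel is needed.  The gap vanishes at \<open>0\<close> to the order
  \<open>2 * N\<close>, so the difference of the multipliers has to vanish to the order \<open>N\<close>; at infinity the weight
  \<open>\<bar>s\<bar> ^ (2 * j)\<close> with \<open>j \<le> N - 1\<close> is beaten by the decay \<open>\<bar>s\<bar> ^ (- 2 * N)\<close> of the squares.\<close>

lemma one_sided_mult_weight_bound:
  assumes N: "N \<ge> 1" and c: "c > 0"
  shows "\<exists>K>0. \<forall>j<N. \<forall>s. s \<noteq> 0 \<longrightarrow>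
    (\<bar>s\<bar> ^ j * norm (complex_of_real (gap N c s / s ^ (2 * N)) - complex_of_real c * one_sided_mult N s))\<^sup>2 / gap N c s
      \<le> K / (1 + s\<^sup>2)"
proof -
  define \<kappa> where "\<kappa> = c / (1 + c)"
  have \<kappa>: "\<kappa> > 0" using c by (simp add: \<kappa>_def)
  define K1 where "K1 = c\<^sup>2 + c * real N ^ N"
  define K2 where "K2 = 1 + c * (2 ^ N * real N)"
  have K: "K1 > 0" "K2 > 0" using c by (auto simp: K1_def K2_def intro!: add_pos_nonneg)
  define L where "L = (K1\<^sup>2 + K2\<^sup>2) / \<kappa>"
  define K where "K = 2 * L"
  have L: "K1\<^sup>2 / \<kappa> \<le> L" "K2\<^sup>2 / \<kappa> \<le> L" "L > 0"
    using \<kappa> K by (auto simp: L_def intro!: divide_right_mono divide_pos_pos add_pos_pos)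
  have K12: "K1\<^sup>2 / \<kappa> \<le> K / 2" "2 * (K2\<^sup>2 / \<kappa>) \<le> K"
    using L by (simp_all add: K_def)
  have "(\<bar>s\<bar> ^ j * norm (complex_of_real (gap N c s / s ^ (2 * N)) - complex_of_real c * one_sided_mult N s))\<^sup>2 / gap N c s
      \<le> K / (1 + s\<^sup>2)" if j: "j < N" and s: "s \<noteq> 0" for j s
  proof -
    define \<theta> where "\<theta> = gap N c s / s ^ (2 * N)"
    define d where "d = norm (complex_of_real \<theta> - complex_of_real c * one_sided_mult N s)"
    have s2: "s ^ (2 * N) > 0" using s by (simp add: power_mult)
    have g: "gap N c s > 0" using gap_pos[OF c s] .
    have abs_s2: "s ^ (2 * N) = \<bar>s\<bar> ^ N * \<bar>s\<bar> ^ N"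
      by (simp add: power_add[symmetric] mult_2[symmetric] power_even_abs)
    show ?thesis
    proof (cases "\<bar>s\<bar> \<le> 1")
      case True
      have "\<bar>\<theta> - c\<bar> = \<bar>gap N c s - c * s ^ (2 * N)\<bar> / s ^ (2 * N)"
      proof -
        have "\<theta> - c = (gap N c s - c * s ^ (2 * N)) / s ^ (2 * N)"
          using s by (simp add: \<theta>_def diff_divide_distrib)
        then show ?thesis using s2 by (simp add: abs_divide)
      qed
      also have "\<dots> \<le> (c * s ^ (2 * N))\<^sup>2 / s ^ (2 * N)"
        using gap_approx[of c N s] c s2 by (intro divide_right_mono) auto
      also have "\<dots> = c\<^sup>2 * \<bar>s\<bar> ^ N * \<bar>s\<bar> ^ N"
        using s2 by (simp add: power2_eq_square abs_s2)
      also have "\<dots> \<le> c\<^sup>2 * \<bar>s\<bar> ^ N * 1"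
        using True by (intro mult_left_mono power_le_one) auto
      finally have 1: "\<bar>\<theta> - c\<bar> \<le> c\<^sup>2 * \<bar>s\<bar> ^ N" by simp
      have "d = norm (complex_of_real (\<theta> - c) + complex_of_real c * (1 - one_sided_mult N s))"
        unfolding d_def by (simp add: algebra_simps)
      also have "\<dots> \<le> \<bar>\<theta> - c\<bar> + c * norm (1 - one_sided_mult N s)"
        using c by (intro norm_triangle_le) (simp add: norm_mult del: of_real_diff)
      also have "\<dots> \<le> c\<^sup>2 * \<bar>s\<bar> ^ N + c * (real N ^ N * \<bar>s\<bar> ^ N)"
        using 1 c one_sided_mult_near[of N s] by (intro add_mono mult_left_mono) auto
      finally have d: "d \<le> K1 * \<bar>s\<bar> ^ N" by (simp add: K1_def algebra_simps)
      have "\<bar>s\<bar> ^ j * d \<le> 1 * (K1 * \<bar>s\<bar> ^ N)"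
        using True d by (intro mult_mono power_le_one) (auto simp: d_def)
      then have "(\<bar>s\<bar> ^ j * d)\<^sup>2 \<le> (1 * (K1 * \<bar>s\<bar> ^ N))\<^sup>2"
        by (intro power_mono) (auto simp: d_def)
      then have "(\<bar>s\<bar> ^ j * d)\<^sup>2 \<le> K1\<^sup>2 * s ^ (2 * N)"
        unfolding abs_s2 by (simp only: power2_eq_square mult_1 mult_ac)
      then have "(\<bar>s\<bar> ^ j * d)\<^sup>2 / gap N c s \<le> K1\<^sup>2 * s ^ (2 * N) / (\<kappa> * s ^ (2 * N))"
        using gap_ge_near[OF c True, of N] mult_pos_pos[OF \<kappa> s2] by (intro frac_le) (simp_all add: \<kappa>_def)
      also have "\<dots> = K1\<^sup>2 / \<kappa>" using s by simp
      also have "\<dots> \<le> K / 2" by (rule K12)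
      also have "\<dots> \<le> K / (1 + s\<^sup>2)"
        using L True by (intro divide_left_mono) (auto simp: K_def abs_square_le_1 add_pos_nonneg)
      finally show ?thesis by (simp add: d_def \<theta>_def)
    next
      case False
      then have s1: "\<bar>s\<bar> \<ge> 1" by simp
      have sN: "\<bar>s\<bar> ^ N \<ge> 1" using s1 by (rule one_le_power)
      have "\<theta> \<le> 1 / s ^ (2 * N)" unfolding \<theta>_def
        using gap_le_1[of N c s] s2 by (intro divide_right_mono) auto
      also have "\<dots> \<le> 1 / \<bar>s\<bar> ^ N" unfolding abs_s2 using sN s
        by (intro divide_left_mono) (auto simp: mult_le_cancel_left1)
      finally have \<theta>: "\<theta> \<le> 1 / \<bar>s\<bar> ^ N" .
      have \<theta>0: "\<theta> \<ge> 0" using g s2 by (simp add: \<theta>_def)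
      have "d \<le> \<theta> + c * norm (one_sided_mult N s)"
        unfolding d_def using c \<theta>0 norm_triangle_ineq4[of "complex_of_real \<theta>" "complex_of_real c * one_sided_mult N s"]
        by (simp add: norm_mult)
      also have "\<dots> \<le> 1 / \<bar>s\<bar> ^ N + c * (2 ^ N * real N / \<bar>s\<bar> ^ N)"
        using c \<theta> one_sided_mult_far[OF s1, of N] by (intro add_mono mult_left_mono) auto
      finally have d: "d \<le> K2 / \<bar>s\<bar> ^ N" by (simp add: K2_def add_divide_distrib)
      have "\<bar>s\<bar> ^ j * d \<le> \<bar>s\<bar> ^ (N - 1) * (K2 / \<bar>s\<bar> ^ N)"
        using s1 j d K by (intro mult_mono power_increasing) (auto simp: d_def)
      also have "\<dots> = K2 / \<bar>s\<bar>" using N s by (cases N) (auto simp: field_simps)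
      finally have "(\<bar>s\<bar> ^ j * d)\<^sup>2 \<le> (K2 / \<bar>s\<bar>)\<^sup>2"
        by (intro power_mono) (auto simp: d_def)
      then have "(\<bar>s\<bar> ^ j * d)\<^sup>2 / gap N c s \<le> (K2\<^sup>2 / s\<^sup>2) / \<kappa>"
        using gap_ge_far[OF c s1, of N] \<kappa> by (intro frac_le) (auto simp: \<kappa>_def power_divide)
      also have "\<dots> = 2 * (K2\<^sup>2 / \<kappa>) / (2 * s\<^sup>2)" by simp
      also have "\<dots> \<le> K / (2 * s\<^sup>2)" using K12(2) by (rule divide_right_mono) simp
      also have "\<dots> \<le> K / (1 + s\<^sup>2)"
        using L s s1 abs_le_square_iff[of 1 s] by (intro divide_left_mono) (auto simp: K_def intro!: mult_pos_pos add_pos_nonneg)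
      finally show ?thesis by (simp add: d_def \<theta>_def)
    qed
  qed
  moreover have "K > 0" using L by (simp add: K_def)
  ultimately show ?thesis by blast
qed

text \<open>If the cutoff \<open>gap / u ^ (2 * N)\<close> were the transform of a one-sided kernel, the moment would vanish,
  being a derivative at \<open>a\<close> of a function that is \<open>0\<close> to the left of \<open>a\<close>.  Subtracting such a kernel leaves an
  error that the energy controls by Cauchy-Schwarz.  With \<open>t = h ^ (2 * N)\<close> the bound is
  \<open>sqrt t * sqrt h * sqrt W\<close>, where \<open>W\<close> is the energy; a bare \<open>sqrt t\<close> would not force the energy to be \<open>o(t)\<close>,
  and the gain \<open>sqrt h\<close> is what the hypothesis \<open>j < N\<close> buys.\<close>

proposition boundary_estimate:
  assumes N: "N \<ge> 1" and c: "c > 0"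
  shows "\<exists>K>0. \<forall>h w a j. 0 < h \<longrightarrow> h \<le> 1 \<longrightarrow> L1_bdd w \<longrightarrow> (\<forall>x\<le>a. w x = 0) \<longrightarrow> j < N \<longrightarrow>
     norm (end_moment N (c * h ^ (2 * N)) j a w)
      \<le> K * h ^ N * sqrt h * sqrt (gap_energy N (c * h ^ (2 * N)) w)"
proof -
  obtain K where K: "K > 0" "\<And>j s. j < N \<Longrightarrow> s \<noteq> 0 \<Longrightarrow>
    (\<bar>s\<bar> ^ j * norm (complex_of_real (gap N c s / s ^ (2 * N)) - complex_of_real c * one_sided_mult N s))\<^sup>2 / gap N c s
      \<le> K / (1 + s\<^sup>2)"
    using one_sided_mult_weight_bound[OF N c] by blast
  have "norm (end_moment N (c * h ^ (2 * N)) j a w)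
      \<le> sqrt (K * pi) * h ^ N * sqrt h * sqrt (gap_energy N (c * h ^ (2 * N)) w)"
    if h: "0 < h" "h \<le> 1" and w: "L1_bdd w" "\<And>x. x \<le> a \<Longrightarrow> w x = 0" and j: "j < N" for h w a j
  proof -
    have [measurable]: "w \<in> borel_measurable borel" using L1_bddD[OF w(1)] by auto
    define D where "D u = gap N (c * h ^ (2 * N)) u" for u
    have D_scale: "D u = gap N c (h * u)" for u by (simp add: D_def gap_scale)
    have D: "D u \<ge> 0" "D u \<le> 1" "u \<noteq> 0 \<Longrightarrow> D u > 0" for u
      unfolding D_scale using c h by (auto simp: gap_nonneg gap_le_1 gap_pos)
    have [measurable]: "D \<in> borel_measurable borel" unfolding D_def[abs_def] by measurable
    define \<delta> where "\<delta> s = complex_of_real (gap N c s / s ^ (2 * N)) - complex_of_real c * one_sided_mult N s" for s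
    have [measurable]: "\<delta> \<in> borel_measurable borel" unfolding \<delta>_def[abs_def] by measurable
    \<comment> \<open>The integrand is split as \<open>f * g\<close> with \<open>sq_norm g\<close> equal to the energy.\<close>
    define f where "f u = iexp_neg (a * u) * complex_of_real (u ^ j / sqrt (D u)) * \<delta> (h * u)" for u
    define g where "g u = complex_of_real (sqrt (D u)) * fourier w u" for u
    have [measurable]: "f \<in> borel_measurable borel" "g \<in> borel_measurable borel"
      unfolding f_def[abs_def] g_def[abs_def] by measurable
    have f_bound: "(norm (f u))\<^sup>2 \<le> K / h ^ (2 * j) * (1 / (1 + (h * u)\<^sup>2))" if u: "u \<noteq> 0" for u
    proof -
      have "(norm (f u))\<^sup>2 = (\<bar>u\<bar> ^ j * norm (\<delta> (h * u)))\<^sup>2 / D u"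
        using D(1)[of u] by (simp add: f_def norm_mult norm_divide norm_power power_mult_distrib power_divide)
      also have "\<dots> = ((\<bar>h * u\<bar> ^ j * norm (\<delta> (h * u)))\<^sup>2 / gap N c (h * u)) / h ^ (2 * j)"
        using h by (simp add: D_scale abs_mult power_mult_distrib power_mult[symmetric] mult.commute[of j])
      also have "\<dots> \<le> (K / (1 + (h * u)\<^sup>2)) / h ^ (2 * j)"
        unfolding \<delta>_def using h u j by (intro divide_right_mono K(2)) auto
      finally show ?thesis by (simp add: mult.commute)
    qed
    have AEf: "AE u in lborel. (norm (f u))\<^sup>2 \<le> K / h ^ (2 * j) * (1 / (1 + (h * u)\<^sup>2))"
      using AE_lborel_singleton[of 0] by eventually_elim (rule f_bound)
    have f2: "integrable lborel (\<lambda>u. (norm (f u))\<^sup>2)"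
    proof (rule Bochner_Integration.integrable_bound)
      show "integrable lborel (\<lambda>u. K / h ^ (2 * j) * (1 / (1 + (h * u)\<^sup>2)))"
        by (intro integrable_mult_right integrable_inverse_1_plus_square_scaled h)
      show "AE u in lborel. norm ((norm (f u))\<^sup>2) \<le> norm (K / h ^ (2 * j) * (1 / (1 + (h * u)\<^sup>2)))"
        using AEf by eventually_elim (use K(1) in simp)
    qed measurable
    have If: "sq_norm f \<le> K * pi / h ^ (2 * j + 1)"
    proof -
      have "sq_norm f \<le> (LINT u|lborel. K / h ^ (2 * j) * (1 / (1 + (h * u)\<^sup>2)))"
        using f2 AEf by (intro integral_mono_AE integrable_mult_right integrable_inverse_1_plus_square_scaled h)
      also have "\<dots> = K / h ^ (2 * j) * (pi / h)"
        by (simp only: Bochner_Integration.integral_mult_right_zero integrable_inverse_1_plus_square_scaled(2)[OF h(1)])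
      finally show ?thesis by (simp add: mult.commute)
    qed
    have g2eq: "(norm (g u))\<^sup>2 = D u * (norm (fourier w u))\<^sup>2" for u
      using D(1)[of u] by (simp add: g_def norm_mult power_mult_distrib)
    have g2: "integrable lborel (\<lambda>u. (norm (g u))\<^sup>2)"
      by (rule Bochner_Integration.integrable_bound[OF fourier_square_integrable[OF w(1)]])
         (use D in \<open>auto simp: g2eq abs_mult intro!: mult_left_le_one_le AE_I2\<close>)
    have fg: "integrable lborel (\<lambda>u. f u * g u)" by (rule integrable_mult_L2[OF _ _ f2 g2]) auto
    define r where "r u = iexp_neg (a * u) * (complex_of_real u ^ j * one_sided_mult N (h * u) * fourier w u)" for u
    have r: "integrable lborel r" "integral\<^sup>L lborel r = 0"
      using one_sided_mult_integral_0[OF h(1) w j] unfolding r_def by auto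
    have split: "iexp_neg (a * u) * (complex_of_real (u ^ j * (gap N (c * h ^ (2 * N)) u / u ^ (2 * N))) * fourier w u)
       = complex_of_real (h ^ (2 * N)) * (f u * g u + complex_of_real c * r u)" if u: "u \<noteq> 0" for u
    proof -
      have "f u * g u = iexp_neg (a * u) * complex_of_real (u ^ j) * \<delta> (h * u) * fourier w u"
        using D(3)[OF u] by (simp add: f_def g_def)
      then have "f u * g u + complex_of_real c * r u = iexp_neg (a * u) * complex_of_real (u ^ j) *
          complex_of_real (D u / (h * u) ^ (2 * N)) * fourier w u"
        unfolding r_def \<delta>_def D_scale by (simp add: algebra_simps)
      then show ?thesis using h u by (simp add: D_def power_mult_distrib)
    qed
    have "end_moment N (c * h ^ (2 * N)) j a w
      = (LINT u|lborel. complex_of_real (h ^ (2 * N)) * (f u * g u + complex_of_real c * r u))"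
    proof (rule integral_cong_AE)
      have [measurable]: "r \<in> borel_measurable borel" using r(1) by (auto dest: borel_measurable_integrable)
      show "(\<lambda>u. complex_of_real (h ^ (2 * N)) * (f u * g u + complex_of_real c * r u)) \<in> borel_measurable lborel" by measurable
      show "AE u in lborel. iexp_neg (a * u) * (complex_of_real (u ^ j * (gap N (c * h ^ (2 * N)) u / u ^ (2 * N))) * fourier w u)
       = complex_of_real (h ^ (2 * N)) * (f u * g u + complex_of_real c * r u)"
        using AE_lborel_singleton[of 0] by eventually_elim (rule split)
    qed measurable
    also have "\<dots> = complex_of_real (h ^ (2 * N)) * (LINT u|lborel. f u * g u)"
      using fg r by simp
    also have "norm \<dots> \<le> h ^ (2 * N) * (sqrt (K * pi / h ^ (2 * j + 1)) * sqrt (sq_norm g))"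
    proof -
      have "norm (LINT u|lborel. f u * g u) \<le> sqrt (sq_norm f) * sqrt (sq_norm g)"
        using Cauchy_Schwarz_L2[OF _ _ f2 g2] by (intro order_trans[OF integral_norm_bound]) auto
      also have "\<dots> \<le> sqrt (K * pi / h ^ (2 * j + 1)) * sqrt (sq_norm g)"
        using If by (intro mult_right_mono real_sqrt_le_mono) auto
      finally show ?thesis using h by (simp add: norm_mult norm_power)
    qed
    also have "\<dots> \<le> sqrt (K * pi) * h ^ N * sqrt h * sqrt (sq_norm g)"
    proof -
      have "h ^ (2 * N) * sqrt (K * pi / h ^ (2 * j + 1)) = sqrt (K * pi) * (h ^ (2 * N) / sqrt (h ^ (2 * j + 1)))"
        by (simp add: real_sqrt_divide)
      also have "\<dots> = sqrt (K * pi) * sqrt (h ^ (4 * N) / h ^ (2 * j + 1))"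
      proof -
        have "sqrt (h ^ (4 * N)) = h ^ (2 * N)"
          using h real_sqrt_abs[of "h ^ (2 * N)"] by (simp add: power_mult[symmetric])
        then show ?thesis by (simp add: real_sqrt_divide)
      qed
      also have "h ^ (4 * N) / h ^ (2 * j + 1) = h ^ (4 * N - (2 * j + 1))"
        using h j by (simp add: power_diff)
      \<comment> \<open>The exponent is smallest for \<open>j = N - 1\<close>.\<close>
      also have "sqrt (h ^ (4 * N - (2 * j + 1))) \<le> sqrt (h ^ (2 * N + 1))"
        using h j by (intro real_sqrt_le_mono power_decreasing) auto
      also have "sqrt (h ^ (2 * N + 1)) = h ^ N * sqrt h"
        
        proof -
          have "h ^ (2 * N + 1) = (h ^ N)\<^sup>2 * h" by (simp add: power_mult[symmetric] mult.commute)
          then show ?thesis using h by (simp add: real_sqrt_mult)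
        qed
      finally have "h ^ (2 * N) * sqrt (K * pi / h ^ (2 * j + 1)) \<le> sqrt (K * pi) * (h ^ N * sqrt h)"
        using K(1) by (auto intro: mult_left_mono)
      then have "h ^ (2 * N) * sqrt (K * pi / h ^ (2 * j + 1)) * sqrt (sq_norm g)
          \<le> sqrt (K * pi) * (h ^ N * sqrt h) * sqrt (sq_norm g)"
        by (rule mult_right_mono) simp
      then show ?thesis by (simp only: mult.assoc)
    qed
    finally show ?thesis by (simp only: g2eq D_def)
  qed
  then show ?thesis using K(1) by (intro exI[of _ "sqrt (K * pi)"]) auto
qed

section \<open>The exit problem for a single step law\<close>

lemma avg_add:
  fixes f g q :: "real \<Rightarrow> complex"
  assumes "integrable lborel q" "f \<in> borel_measurable borel" "g \<in> borel_measurable borel" "bounded (range f)" "bounded (range g)"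
  shows "avg q (\<lambda>x. f x + g x) x = avg q f x + avg q g x"
    and avg_diff: "avg q (\<lambda>x. f x - g x) x = avg q f x - avg q g x"
proof -
  obtain B C where "\<And>x. norm (f x) \<le> B" "\<And>x. norm (g x) \<le> C"
    using assms(4,5) by (auto simp: bounded_iff)
  then have "integrable lborel (\<lambda>y. f (x + y) * q y)" "integrable lborel (\<lambda>y. g (x + y) * q y)"
    using assms by (auto intro: avg_integrand_integrable)
  then show "avg q (\<lambda>x. f x + g x) x = avg q f x + avg q g x" "avg q (\<lambda>x. f x - g x) x = avg q f x - avg q g x"
    by (simp_all add: avg_def algebra_simps)
qed

lemma inverse_power_bound:
  fixes r u :: real
  assumes N: "N \<ge> 1" and r: "r > 0"
  shows "1 / (1 + r * u ^ (2 * N)) \<le> (2 + 1 / r) * (1 / (1 + u\<^sup>2))"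
proof -
  have p: "u ^ (2 * N) \<ge> 0" by (rule even_power_nonneg)
  have "u\<^sup>2 \<le> 1 + u ^ (2 * N)"
  proof (cases "u\<^sup>2 \<le> 1")
    case False
    then have "(u\<^sup>2) ^ 1 \<le> (u\<^sup>2) ^ N" using N by (intro power_increasing) auto
    then show ?thesis by (simp add: power_mult)
  qed (use p in linarith)
  then have "1 + u\<^sup>2 \<le> 2 + u ^ (2 * N)" by simp
  also have "\<dots> \<le> (2 + 1 / r) * (1 + r * u ^ (2 * N))"
    using r p by (simp add: algebra_simps)
  finally have "1 + u\<^sup>2 \<le> (2 + 1 / r) * (1 + r * u ^ (2 * N))" .
  moreover have "1 + u\<^sup>2 > 0" by (simp add: add_pos_nonneg)
  moreover have "1 + r * u ^ (2 * N) > 0" using r p by (simp add: add_pos_nonneg)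
  ultimately show ?thesis by (simp add: divide_le_eq pos_le_divide_eq mult.commute)
qed

lemma integrable_inverse_power:
  fixes r :: real
  assumes N: "N \<ge> 1" and r: "r > 0"
  shows "integrable lborel (\<lambda>u. 1 / (1 + r * u ^ (2 * N)))"
proof (rule Bochner_Integration.integrable_bound)
  show "integrable lborel (\<lambda>u. (2 + 1 / r) * (1 / (1 + u\<^sup>2)))"
    by (intro integrable_mult_right integrable_inverse_1_plus_square_lborel)
  have "norm (1 / (1 + r * u ^ (2 * N))) \<le> norm ((2 + 1 / r) * (1 / (1 + u\<^sup>2)))" for u
    using inverse_power_bound[OF N r, of u] r by (simp add: even_power_nonneg)
  then show "AE u in lborel. norm (1 / (1 + r * u ^ (2 * N))) \<le> norm ((2 + 1 / r) * (1 / (1 + u\<^sup>2)))" by simp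
qed measurable

lemma integrable_weighted_fourier_square:
  fixes m :: "real \<Rightarrow> real"
  assumes f: "L1_bdd f" and [measurable]: "m \<in> borel_measurable borel" and m: "\<And>u. 0 \<le> m u" "\<And>u. m u \<le> 1"
  shows "integrable lborel (\<lambda>u. m u * (norm (fourier f u))\<^sup>2)"
proof (rule Bochner_Integration.integrable_bound[OF fourier_square_integrable[OF f]])
  have [measurable]: "f \<in> borel_measurable borel" using L1_bddD[OF f] by auto
  show "(\<lambda>u. m u * (norm (fourier f u))\<^sup>2) \<in> borel_measurable lborel" by measurable
qed (use m in \<open>auto simp: abs_mult intro!: AE_I2 mult_left_le_one_le\<close>)

lemma norm_fourier_square_le_support:
  assumes f: "L1_bdd f" and supp: "\<And>x. x \<notin> {a<..<b} \<Longrightarrow> f x = 0" and ab: "a < b"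
  shows "(norm (fourier f u))\<^sup>2 \<le> (b - a) * sq_norm f"
proof -
  have [measurable]: "f \<in> borel_measurable borel" using L1_bddD[OF f] by auto
  let ?I = "\<lambda>x. indicator {a<..<b} x :: complex"
  have I2: "(norm (?I x))\<^sup>2 = indicator {a<..<b} x" for x :: real by (simp add: indicator_def)
  have "norm (fourier f u) \<le> (LINT x|lborel. norm (f x))" by (rule norm_fourier_le)
  also have "\<dots> = (LINT x|lborel. norm (?I x * f x))"
    using supp by (intro Bochner_Integration.integral_cong) (auto simp: indicator_def)
  also have "\<dots> \<le> sqrt (LINT x|lborel. (norm (?I x))\<^sup>2) * sqrt (sq_norm f)"
    by (rule Cauchy_Schwarz_L2) (use L1_bdd_square_integrable[OF f] ab in \<open>auto simp: I2\<close>)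
  also have "(LINT x|lborel. (norm (?I x))\<^sup>2) = b - a" using ab by (simp add: I2)
  finally have "(norm (fourier f u))\<^sup>2 \<le> (sqrt (b - a) * sqrt (sq_norm f))\<^sup>2"
    by (intro power_mono) auto
  also have "\<dots> = (b - a) * sq_norm f"
    using ab by (simp add: power_mult_distrib)
  finally show ?thesis .
qed

text \<open>By the previous bound the transform is too flat to be concentrated near \<open>0\<close>: at most half of its
  energy belongs to frequencies below \<open>pi / (2 * (b - a))\<close>.\<close>

lemma Poincare_fourier:
  fixes m :: "real \<Rightarrow> real"
  assumes f: "L1_bdd f" and supp: "\<And>x. x \<notin> {a<..<b} \<Longrightarrow> f x = 0" and ab: "a < b"
    and [measurable]: "m \<in> borel_measurable borel" and m: "\<And>u. 0 \<le> m u" "\<And>u. m u \<le> 1"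
    and m0: "\<And>u. \<bar>u\<bar> \<ge> pi / (2 * (b - a)) \<Longrightarrow> m0 \<le> m u" "0 \<le> m0"
  shows "m0 / 2 * sq_norm (fourier f) \<le> (LINT u|lborel. m u * (norm (fourier f u))\<^sup>2)"
proof -
  define \<eta> where "\<eta> = pi / (2 * (b - a))"
  define F where "F u = (norm (fourier f u))\<^sup>2" for u
  define E where "E = sq_norm f"
  have \<eta>: "\<eta> > 0" using ab by (simp add: \<eta>_def)
  have iF: "integrable lborel F" unfolding F_def by (rule fourier_square_integrable[OF f])
  have imF: "integrable lborel (\<lambda>u. m u * F u)"
    unfolding F_def using f m by (intro integrable_weighted_fourier_square) auto
  have IF: "integral\<^sup>L lborel F = 2 * pi * E" unfolding F_def E_def by (rule Plancherel[OF f])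
  have iI: "integrable lborel (\<lambda>u. (b - a) * E * indicator {-\<eta>..\<eta>} u)"
    using \<eta> by (intro integrable_mult_right) simp
  have low: "m0 * F u \<le> m u * F u + m0 * ((b - a) * E * indicator {-\<eta>..\<eta>} u)" for u
  proof (cases "\<bar>u\<bar> \<ge> \<eta>")
    case True
    have "m0 * F u \<le> m u * F u" using m0(1)[of u] True by (intro mult_right_mono) (auto simp: F_def \<eta>_def)
    moreover have "0 \<le> m0 * ((b - a) * E * indicator {-\<eta>..\<eta>} u)"
      using m0(2) ab by (auto simp: E_def indicator_def)
    ultimately show ?thesis by linarith
  next
    case False
    then have "indicator {-\<eta>..\<eta>} u = (1::real)" by (auto simp: indicator_def)
    moreover have "m0 * F u \<le> m0 * ((b - a) * E)"
      unfolding F_def E_def using norm_fourier_square_le_support[OF f supp ab] m0(2) by (intro mult_left_mono) auto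
    moreover have "0 \<le> m u * F u" using m by (simp add: F_def)
    ultimately show ?thesis by simp
  qed
  have "m0 * (2 * pi * E) = (LINT u|lborel. m0 * F u)" using iF IF by simp
  also have "\<dots> \<le> (LINT u|lborel. m u * F u + m0 * ((b - a) * E * indicator {-\<eta>..\<eta>} u))"
    by (intro integral_mono low Bochner_Integration.integrable_add imF iF integrable_mult_right iI)
  also have "\<dots> = (LINT u|lborel. m u * F u) + m0 * ((b - a) * E * (2 * \<eta>))"
    using \<eta> imF iI by simp
  also have "(b - a) * E * (2 * \<eta>) = pi * E"
    using ab by (simp only: \<eta>_def) (simp add: divide_simps)
  finally have "m0 * pi * E \<le> (LINT u|lborel. m u * F u)" by (simp add: algebra_simps)
  moreover have "m0 / 2 * integral\<^sup>L lborel F = m0 * pi * E" unfolding IF by simp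
  ultimately show ?thesis unfolding F_def[abs_def] by linarith
qed

text \<open>The transform is even in \<open>u\<close>, so the direction of the step does not matter.\<close>

locale step_law =
  fixes N :: nat and r :: real and q :: "real \<Rightarrow> complex"
  assumes N: "N \<ge> 1" and r: "r > 0" and q: "integrable lborel q"
    and fourier_q: "\<And>u. fourier q u = complex_of_real (exp (- (r * u ^ (2 * N))))"
begin

lemma q_borel [measurable]: "q \<in> borel_measurable borel"
  using q by (auto dest: borel_measurable_integrable)

lemma fourier_avg_q:
  "integrable lborel f \<Longrightarrow> fourier (avg q f) u = complex_of_real (exp (- (r * u ^ (2 * N)))) * fourier f u"
  using fourier_avg[OF q, of f u] by (simp add: fourier_q)

lemma exp_le_inverse_power: "exp (- (r * u ^ (2 * N))) \<le> 1 / (1 + r * u ^ (2 * N))"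
  using exp_minus_le_inverse[of "r * u ^ (2 * N)"] r by (simp add: even_power_nonneg)

lemma exp_power_integrable: "integrable lborel (\<lambda>u. exp (- (r * u ^ (2 * N))))"
  by (rule Bochner_Integration.integrable_bound[OF integrable_inverse_power[OF N r]])
     (use exp_le_inverse_power r in \<open>auto intro!: AE_I2 simp: even_power_nonneg\<close>)

lemma exp_power_square_integrable: "integrable lborel (\<lambda>u. (norm (complex_of_real (exp (- (r * u ^ (2 * N))))))\<^sup>2)"
  by (rule Bochner_Integration.integrable_bound[OF exp_power_integrable])
     (use r in \<open>auto intro!: AE_I2 simp: power2_eq_square even_power_nonneg mult_left_le\<close>)

lemma avg_q_isCont:
  assumes "f \<in> borel_measurable borel" "bounded (range f)"
  shows "isCont (avg q f) x"
proof -
  obtain B where "\<And>x. norm (f x) \<le> B" using assms(2) by (auto simp: bounded_iff)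
  then show ?thesis using avg_isCont[OF q assms(1)] by blast
qed

lemma avg_q_bounded:
  assumes "f \<in> borel_measurable borel" "bounded (range f)"
  shows "bounded (range (avg q f))"
proof -
  obtain B where "\<And>x. norm (f x) \<le> B" using assms(2) by (auto simp: bounded_iff)
  then show ?thesis using norm_avg_le[OF q assms(1)] by (auto simp: bounded_iff)
qed

lemma fourier_avg_q_integrable:
  assumes f: "L1_bdd f"
  shows "integrable lborel (\<lambda>u. complex_of_real (exp (- (r * u ^ (2 * N)))) * fourier f u)"
proof -
  have [measurable]: "f \<in> borel_measurable borel" using L1_bddD[OF f] by auto
  show ?thesis
    by (rule integrable_mult_L2) (use fourier_square_integrable[OF f] exp_power_square_integrable in auto)
qed

lemma norm_avg_q_le:
  assumes f: "L1_bdd f"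
  shows "norm (avg q f x) \<le> (LINT u|lborel. norm (complex_of_real (exp (- (r * u ^ (2 * N)))) * fourier f u)) / (2 * pi)"
proof -
  note fi = L1_bddD(1)[OF f]
  have eq: "fourier (avg q f) = (\<lambda>u. complex_of_real (exp (- (r * u ^ (2 * N)))) * fourier f u)"
    using fourier_avg_q[OF fi] by auto
  have "2 * pi * avg q f x = (LINT u|lborel. iexp_neg (x * u) * fourier (avg q f) u)"
  proof (rule fourier_inversion[symmetric])
    show "L1_bdd (avg q f)" by (rule L1_bdd_avg[OF q f])
    show "isCont (avg q f) x" using f by (intro avg_q_isCont L1_bddD(2)) (auto simp: L1_bdd_def)
    show "integrable lborel (fourier (avg q f))" unfolding eq by (rule fourier_avg_q_integrable[OF f])
  qed
  then have "norm (2 * pi * avg q f x) \<le> (LINT u|lborel. norm (iexp_neg (x * u) * fourier (avg q f) u))"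
    by (simp only: integral_norm_bound)
  then have "2 * pi * norm (avg q f x) \<le> (LINT u|lborel. norm (complex_of_real (exp (- (r * u ^ (2 * N)))) * fourier f u))"
    by (simp add: norm_mult eq)
  then show ?thesis by (simp add: field_simps)
qed

text \<open>The smoothing by one step turns convergence in \<open>L\<^sup>2\<close> into uniform convergence.\<close>

lemma norm_avg_q_le_L2:
  "\<exists>C\<ge>0. \<forall>f x. L1_bdd f \<longrightarrow> norm (avg q f x) \<le> C * sqrt (sq_norm f)"
proof -
  define C where "C = sqrt (LINT u|lborel. (norm (complex_of_real (exp (- (r * u ^ (2 * N))))))\<^sup>2) * sqrt (2 * pi) / (2 * pi)"
  have "norm (avg q f x) \<le> C * sqrt (sq_norm f)" if f: "L1_bdd f" for f x
  proof -
    have [measurable]: "f \<in> borel_measurable borel" using L1_bddD[OF f] by auto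
    have "(LINT u|lborel. norm (complex_of_real (exp (- (r * u ^ (2 * N)))) * fourier f u))
      \<le> sqrt (LINT u|lborel. (norm (complex_of_real (exp (- (r * u ^ (2 * N))))))\<^sup>2) * sqrt (sq_norm (fourier f))"
      by (rule Cauchy_Schwarz_L2) (use fourier_square_integrable[OF f] exp_power_square_integrable in auto)
    also have "sqrt (sq_norm (fourier f)) = sqrt (2 * pi) * sqrt (sq_norm f)"
      by (simp only: Plancherel[OF f] real_sqrt_mult)
    finally show ?thesis
      by (intro order_trans[OF norm_avg_q_le[OF f]]) (simp add: C_def divide_right_mono mult.assoc)
  qed
  moreover have "C \<ge> 0" by (simp add: C_def)
  ultimately show ?thesis by blast
qed

text \<open>One step from \<open>x\<close>, counted only if \<open>x\<close> still lies in \<open>(a, b)\<close>; its powers describe the walk killed at the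
  exit.\<close>

definition kill :: "real \<Rightarrow> real \<Rightarrow> (real \<Rightarrow> complex) \<Rightarrow> real \<Rightarrow> complex" where
  "kill a b f x = (if x \<in> {a<..<b} then avg q f x else 0)"

lemma kill_borel [measurable]:
  assumes [measurable]: "f \<in> borel_measurable borel"
  shows "kill a b f \<in> borel_measurable borel"
  unfolding kill_def[abs_def] by measurable

lemma L1_bdd_kill:
  assumes f: "f \<in> borel_measurable borel" "bounded (range f)"
  shows "L1_bdd (kill a b f)"
proof -
  obtain B where B: "\<And>x. norm (avg q f x) \<le> B" using avg_q_bounded[OF f] by (auto simp: bounded_iff)
  have [measurable]: "f \<in> borel_measurable borel" by (rule f)
  have B0: "B \<ge> 0" using B[of 0] norm_ge_zero order_trans by blast
  have "integrable lborel (kill a b f)"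
  proof (rule Bochner_Integration.integrable_bound[of _ "\<lambda>x. B * indicator {a..b} x"])
    show "integrable lborel (\<lambda>x. B * indicator {a..b} x)"
      by (intro integrable_mult_right integrable_real_indicator) (auto simp: emeasure_lborel_Icc_eq)
  qed (use B B0 in \<open>auto simp: kill_def indicator_def intro!: AE_I2\<close>)
  then show ?thesis using B B0 by (intro L1_bddI[where B = B]) (auto simp: kill_def)
qed

text \<open>One step multiplies the transform by \<open>exp (- r u^(2N))\<close>, which is bounded away from \<open>1\<close> at the frequencies
  that carry half of the energy of a function supported in \<open>(a, b)\<close>.\<close>

lemma kill_contraction:
  assumes ab: "a < b"
  shows "\<exists>\<rho>. 0 \<le> \<rho> \<and> \<rho> < 1 \<and> (\<forall>f. L1_bdd f \<longrightarrow> (\<forall>x. x \<notin> {a<..<b} \<longrightarrow> f x = 0) \<longrightarrow>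
     sqrt (sq_norm (kill a b f)) \<le> \<rho> * sqrt (sq_norm f))"
proof -
  define \<eta> where "\<eta> = pi / (2 * (b - a))"
  \<comment> \<open>The parameter is \<open>2 * r\<close> because the multiplier gets squared.\<close>
  define m0 where "m0 = gap N (2 * r) \<eta>"
  have \<eta>: "\<eta> > 0" using ab by (simp add: \<eta>_def)
  have m0: "0 < m0" "m0 \<le> 1" unfolding m0_def using gap_pos[of "2 * r" \<eta> N] gap_le_1 r \<eta> by auto
  have mono: "m0 \<le> gap N (2 * r) u" if "\<bar>u\<bar> \<ge> \<eta>" for u
  proof -
    have "\<eta> ^ (2 * N) \<le> \<bar>u\<bar> ^ (2 * N)" using that \<eta> by (intro power_mono) auto
    then have "\<eta> ^ (2 * N) \<le> u ^ (2 * N)" by (simp add: power_even_abs)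
    then show ?thesis using r by (simp add: m0_def gap_def)
  qed
  have "sqrt (sq_norm (kill a b f)) \<le> sqrt (1 - m0 / 2) * sqrt (sq_norm f)"
    if f: "L1_bdd f" and supp: "\<And>x. x \<notin> {a<..<b} \<Longrightarrow> f x = 0" for f
  proof -
    have f': "f \<in> borel_measurable borel" "bounded (range f)" using f by (auto simp: L1_bdd_def dest: borel_measurable_integrable)
    define E where "E = sq_norm f"
    have [measurable]: "f \<in> borel_measurable borel" by (rule f')
    have Qf: "L1_bdd (avg q f)" by (rule L1_bdd_avg[OF q f])
    have "sq_norm (kill a b f) \<le> sq_norm (avg q f)"
      using L1_bdd_square_integrable[OF Qf] L1_bdd_square_integrable[OF L1_bdd_kill[OF f']]
      by (intro integral_mono) (auto simp: kill_def)
    also have "2 * pi * \<dots> = sq_norm (fourier (avg q f))"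
      by (rule Plancherel[OF Qf, symmetric])
    also have "\<dots> = (LINT u|lborel. (norm (fourier f u))\<^sup>2 - gap N (2 * r) u * (norm (fourier f u))\<^sup>2)"
    proof (rule Bochner_Integration.integral_cong[OF refl])
      fix u
      have "(exp (- (r * u ^ (2 * N))))\<^sup>2 = 1 - gap N (2 * r) u"
        by (simp add: gap_def power2_eq_square exp_add[symmetric])
      then show "(norm (fourier (avg q f) u))\<^sup>2 = (norm (fourier f u))\<^sup>2 - gap N (2 * r) u * (norm (fourier f u))\<^sup>2"
        using fourier_avg_q[OF L1_bddD(1)[OF f]] by (simp add: norm_mult power_mult_distrib left_diff_distrib)
    qed
    also have "\<dots> = sq_norm (fourier f) - gap_energy N (2 * r) f"
      using fourier_square_integrable[OF f] integrable_weighted_fourier_square[OF f, of "gap N (2 * r)"] r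
      by (intro Bochner_Integration.integral_diff) (auto simp: gap_nonneg gap_le_1)
    also have "\<dots> \<le> (1 - m0 / 2) * sq_norm (fourier f)"
      using Poincare_fourier[OF f supp ab, of "gap N (2 * r)" m0] mono m0 r
      by (simp add: gap_nonneg gap_le_1 \<eta>_def left_diff_distrib)
    also have "\<dots> = 2 * pi * ((1 - m0 / 2) * E)" by (simp add: Plancherel[OF f] E_def)
    finally have "sq_norm (kill a b f) \<le> (1 - m0 / 2) * E" by simp
    then show ?thesis unfolding E_def by (metis real_sqrt_le_mono real_sqrt_mult)
  qed
  then show ?thesis using m0 by (intro exI[of _ "sqrt (1 - m0 / 2)"]) auto
qed

lemma kill_funpow_L1_bdd:
  assumes f: "f \<in> borel_measurable borel" "bounded (range f)"
  shows "L1_bdd ((kill a b ^^ Suc k) f) \<and> (\<forall>x. x \<notin> {a<..<b} \<longrightarrow> (kill a b ^^ Suc k) f x = 0)"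
proof (induction k)
  case 0
  have "kill a b f x = 0" if "x \<notin> {a<..<b}" for x using that by (auto simp: kill_def)
  then show ?case using L1_bdd_kill[OF f] by simp
next
  case (Suc k)
  then have "(kill a b ^^ Suc k) f \<in> borel_measurable borel" "bounded (range ((kill a b ^^ Suc k) f))"
    by (auto simp: L1_bdd_def dest: borel_measurable_integrable)
  then have "L1_bdd (kill a b ((kill a b ^^ Suc k) f))" by (rule L1_bdd_kill)
  moreover have "kill a b g x = 0" if "x \<notin> {a<..<b}" for g x using that by (auto simp: kill_def)
  ultimately show ?case by simp
qed

text \<open>The contraction property in \<open>L\<^sup>2\<close> makes the sum over the exit step converge geometrically and
  uniformly, although the law of a step is signed.\<close>

proposition exit_solution:
  assumes ab: "a < b" and f: "f \<in> borel_measurable borel" "bounded (range f)"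
  defines "f0 \<equiv> \<lambda>x. if x \<in> {a<..<b} then 0 else f x"
  shows "\<exists>u. u \<in> borel_measurable borel \<and> bounded (range u) \<and> (\<forall>x. x \<notin> {a<..<b} \<longrightarrow> u x = f x) \<and>
     (\<forall>x\<in>{a<..<b}. u x = avg q u x) \<and> (\<forall>x. (\<lambda>k. (kill a b ^^ k) f0 x) sums u x)"
proof -
  have [measurable]: "f \<in> borel_measurable borel" by (rule f)
  obtain B where B: "\<And>x. norm (f x) \<le> B" using f(2) by (auto simp: bounded_iff)
  have B0: "B \<ge> 0" using B[of 0] norm_ge_zero order_trans by blast
  have f0: "f0 \<in> borel_measurable borel" "bounded (range f0)" "\<And>x. norm (f0 x) \<le> B"
    unfolding f0_def using B B0 by (auto simp: bounded_iff intro!: exI[of _ B])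
  define v where "v k = (kill a b ^^ k) f0" for k
  have v_Suc: "v (Suc k) = kill a b (v k)" for k by (simp add: v_def)
  have vL: "L1_bdd (v (Suc k))" "\<And>x. x \<notin> {a<..<b} \<Longrightarrow> v (Suc k) x = 0" for k
    using kill_funpow_L1_bdd[OF f0(1,2)] unfolding v_def by blast+
  have v_borel [measurable]: "v k \<in> borel_measurable borel" for k
    using f0 L1_bddD(2)[OF vL(1)] by (cases k) (auto simp: v_def)
  obtain \<rho> where \<rho>: "0 \<le> \<rho>" "\<rho> < 1"
    "\<And>f. L1_bdd f \<Longrightarrow> (\<And>x. x \<notin> {a<..<b} \<Longrightarrow> f x = 0) \<Longrightarrow>
     sqrt (sq_norm (kill a b f)) \<le> \<rho> * sqrt (sq_norm f)"
    using kill_contraction[OF ab] by blast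
  obtain C where C: "C \<ge> 0" "\<And>f x. L1_bdd f \<Longrightarrow> norm (avg q f x) \<le> C * sqrt (sq_norm f)"
    using norm_avg_q_le_L2 by blast
  define n0 where "n0 = sqrt (LINT x|lborel. (norm (v (Suc 0) x))\<^sup>2)"
  have norm_v: "sqrt (LINT x|lborel. (norm (v (Suc k) x))\<^sup>2) \<le> \<rho> ^ k * n0" for k
  proof (induction k)
    case (Suc k)
    have "sqrt (LINT x|lborel. (norm (v (Suc (Suc k)) x))\<^sup>2) \<le> \<rho> * sqrt (LINT x|lborel. (norm (v (Suc k) x))\<^sup>2)"
      unfolding v_Suc[of "Suc k"] using vL by (intro \<rho>(3)) auto
    also have "\<dots> \<le> \<rho> * (\<rho> ^ k * n0)" using Suc \<rho> by (intro mult_left_mono)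
    finally show ?case by (simp add: mult.assoc)
  qed (simp add: n0_def)
  obtain B1 where B1: "\<And>x. norm (v (Suc 0) x) \<le> B1" using L1_bddD(3)[OF vL(1)[of 0]] by blast
  \<comment> \<open>The contraction needs a function supported in \<open>(a, b)\<close>, and the sup bound needs one more step; hence the geometric bound starts at \<open>k = 2\<close>.\<close>
  define M where "M k = (case k of 0 \<Rightarrow> B | Suc 0 \<Rightarrow> B1 | Suc (Suc k) \<Rightarrow> C * (\<rho> ^ k * n0))" for k
  have vM: "norm (v k x) \<le> M k" for k x
  proof (cases k)
    case 0
    then show ?thesis using f0(3) by (simp add: M_def v_def)
  next
    case (Suc k')
    show ?thesis
    proof (cases k')
      case 0
      then show ?thesis using B1 Suc by (simp add: M_def)
    next
      case (Suc l)
      have nn: "0 \<le> C * (\<rho> ^ l * n0)" using C \<rho> by (simp add: n0_def)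
      have "norm (v (Suc (Suc l)) x) \<le> norm (avg q (v (Suc l)) x)"
        unfolding v_Suc[of "Suc l"] by (simp add: kill_def)
      also have "\<dots> \<le> C * sqrt (LINT y|lborel. (norm (v (Suc l) y))\<^sup>2)" by (rule C(2)[OF vL(1)])
      also have "\<dots> \<le> C * (\<rho> ^ l * n0)" using norm_v C(1) by (rule mult_left_mono)
      finally show ?thesis using Suc \<open>k = Suc k'\<close> by (simp add: M_def)
    qed
  qed
  have M: "summable M"
  proof -
    have "summable (\<lambda>k. M (k + 2))"
      using \<rho> by (auto simp: M_def eval_nat_numeral intro!: summable_mult summable_mult2 summable_geometric)
    then show ?thesis by (simp only: summable_iff_shift)
  qed
  have sv: "summable (\<lambda>k. v k x)" for x
    by (rule summable_comparison_test[OF _ M]) (use vM in auto)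
  define u where "u x = (\<Sum>k. v k x)" for x
  have su: "(\<lambda>k. v k x) sums u x" for x unfolding u_def by (rule summable_sums[OF sv])
  have u_borel [measurable]: "u \<in> borel_measurable borel"
    unfolding u_def[abs_def] by (rule borel_measurable_suminf) measurable
  have M0: "0 \<le> M k" for k using vM[of k 0] norm_ge_zero order_trans by blast
  have partial: "norm (\<Sum>k<n. v k x) \<le> suminf M" for n x
  proof -
    have "norm (\<Sum>k<n. v k x) \<le> (\<Sum>k<n. M k)" by (rule sum_norm_le) (rule vM)
    also have "\<dots> \<le> suminf M" by (rule sum_le_suminf[OF M]) (use M0 in auto)
    finally show ?thesis .
  qed
  have u_bound: "norm (u x) \<le> suminf M" for x
  proof (rule LIMSEQ_le_const2)
    show "(\<lambda>n. norm (\<Sum>k<n. v k x)) \<longlonglongrightarrow> norm (u x)" using su[of x] unfolding sums_def by (rule tendsto_norm)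
  qed (use partial in auto)
  have out: "u x = f x" if "x \<notin> {a<..<b}" for x
  proof -
    have "(\<lambda>k. v k x) sums (\<Sum>k\<in>{0}. v k x)"
    proof (rule sums_finite)
      show "v k x = 0" if "k \<notin> {0}" for k using that vL(2)[OF \<open>x \<notin> {a<..<b}\<close>] by (cases k) auto
    qed auto
    then have "u x = v 0 x" using su[of x] sums_unique2 by (metis (no_types, lifting) finite.emptyI sum.empty sum.insert empty_iff add.right_neutral)
    then show ?thesis using that by (simp add: v_def f0_def del: greaterThanLessThan_iff)
  qed
  have ins: "u x = avg q u x" if x: "x \<in> {a<..<b}" for x
  proof (rule LIMSEQ_unique)
    have iv: "integrable lborel (\<lambda>y. v k (x + y) * q y)" for k
      by (rule avg_integrand_integrable[OF q]) (use vM in auto)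
    have "(\<lambda>n. LINT y|lborel. (\<Sum>k<n. v k (x + y)) * q y) \<longlonglongrightarrow> (LINT y|lborel. u (x + y) * q y)"
    proof (rule integral_dominated_convergence[where w = "\<lambda>y. suminf M * norm (q y)"])
      show "integrable lborel (\<lambda>y. suminf M * norm (q y))" using q by (intro integrable_mult_right integrable_norm)
      show "AE y in lborel. (\<lambda>n. (\<Sum>k<n. v k (x + y)) * q y) \<longlonglongrightarrow> u (x + y) * q y"
        using su unfolding sums_def by (intro AE_I2 tendsto_mult tendsto_const) auto
      show "AE y in lborel. norm ((\<Sum>k<n. v k (x + y)) * q y) \<le> suminf M * norm (q y)" for n
        unfolding norm_mult by (intro AE_I2 mult_right_mono partial) auto
    qed measurable
    moreover have "(LINT y|lborel. (\<Sum>k<n. v k (x + y)) * q y) = (\<Sum>k<Suc n. v k x)" for n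
    proof -
      have "(LINT y|lborel. (\<Sum>k<n. v k (x + y)) * q y) = (LINT y|lborel. (\<Sum>k<n. v k (x + y) * q y))"
        by (simp add: sum_distrib_right)
      also have "\<dots> = (\<Sum>k<n. avg q (v k) x)"
        unfolding avg_def by (rule Bochner_Integration.integral_sum) (rule iv)
      also have "\<dots> = (\<Sum>k<n. v (Suc k) x)" using x by (intro sum.cong) (auto simp: v_Suc kill_def)
      also have "\<dots> = (\<Sum>k<Suc n. v k x)"
        unfolding sum.lessThan_Suc_shift using x by (simp add: v_def f0_def)
      finally show ?thesis .
    qed
    ultimately show "(\<lambda>n. \<Sum>k<Suc n. v k x) \<longlonglongrightarrow> avg q u x" by (simp only: avg_def)
    show "(\<lambda>n. \<Sum>k<Suc n. v k x) \<longlonglongrightarrow> u x"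
      using su[of x] unfolding sums_def by (rule LIMSEQ_Suc)
  qed
  show ?thesis
    using u_borel u_bound out ins su by (intro exI[of _ u]) (auto simp: v_def bounded_iff)
qed

end

section \<open>The limit of the exit problem\<close>

text \<open>The estimate is invariant under reflection, because the gap is even.\<close>

lemma boundary_estimate_right:
  assumes w: "L1_bdd w" and vanish: "\<And>x. x \<ge> b \<Longrightarrow> w x = 0"
    and est: "\<And>w a. L1_bdd w \<Longrightarrow> (\<And>x. x \<le> a \<Longrightarrow> w x = 0) \<Longrightarrow>
     norm (end_moment N r j a w)
      \<le> K * sqrt (gap_energy N r w)"
  shows "norm (end_moment N r j b w)
      \<le> K * sqrt (gap_energy N r w)"
proof -
  define w' where "w' x = w (- x)" for x
  have fw': "fourier w' u = fourier w (- u)" for u unfolding w'_def by (rule fourier_uminus)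
  have L: "L1_bdd w'"
  proof -
    obtain B where "\<And>x. norm (w x) \<le> B" using L1_bddD(3)[OF w] by blast
    moreover have "integrable lborel w'"
      using lborel_integrable_real_affine[OF L1_bddD(1)[OF w], of "-1" 0] by (simp add: w'_def[abs_def])
    ultimately show ?thesis by (intro L1_bddI[where B = B]) (auto simp: w'_def)
  qed
  have gap_even: "gap N r (- u) = gap N r u" for u by (simp add: gap_def)
  have reflect: "(LINT u|lborel. G u) = (LINT u|lborel. G (- u))" for G :: "real \<Rightarrow> 'z :: {banach, second_countable_topology}"
    using lborel_integral_real_affine[of "-1" G 0] by simp
  have "norm (end_moment N r j (- b) w')
      \<le> K * sqrt (gap_energy N r w')"
    by (rule est[OF L]) (simp add: w'_def vanish)
  also have "end_moment N r j (- b) w'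
     = (LINT u|lborel. (- 1) ^ j * (iexp_neg (b * u) *
        (complex_of_real (u ^ j * (gap N r u / u ^ (2 * N))) * fourier w u)))"
  proof (subst reflect, rule Bochner_Integration.integral_cong[OF refl])
    fix u
    have "(- u) ^ j * (gap N r (- u) / (- u) ^ (2 * N)) = (- 1) ^ j * (u ^ j * (gap N r u / u ^ (2 * N)))"
      by (simp add: gap_even power_minus[of u j])
    then show "iexp_neg (- b * - u) *
        (complex_of_real ((- u) ^ j * (gap N r (- u) / (- u) ^ (2 * N))) * fourier w' (- u)) =
        (- 1) ^ j * (iexp_neg (b * u) * (complex_of_real (u ^ j * (gap N r u / u ^ (2 * N))) * fourier w u))"
      by (simp only: fw' minus_minus of_real_mult of_real_power of_real_minus of_real_1 minus_mult_minus mult_ac)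
  qed
  also have "norm \<dots> = norm (end_moment N r j b w)"
    by (simp only: Bochner_Integration.integral_mult_right_zero norm_mult norm_power norm_minus_cancel norm_one power_one mult_1)
  also have "gap_energy N r w' = gap_energy N r w"
    by (subst reflect) (simp only: fw' gap_even minus_minus)
  finally show ?thesis .
qed

abbreviation end_terms :: "nat \<Rightarrow> real \<Rightarrow> real \<Rightarrow> (nat \<Rightarrow> complex) \<Rightarrow> (nat \<Rightarrow> complex) \<Rightarrow> real \<Rightarrow> complex" where
  "end_terms N a b \<alpha> \<beta> v \<equiv> \<Sum>j<N. complex_of_real (v ^ j) * (\<alpha> j * iexp (a * v) + \<beta> j * iexp (b * v))"

text \<open>The form of the transform of \<open>g - avg q g\<close> for an interpolation \<open>g\<close>.  The powers \<open>v ^ j\<close> with \<open>j < N\<close> come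
  from the jumps at the ends of the derivatives of \<open>g\<close> of order at least \<open>N\<close>; \<open>F\<close> comes from its
  derivative of order \<open>2 * N\<close> between the ends.\<close>

definition residual :: "nat \<Rightarrow> real \<Rightarrow> real \<Rightarrow> real \<Rightarrow> (nat \<Rightarrow> complex) \<Rightarrow> (nat \<Rightarrow> complex) \<Rightarrow> (real \<Rightarrow> complex) \<Rightarrow> real \<Rightarrow> complex" where
  "residual N r a b \<alpha> \<beta> F v = complex_of_real (gap N r v / v ^ (2 * N)) *
     (end_terms N a b \<alpha> \<beta> v + F v)"

lemma gap_ratio_bound:
  assumes N: "j < N" and r: "0 \<le> r"
  shows "\<bar>gap N r v / v ^ (2 * N)\<bar> * \<bar>v\<bar> ^ j \<le> 2 * (r + 1) / (1 + v\<^sup>2)"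
proof (cases "v = 0")
  case True
  then show ?thesis using N r by (simp add: gap_0)
next
  case False
  have p: "v ^ (2 * N) > 0" using False by (simp add: power_mult)
  have v2: "0 < 1 + v\<^sup>2" by (simp add: add_pos_nonneg)
  show ?thesis
  proof (cases "\<bar>v\<bar> \<le> 1")
    case True
    have "\<bar>gap N r v / v ^ (2 * N)\<bar> \<le> r"
      using gap_le[of N r v] gap_nonneg[OF r, of N v] p by (simp add: divide_le_eq)
    then have "\<bar>gap N r v / v ^ (2 * N)\<bar> * \<bar>v\<bar> ^ j \<le> r * 1"
      using True r by (intro mult_mono power_le_one) auto
    also have "\<dots> \<le> 2 * (r + 1) / 2" by simp
    also have "\<dots> \<le> 2 * (r + 1) / (1 + v\<^sup>2)"
      using True r v2 by (intro divide_left_mono) (auto simp: abs_square_le_1)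
    finally show ?thesis .
  next
    case False
    then have v1: "\<bar>v\<bar> \<ge> 1" by simp
    have "\<bar>gap N r v / v ^ (2 * N)\<bar> * \<bar>v\<bar> ^ j \<le> 1 / v ^ (2 * N) * \<bar>v\<bar> ^ j"
      using gap_le_1[of N r v] gap_nonneg[OF r, of N v] p
      by (intro mult_right_mono) (auto simp: abs_divide intro!: divide_right_mono)
    also have "\<dots> \<le> 1 / v ^ (2 * N) * \<bar>v\<bar> ^ (2 * N - 2)"
      using N v1 p by (intro mult_left_mono power_increasing) auto
    also have "\<dots> = 1 / v\<^sup>2"
    proof -
      have "\<bar>v\<bar> ^ (2 * N) = \<bar>v\<bar> ^ (2 * N - 2) * \<bar>v\<bar>\<^sup>2"
      proof -
        have e: "2 * N = 2 * N - 2 + 2" using N by linarith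
        show ?thesis by (subst e) (rule power_add)
      qed
      then have "v ^ (2 * N) = \<bar>v\<bar> ^ (2 * N - 2) * v\<^sup>2" by (simp add: power_even_abs)
      then show ?thesis using \<open>v \<noteq> 0\<close> by simp
    qed
    also have "\<dots> = 2 / (2 * v\<^sup>2)" by simp
    also have "\<dots> \<le> 2 / (1 + v\<^sup>2)"
      using v1 v2 abs_le_square_iff[of 1 v] \<open>v \<noteq> 0\<close> by (intro divide_left_mono) auto
    also have "\<dots> \<le> 2 * (r + 1) / (1 + v\<^sup>2)" using r v2 by (intro divide_right_mono) auto
    finally show ?thesis .
  qed
qed

lemma residual_bound:
  assumes N: "N \<ge> 1" and r: "0 \<le> r" "r \<le> c" and F: "\<And>v. norm (F v) \<le> M"
  shows "norm (residual N r a b \<alpha> \<beta> F v) \<le> ((\<Sum>j<N. norm (\<alpha> j) + norm (\<beta> j)) + M) * (2 * (c + 1) / (1 + v\<^sup>2))"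
proof -
  define \<theta> where "\<theta> = gap N r v / v ^ (2 * N)"
  define X where "X = 2 * (c + 1) / (1 + v\<^sup>2)"
  have X: "\<bar>\<theta>\<bar> * \<bar>v\<bar> ^ j \<le> X" if "j < N" for j
  proof -
    have "2 * (r + 1) / (1 + v\<^sup>2) \<le> X" unfolding X_def using r by (intro divide_right_mono) auto
    then show ?thesis using gap_ratio_bound[OF that r(1), of v] unfolding \<theta>_def by linarith
  qed
  have "norm (residual N r a b \<alpha> \<beta> F v) = \<bar>\<theta>\<bar> * norm (end_terms N a b \<alpha> \<beta> v + F v)"
    by (simp only: residual_def \<theta>_def norm_mult norm_of_real)
  also have "\<dots> \<le> \<bar>\<theta>\<bar> * ((\<Sum>j<N. \<bar>v\<bar> ^ j * (norm (\<alpha> j) + norm (\<beta> j))) + norm (F v))"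
  proof (intro mult_left_mono norm_triangle_le add_right_mono sum_norm_le)
    fix j
    have "norm (\<alpha> j * iexp (a * v) + \<beta> j * iexp (b * v)) \<le> norm (\<alpha> j) + norm (\<beta> j)"
      by (rule order_trans[OF norm_triangle_ineq]) (simp add: norm_mult)
    then show "norm (complex_of_real (v ^ j) * (\<alpha> j * iexp (a * v) + \<beta> j * iexp (b * v))) \<le> \<bar>v\<bar> ^ j * (norm (\<alpha> j) + norm (\<beta> j))"
      by (simp add: norm_mult norm_power mult_left_mono)
  qed auto
  also have "\<dots> = (\<Sum>j<N. (\<bar>\<theta>\<bar> * \<bar>v\<bar> ^ j) * (norm (\<alpha> j) + norm (\<beta> j))) + (\<bar>\<theta>\<bar> * \<bar>v\<bar> ^ 0) * norm (F v)"
    by (simp add: algebra_simps sum_distrib_left)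
  also have "\<dots> \<le> (\<Sum>j<N. X * (norm (\<alpha> j) + norm (\<beta> j))) + X * M"
  proof (intro add_mono sum_mono mult_right_mono mult_mono X F)
    show "0 \<le> X" unfolding X_def using r by auto
  qed (use N in auto)
  also have "\<dots> = ((\<Sum>j<N. norm (\<alpha> j) + norm (\<beta> j)) + M) * X"
    by (subst sum_distrib_left[symmetric]) (simp only: distrib_left mult.commute[of _ X])
  finally show ?thesis unfolding X_def .
qed

lemma residual_borel [measurable]:
  assumes [measurable]: "F \<in> borel_measurable borel"
  shows "residual N r a b \<alpha> \<beta> F \<in> borel_measurable borel"
  unfolding residual_def[abs_def] by measurable

lemma residual_integrable:
  assumes N: "N \<ge> 1" and r: "0 \<le> r" and F: "F \<in> borel_measurable borel" "\<And>v. norm (F v) \<le> M"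
  shows "integrable lborel (residual N r a b \<alpha> \<beta> F)"
proof (rule Bochner_Integration.integrable_bound)
  let ?C = "(\<Sum>j<N. norm (\<alpha> j) + norm (\<beta> j)) + M"
  show "integrable lborel (\<lambda>v. ?C * (2 * (r + 1)) * (1 / (1 + v\<^sup>2)))"
    by (intro integrable_mult_right integrable_inverse_1_plus_square_lborel)
  have [measurable]: "F \<in> borel_measurable borel" by (rule F)
  show "residual N r a b \<alpha> \<beta> F \<in> borel_measurable lborel" by measurable
  have "norm (residual N r a b \<alpha> \<beta> F v) \<le> norm (?C * (2 * (r + 1)) * (1 / (1 + v\<^sup>2)))" for v
    using residual_bound[where F = F and M = M and a = a and b = b and \<alpha> = \<alpha> and \<beta> = \<beta> and v = v, OF N r order_refl F(2)]
    unfolding real_norm_def by (intro order_trans[OF _ abs_ge_self]) simp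
  then show "AE v in lborel. norm (residual N r a b \<alpha> \<beta> F v) \<le> norm (?C * (2 * (r + 1)) * (1 / (1 + v\<^sup>2)))" by simp
qed

lemma residual_integral_tendsto_0:
  assumes N: "N \<ge> 1" and r: "\<And>n. 0 \<le> r n" "\<And>n. r n \<le> c" "r \<longlonglongrightarrow> 0" and F: "F \<in> borel_measurable borel" "\<And>v. norm (F v) \<le> M"
  shows "(\<lambda>n. LINT v|lborel. residual N (r n) a b \<alpha> \<beta> F v) \<longlonglongrightarrow> 0"
proof -
  let ?C = "(\<Sum>j<N. norm (\<alpha> j) + norm (\<beta> j)) + M"
  have [measurable]: "F \<in> borel_measurable borel" by (rule F)
  have "(\<lambda>n. LINT v|lborel. residual N (r n) a b \<alpha> \<beta> F v) \<longlonglongrightarrow> (LINT v::real|lborel. 0)"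
  proof (rule integral_dominated_convergence)
    show "integrable lborel (\<lambda>v. ?C * (2 * (c + 1)) * (1 / (1 + v\<^sup>2)))"
      by (intro integrable_mult_right integrable_inverse_1_plus_square_lborel)
    show "AE v in lborel. norm (residual N (r n) a b \<alpha> \<beta> F v) \<le> ?C * (2 * (c + 1)) * (1 / (1 + v\<^sup>2))" for n
      using residual_bound[where F = F and M = M and a = a and b = b and \<alpha> = \<alpha> and \<beta> = \<beta>, OF N r(1,2) F(2)] by simp
    have "(\<lambda>n. residual N (r n) a b \<alpha> \<beta> F v) \<longlonglongrightarrow> 0" for v
    proof -
      have "(\<lambda>n. (1 - exp (- (r n * v ^ (2 * N)))) * (1 / v ^ (2 * N))) \<longlonglongrightarrow> (1 - exp (- (0 * v ^ (2 * N)))) * (1 / v ^ (2 * N))"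
        by (intro tendsto_intros r(3))
      then have "(\<lambda>n. complex_of_real (gap N (r n) v / v ^ (2 * N))) \<longlonglongrightarrow> complex_of_real 0"
        by (intro tendsto_of_real) (simp add: gap_def)
      from tendsto_mult[OF this tendsto_const] show ?thesis unfolding residual_def by simp
    qed
    then show "AE v in lborel. (\<lambda>n. residual N (r n) a b \<alpha> \<beta> F v) \<longlonglongrightarrow> 0" by simp
  qed measurable
  then show ?thesis by simp
qed

lemma integral_exp_fourier_pairing:
  fixes S w :: "real \<Rightarrow> complex"
  assumes S: "integrable lborel S" and w: "integrable lborel w"
  shows "(LINT x|lborel. (LINT v|lborel. iexp_neg (x * v) * S v) * cnj (w x))
      = (LINT v|lborel. S v * cnj (fourier w v))"
    and "integrable lborel (\<lambda>x. (LINT v|lborel. iexp_neg (x * v) * S v) * cnj (w x))"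
proof -
  have [measurable]: "S \<in> borel_measurable borel" "w \<in> borel_measurable borel"
    using S w by (auto dest: borel_measurable_integrable)
  let ?f = "\<lambda>x v. iexp_neg (x * v) * S v * cnj (w x)"
  have pair: "integrable (lborel \<Otimes>\<^sub>M lborel) (\<lambda>(x, v). ?f x v)"
  proof (rule lborel_pair.Fubini_integrable)
    show "AE x in lborel. integrable lborel (\<lambda>v. case (x, v) of (x, v) \<Rightarrow> ?f x v)"
    proof (intro AE_I2)
      fix x
      have "integrable lborel (\<lambda>v. iexp (v * (- x)) * S v)" by (rule integrable_exp_i[OF S])
      then show "integrable lborel (\<lambda>v. case (x, v) of (x, v) \<Rightarrow> ?f x v)" by (simp add: mult.commute)
    qed
    have "(LINT v|lborel. norm (?f x v)) = (LINT v|lborel. norm (S v)) * norm (w x)" for x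
      by (simp add: norm_mult)
    then show "integrable lborel (\<lambda>x. LINT v|lborel. norm (case (x, v) of (x, v) \<Rightarrow> ?f x v))" using w by simp
  qed measurable
  have "(LINT v|lborel. S v * cnj (fourier w v)) = (LINT v|lborel. LINT x|lborel. ?f x v)"
  proof (rule Bochner_Integration.integral_cong[OF refl])
    fix v
    have "cnj (fourier w v) = (LINT x|lborel. iexp_neg (x * v) * cnj (w x))"
      unfolding fourier_def by (simp flip: Bochner_Integration.integral_cnj add: exp_cnj)
    then have "S v * cnj (fourier w v) = (LINT x|lborel. S v * (iexp_neg (x * v) * cnj (w x)))" by simp
    then show "S v * cnj (fourier w v) = (LINT x|lborel. ?f x v)" by (simp add: mult_ac)
  qed
  also have "\<dots> = (LINT x|lborel. LINT v|lborel. ?f x v)"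
    by (rule lborel_pair.Fubini_integral[OF pair])
  finally show "(LINT x|lborel. (LINT v|lborel. iexp_neg (x * v) * S v) * cnj (w x))
      = (LINT v|lborel. S v * cnj (fourier w v))" by simp
  show "integrable lborel (\<lambda>x. (LINT v|lborel. iexp_neg (x * v) * S v) * cnj (w x))"
    using lborel_pair.integrable_fst[OF pair] by simp
qed

text \<open>Inside \<open>(a, b)\<close> the equation for \<open>u\<close> gives \<open>w - avg q w = - (g - avg q g)\<close>, and outside \<open>w\<close> is \<open>0\<close>; so the
  energy of \<open>w\<close> is a pairing of \<open>w\<close> with the defect of \<open>g\<close>, which has to be known only inside.\<close>

lemma (in step_law) energy_identity:
  fixes u g S E :: "real \<Rightarrow> complex"
  assumes ab: "a < b"
    and g: "g \<in> borel_measurable borel" "bounded (range g)"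
    and u: "u \<in> borel_measurable borel" "bounded (range u)" "\<And>x. x \<notin> {a<..<b} \<Longrightarrow> u x = g x"
       "\<And>x. x \<in> {a<..<b} \<Longrightarrow> u x = avg q u x"
    and S: "integrable lborel S" and E: "L1_bdd E"
    and rep: "\<And>x. x \<in> {a<..<b} \<Longrightarrow> 2 * pi * (g x - avg q g x) =
        (LINT v|lborel. iexp_neg (x * v) * S v) + 2 * pi * (\<gamma> * E x)"
  defines "w \<equiv> \<lambda>x. u x - g x"
  shows "L1_bdd w" and "complex_of_real (gap_energy N r w) =
      - (LINT v|lborel. S v * cnj (fourier w v)) - \<gamma> * (LINT v|lborel. fourier E v * cnj (fourier w v))"
proof -
  have [measurable]: "g \<in> borel_measurable borel" "u \<in> borel_measurable borel" by fact+
  have wout: "w x = 0" if "x \<notin> {a<..<b}" for x using u(3)[OF that] by (simp add: w_def)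
  obtain Bu Bg where B: "\<And>x. norm (u x) \<le> Bu" "\<And>x. norm (g x) \<le> Bg"
    using u(2) g(2) by (auto simp: bounded_iff)
  have wb: "norm (w x) \<le> Bu + Bg" for x
    unfolding w_def using norm_triangle_ineq4[of "u x" "g x"] B[of x] by linarith
  have B0: "0 \<le> Bu + Bg" using wb[of 0] norm_ge_zero order_trans by blast
  have wm [measurable]: "w \<in> borel_measurable borel" unfolding w_def by measurable
  have "integrable lborel w"
  proof (rule Bochner_Integration.integrable_bound[of _ "\<lambda>x. (Bu + Bg) * indicator {a..b} x"])
    show "integrable lborel (\<lambda>x. (Bu + Bg) * indicator {a..b} x)"
      by (intro integrable_mult_right integrable_real_indicator) (auto simp: emeasure_lborel_Icc_eq)
    have "norm (w x) \<le> norm ((Bu + Bg) * indicator {a..b} x)" for x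
      using wb[of x] wout[of x] B0 by (cases "x \<in> {a<..<b}") (auto simp: indicator_def)
    then show "AE x in lborel. norm (w x) \<le> norm ((Bu + Bg) * indicator {a..b} x)" by simp
  qed measurable
  then show w: "L1_bdd w" using wb by (rule L1_bddI)
  note wi = L1_bddD(1)[OF w]
  have Qw: "L1_bdd (avg q w)" by (rule L1_bdd_avg[OF q w])
  have wQw: "L1_bdd (\<lambda>x. w x - avg q w x)"
  proof -
    obtain B1 where B1: "\<And>x. norm (avg q w x) \<le> B1" using L1_bddD(3)[OF Qw] by blast
    have "norm (w x - avg q w x) \<le> Bu + Bg + B1" for x
      using norm_triangle_ineq4[of "w x" "avg q w x"] wb[of x] B1[of x] by linarith
    then show ?thesis using wi L1_bddD(1)[OF Qw] by (intro L1_bddI[where B = "Bu + Bg + B1"]) auto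
  qed
  have diff: "w x - avg q w x = - (g x - avg q g x)" if "x \<in> {a<..<b}" for x
    using u(4)[OF that] avg_diff[OF q u(1) g(1) u(2) g(2), of x] by (simp add: w_def)
  have "complex_of_real (gap_energy N r w) =
      (LINT v|lborel. fourier (\<lambda>x. w x - avg q w x) v * cnj (fourier w v))"
  proof -
    have "fourier (\<lambda>x. w x - avg q w x) v * cnj (fourier w v) = complex_of_real (gap N r v * (norm (fourier w v))\<^sup>2)" for v
      using wi L1_bddD(1)[OF Qw] fourier_avg_q[OF wi]
      by (simp add: fourier_diff gap_def complex_norm_square algebra_simps del: of_real_power)
    then show ?thesis by (simp flip: integral_complex_of_real)
  qed
  also have "\<dots> = 2 * pi * (LINT x|lborel. (w x - avg q w x) * cnj (w x))"
    by (rule Parseval[OF wQw w])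
  also have "\<dots> = (LINT x|lborel. 2 * pi * ((w x - avg q w x) * cnj (w x)))" by simp
  also have "\<dots> = (LINT x|lborel. - ((LINT v|lborel. iexp_neg (x * v) * S v) * cnj (w x))
       - 2 * pi * \<gamma> * (E x * cnj (w x)))"
  proof (rule Bochner_Integration.integral_cong[OF refl])
    fix x
    show "2 * pi * ((w x - avg q w x) * cnj (w x)) = - ((LINT v|lborel. iexp_neg (x * v) * S v) * cnj (w x))
       - 2 * pi * \<gamma> * (E x * cnj (w x))"
    proof (cases "x \<in> {a<..<b}")
      case True
      have "2 * pi * ((w x - avg q w x) * cnj (w x)) = - (2 * pi * (g x - avg q g x)) * cnj (w x)"
        by (simp only: diff[OF True] mult_minus_left mult_minus_right mult.assoc)
      then show ?thesis unfolding rep[OF True] by (simp add: algebra_simps)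
    qed (simp add: wout)
  qed
  also have "\<dots> = - (LINT x|lborel. (LINT v|lborel. iexp_neg (x * v) * S v) * cnj (w x))
       - 2 * pi * \<gamma> * (LINT x|lborel. E x * cnj (w x))"
  proof -
    have "integrable lborel (\<lambda>x. E x * cnj (w x))"
      using wb by (intro L1_bdd_integrable_bounded_mult[where B = "Bu + Bg"] L1_bddD(1)[OF E]) auto
    then show ?thesis using integral_exp_fourier_pairing(2)[OF S wi] by simp
  qed
  also have "\<dots> = - (LINT v|lborel. S v * cnj (fourier w v)) - \<gamma> * (LINT v|lborel. fourier E v * cnj (fourier w v))"
    unfolding integral_exp_fourier_pairing(1)[OF S wi] Parseval[OF E w] by simp
  finally show "complex_of_real (gap_energy N r w) =
      - (LINT v|lborel. S v * cnj (fourier w v)) - \<gamma> * (LINT v|lborel. fourier E v * cnj (fourier w v))" .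
qed

text \<open>A Sobolev inequality that is uniform in the step length \<open>t\<close>.  At high frequencies \<open>gap / t\<close> is much smaller
  than \<open>c * v ^ (2 * N)\<close>, but there the multiplier of the step makes up for it: the square of the
  multiplier, divided by \<open>1 + gap / t\<close>, is at most \<open>1 / (1 + c * v ^ (2 * N))\<close>.\<close>

lemma (in step_law) norm_avg_q_le_energy:
  assumes c: "c > 0" and t: "t > 0" and rt: "r = c * t" and f: "L1_bdd f"
  shows "norm (avg q f x) \<le> sqrt (LINT v|lborel. 1 / (1 + c * v ^ (2 * N))) *
     sqrt (sq_norm (fourier f) + gap_energy N r f / t)"
proof -
  have [measurable]: "f \<in> borel_measurable borel" using L1_bddD[OF f] by auto
  define m where "m v = 1 + gap N r v / t" for v
  have g0: "0 \<le> gap N r v" for v using r by (simp add: gap_nonneg)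
  have m: "1 \<le> m v" for v using g0 t by (simp add: m_def)
  have m0: "0 < m v" for v using m[of v] by linarith
  define e where "e v = exp (- (r * v ^ (2 * N)))" for v
  have [measurable]: "m \<in> borel_measurable borel" "e \<in> borel_measurable borel"
    unfolding m_def[abs_def] e_def[abs_def] by measurable
  define F where "F v = complex_of_real (e v / sqrt (m v))" for v
  define G where "G v = complex_of_real (sqrt (m v)) * fourier f v" for v
  have [measurable]: "F \<in> borel_measurable borel" "G \<in> borel_measurable borel"
    unfolding F_def[abs_def] G_def[abs_def] by measurable
  have key: "(norm (F v))\<^sup>2 \<le> 1 / (1 + c * v ^ (2 * N))" for v
  proof -
    define y where "y = c * v ^ (2 * N)"
    have y: "y \<ge> 0" using c by (simp add: y_def even_power_nonneg)
    have ev: "e v = exp (- (t * y))" by (simp add: e_def rt y_def mult_ac)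
    have ty: "t * y \<ge> 0" using t y by simp
    have "t * y * exp (- (t * y)) \<le> 1 - exp (- (t * y))"
      using exp_ge_add_one_self[of "t * y"] by (simp add: exp_minus field_simps)
    then have "y * exp (- (t * y)) \<le> (1 - exp (- (t * y))) / t"
      using t by (simp add: pos_le_divide_eq mult_ac)
    moreover have "1 - exp (- (t * y)) = gap N r v" by (simp add: gap_def rt y_def mult_ac)
    ultimately have "y * exp (- (t * y)) \<le> gap N r v / t" by (simp only:)
    moreover have "exp (- (t * y)) \<le> 1" using ty by simp
    ultimately have "exp (- (t * y)) + y * exp (- (t * y)) \<le> 1 + gap N r v / t" by (intro add_mono)
    then have "e v * (1 + y) \<le> m v" by (simp add: ev m_def algebra_simps)
    then have "e v / m v \<le> 1 / (1 + y)" using m0 y by (simp add: field_simps add_pos_nonneg)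
    moreover have "(norm (F v))\<^sup>2 = e v * (e v / m v)"
      using m0[of v] by (simp add: F_def e_def power_divide norm_divide) (simp add: power2_eq_square)
    moreover have "e v * (e v / m v) \<le> e v / m v"
      using m0[of v] ty by (intro mult_left_le_one_le) (auto simp: ev)
    ultimately show ?thesis unfolding y_def by linarith
  qed
  have iP: "integrable lborel (\<lambda>v. 1 / (1 + c * v ^ (2 * N)))" by (rule integrable_inverse_power[OF N c])
  have F2: "integrable lborel (\<lambda>v. (norm (F v))\<^sup>2)"
    by (rule Bochner_Integration.integrable_bound[OF iP]) (use key c in \<open>auto simp: even_power_nonneg intro!: AE_I2\<close>)
  have ifs: "integrable lborel (\<lambda>v. (norm (fourier f v))\<^sup>2)" by (rule fourier_square_integrable[OF f])
  have igs: "integrable lborel (\<lambda>v. gap N r v * (norm (fourier f v))\<^sup>2)"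
    using g0 gap_le_1 by (intro integrable_weighted_fourier_square[OF f]) auto
  have G2eq: "(norm (G v))\<^sup>2 = (norm (fourier f v))\<^sup>2 + gap N r v * (norm (fourier f v))\<^sup>2 / t" for v
    using m0[of v] by (simp add: G_def norm_mult power_mult_distrib) (simp add: m_def distrib_right)
  have G2: "integrable lborel (\<lambda>v. (norm (G v))\<^sup>2)" unfolding G2eq using ifs igs by simp
  have FG: "F v * G v = complex_of_real (e v) * fourier f v" for v
    using m0[of v] by (simp add: F_def G_def)
  have "norm (avg q f x) \<le> (LINT v|lborel. norm (F v * G v)) / (2 * pi)"
    using norm_avg_q_le[OF f, of x] unfolding FG e_def .
  also have "\<dots> \<le> (LINT v|lborel. norm (F v * G v)) / 1"
    using pi_gt3 by (intro divide_left_mono) auto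
  also have "\<dots> \<le> sqrt (sq_norm F) * sqrt (sq_norm G)"
    using Cauchy_Schwarz_L2[OF _ _ F2 G2] by simp
  also have "\<dots> \<le> sqrt (LINT v|lborel. 1 / (1 + c * v ^ (2 * N))) * sqrt (sq_norm G)"
    using F2 iP key by (intro mult_right_mono real_sqrt_le_mono integral_mono) auto
  also have "sq_norm G = sq_norm (fourier f) + gap_energy N r f / t"
    unfolding G2eq using ifs igs by simp
  finally show ?thesis .
qed

text \<open>The pairing with the defect consists of the end moments, to which the boundary estimate \<open>K\<close> applies,
  and of a remainder with the transform \<open>D\<close>, in which the two terms with \<open>E\<close> cancel in the limit.\<close>

lemma (in step_law) exit_energy_estimate:
  fixes \<alpha> \<beta> :: "nat \<Rightarrow> complex" and E w :: "real \<Rightarrow> complex"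
  assumes w: "L1_bdd w" and supp: "\<And>x. x \<notin> {a<..<b} \<Longrightarrow> w x = 0" and E: "L1_bdd E"
    and K: "\<And>w a j. L1_bdd w \<Longrightarrow> (\<And>x. x \<le> a \<Longrightarrow> w x = 0) \<Longrightarrow> j < N \<Longrightarrow>
     norm (end_moment N r j a w)
      \<le> K * sqrt (gap_energy N r w)"
    and identity: "complex_of_real (gap_energy N r w) =
      - (LINT v|lborel. residual N r a b \<alpha> \<beta> (\<lambda>v. - (\<kappa> * complex_of_real (\<mu> ^ (2 * N)) * fourier E v)) v * cnj (fourier w v))
      - \<kappa> * complex_of_real (gap N r \<mu>) * (LINT v|lborel. fourier E v * cnj (fourier w v))"
  defines "D \<equiv> \<lambda>v. \<kappa> * complex_of_real (gap N r \<mu> - \<mu> ^ (2 * N) * (gap N r v / v ^ (2 * N))) * fourier E v"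
  shows "gap_energy N r w \<le>
     (\<Sum>j<N. norm (\<alpha> j) + norm (\<beta> j)) * (K * sqrt (gap_energy N r w))
     + sqrt (sq_norm D) * sqrt (sq_norm (fourier w))"
proof -
  have r0: "r \<ge> 0" using r by simp
  have [measurable]: "w \<in> borel_measurable borel" "E \<in> borel_measurable borel" using L1_bddD w E by auto
  define W where "W = gap_energy N r w"
  define \<theta> where "\<theta> v = gap N r v / v ^ (2 * N)" for v
  define Mw where "Mw = (LINT x|lborel. norm (w x))"
  define ME where "ME = (LINT x|lborel. norm (E x))"
  define S where "S = residual N r a b \<alpha> \<beta> (\<lambda>v. - (\<kappa> * complex_of_real (\<mu> ^ (2 * N)) * fourier E v))"
  define T where "T y j v = complex_of_real (v ^ j * \<theta> v) * iexp (y * v) * cnj (fourier w v)" for y j v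
  have [measurable]: "\<theta> \<in> borel_measurable borel" "T y j \<in> borel_measurable borel" for y j
    unfolding \<theta>_def[abs_def] T_def[abs_def] by measurable
  have wF: "norm (fourier w v) \<le> Mw" "norm (fourier E v) \<le> ME" for v unfolding Mw_def ME_def by (rule norm_fourier_le)+
  have \<theta>_bound: "\<bar>\<theta> v\<bar> * \<bar>v\<bar> ^ j \<le> 2 * (r + 1) / (1 + v\<^sup>2)" if "j < N" for v j
    unfolding \<theta>_def by (rule gap_ratio_bound[OF that r0])
  have T_int: "integrable lborel (T y j)" if "j < N" for y j
  proof (rule Bochner_Integration.integrable_bound)
    show "integrable lborel (\<lambda>v. Mw * (2 * (r + 1)) * (1 / (1 + v\<^sup>2)))"
      by (intro integrable_mult_right integrable_inverse_1_plus_square_lborel)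
    have "norm (T y j v) \<le> norm (Mw * (2 * (r + 1)) * (1 / (1 + v\<^sup>2)))" for v
    proof -
      have "norm (T y j v) = (\<bar>\<theta> v\<bar> * \<bar>v\<bar> ^ j) * norm (fourier w v)"
        by (simp add: T_def norm_mult norm_power abs_mult)
      also have "\<dots> \<le> (2 * (r + 1) / (1 + v\<^sup>2)) * Mw"
        using \<theta>_bound[OF that, of v] wF(1)[of v] r0 by (intro mult_mono) (auto simp: add_nonneg_nonneg)
      also have "\<dots> \<le> norm (Mw * (2 * (r + 1)) * (1 / (1 + v\<^sup>2)))"
        unfolding real_norm_def by (intro order_trans[OF _ abs_ge_self]) (simp add: mult_ac)
      finally show ?thesis .
    qed
    then show "AE v in lborel. norm (T y j v) \<le> norm (Mw * (2 * (r + 1)) * (1 / (1 + v\<^sup>2)))" by simp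
  qed measurable
  have T_conj: "T y j v = cnj (iexp_neg (y * v) * (complex_of_real (v ^ j * (gap N r v / v ^ (2 * N))) * fourier w v))" for y j v
    by (simp add: T_def \<theta>_def exp_cnj)
  have Ta: "norm (integral\<^sup>L lborel (T a j)) \<le> K * sqrt W" if "j < N" for j
  proof -
    have "norm (integral\<^sup>L lborel (T a j)) = norm (end_moment N r j a w)"
      unfolding T_conj[abs_def] Bochner_Integration.integral_cnj complex_mod_cnj ..
    also have "\<dots> \<le> K * sqrt W" unfolding W_def using supp by (intro K w that) auto
    finally show ?thesis .
  qed
  have Tb: "norm (integral\<^sup>L lborel (T b j)) \<le> K * sqrt W" if "j < N" for j
  proof -
    have "norm (integral\<^sup>L lborel (T b j)) = norm (end_moment N r j b w)"
      unfolding T_conj[abs_def] Bochner_Integration.integral_cnj complex_mod_cnj ..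
    also have "\<dots> \<le> K * sqrt W" unfolding W_def using supp that
      by (intro boundary_estimate_right[OF w] K) auto
    finally show ?thesis .
  qed
  have D_bound: "norm (D v) \<le> norm \<kappa> * (1 + \<mu> ^ (2 * N) * (2 * (r + 1))) * norm (fourier E v)" for v
  proof -
    have "\<bar>\<theta> v\<bar> \<le> 2 * (r + 1) / (1 + v\<^sup>2)" using \<theta>_bound[of 0 v] N by simp
    also have "\<dots> \<le> 2 * (r + 1) / 1" using r0 by (intro divide_left_mono) (auto simp: add_pos_nonneg)
    finally have "\<bar>\<theta> v\<bar> \<le> 2 * (r + 1)" by simp
    then have "\<mu> ^ (2 * N) * \<bar>\<theta> v\<bar> \<le> \<mu> ^ (2 * N) * (2 * (r + 1))" by (intro mult_left_mono even_power_nonneg)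
    then have "\<bar>gap N r \<mu> - \<mu> ^ (2 * N) * \<theta> v\<bar> \<le> 1 + \<mu> ^ (2 * N) * (2 * (r + 1))"
      using abs_triangle_ineq4[of "gap N r \<mu>" "\<mu> ^ (2 * N) * \<theta> v"] gap_nonneg[OF r0, of N \<mu>] gap_le_1[of N r \<mu>]
      by (simp add: abs_mult even_power_nonneg)
    then show ?thesis
      unfolding D_def \<theta>_def[symmetric] norm_mult norm_of_real by (intro mult_right_mono mult_left_mono) auto
  qed
  have [measurable]: "D \<in> borel_measurable borel" unfolding D_def by measurable
  have D2: "integrable lborel (\<lambda>v. (norm (D v))\<^sup>2)"
  proof (rule Bochner_Integration.integrable_bound)
    show "integrable lborel (\<lambda>v. (norm \<kappa> * (1 + \<mu> ^ (2 * N) * (2 * (r + 1))))\<^sup>2 * (norm (fourier E v))\<^sup>2)"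
      by (intro integrable_mult_right fourier_square_integrable[OF E])
    show "AE v in lborel. norm ((norm (D v))\<^sup>2) \<le> norm ((norm \<kappa> * (1 + \<mu> ^ (2 * N) * (2 * (r + 1))))\<^sup>2 * (norm (fourier E v))\<^sup>2)"
      using power_mono[OF D_bound norm_ge_zero, of _ 2] by (auto simp: power_mult_distrib)
  qed measurable
  have w2: "integrable lborel (\<lambda>v. (norm (cnj (fourier w v)))\<^sup>2)" using fourier_square_integrable[OF w] by simp
  have Dw: "integrable lborel (\<lambda>v. D v * cnj (fourier w v))"
    by (rule integrable_mult_L2[OF _ _ D2 w2]) measurable
  have S_int: "integrable lborel (\<lambda>v. S v * cnj (fourier w v))"
  proof (rule L1_bdd_integrable_bounded_mult[where B = Mw])
    show "integrable lborel S" unfolding S_def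
    proof (rule residual_integrable[OF N r0, where M = "norm (\<kappa> * complex_of_real (\<mu> ^ (2 * N))) * ME"])
      show "norm (- (\<kappa> * complex_of_real (\<mu> ^ (2 * N)) * fourier E v)) \<le> norm (\<kappa> * complex_of_real (\<mu> ^ (2 * N))) * ME" for v
        unfolding norm_minus_cancel norm_mult[of _ "fourier E v"] by (intro mult_left_mono wF) auto
    qed measurable
  qed (use wF in auto)
  have E_int: "integrable lborel (\<lambda>v. fourier E v * cnj (fourier w v))" by (rule fourier_mult_cnj_integrable[OF E w])
  have eq: "S v * cnj (fourier w v) + \<kappa> * complex_of_real (gap N r \<mu>) * (fourier E v * cnj (fourier w v)) =
     (\<Sum>j<N. \<alpha> j * T a j v + \<beta> j * T b j v) + D v * cnj (fourier w v)" for v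
  proof -
    have "S v * cnj (fourier w v) = (\<Sum>j<N. \<alpha> j * T a j v + \<beta> j * T b j v)
       - complex_of_real (\<theta> v) * (\<kappa> * complex_of_real (\<mu> ^ (2 * N)) * fourier E v) * cnj (fourier w v)"
    proof -
      have "complex_of_real (\<theta> v) * end_terms N a b \<alpha> \<beta> v * cnj (fourier w v)
         = (\<Sum>j<N. \<alpha> j * T a j v + \<beta> j * T b j v)"
        unfolding sum_distrib_left sum_distrib_right T_def by (intro sum.cong refl) (simp add: algebra_simps)
      then show ?thesis
        unfolding S_def residual_def \<theta>_def[symmetric] by (simp only: distrib_left distrib_right) simp
    qed
    then show ?thesis unfolding D_def \<theta>_def[symmetric] by (simp add: algebra_simps)
  qed
  have "complex_of_real W = - ((\<Sum>j<N. \<alpha> j * integral\<^sup>L lborel (T a j) + \<beta> j * integral\<^sup>L lborel (T b j)) + (LINT v|lborel. D v * cnj (fourier w v)))"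
  proof -
    have "complex_of_real W = - (LINT v|lborel. S v * cnj (fourier w v) + \<kappa> * complex_of_real (gap N r \<mu>) * (fourier E v * cnj (fourier w v)))"
      using identity S_int E_int unfolding W_def S_def by simp
    also have "\<dots> = - ((\<Sum>j<N. \<alpha> j * integral\<^sup>L lborel (T a j) + \<beta> j * integral\<^sup>L lborel (T b j)) + (LINT v|lborel. D v * cnj (fourier w v)))"
    proof -
      have i: "integrable lborel (\<lambda>v. \<alpha> j * T a j v + \<beta> j * T b j v)" if "j \<in> {..<N}" for j
        using that by (intro Bochner_Integration.integrable_add integrable_mult_right T_int) auto
      have "(LINT v|lborel. (\<Sum>j<N. \<alpha> j * T a j v + \<beta> j * T b j v)) = (\<Sum>j<N. \<alpha> j * integral\<^sup>L lborel (T a j) + \<beta> j * integral\<^sup>L lborel (T b j))"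
      proof (subst Bochner_Integration.integral_sum[OF i], assumption, rule sum.cong[OF refl])
        fix j assume "j \<in> {..<N}"
        then have "integrable lborel (T a j)" "integrable lborel (T b j)" by (auto intro: T_int)
        then show "(LINT v|lborel. \<alpha> j * T a j v + \<beta> j * T b j v) = \<alpha> j * integral\<^sup>L lborel (T a j) + \<beta> j * integral\<^sup>L lborel (T b j)"
          by simp
      qed
      moreover have "integrable lborel (\<lambda>v. \<Sum>j<N. \<alpha> j * T a j v + \<beta> j * T b j v)"
        by (intro Bochner_Integration.integrable_sum i)
      ultimately show ?thesis
        unfolding eq by (subst Bochner_Integration.integral_add[OF _ Dw]) simp_all
    qed
    finally show ?thesis .
  qed
  then have "norm (complex_of_real W) \<le> norm (\<Sum>j<N. \<alpha> j * integral\<^sup>L lborel (T a j) + \<beta> j * integral\<^sup>L lborel (T b j)) + norm (LINT v|lborel. D v * cnj (fourier w v))"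
    by (simp only: norm_minus_cancel norm_triangle_ineq)
  also have "\<dots> \<le> (\<Sum>j<N. (norm (\<alpha> j) + norm (\<beta> j)) * (K * sqrt W)) + sqrt (sq_norm D) * sqrt (sq_norm (fourier w))"
  proof (rule add_mono)
    show "norm (\<Sum>j<N. \<alpha> j * integral\<^sup>L lborel (T a j) + \<beta> j * integral\<^sup>L lborel (T b j)) \<le> (\<Sum>j<N. (norm (\<alpha> j) + norm (\<beta> j)) * (K * sqrt W))"
    proof (rule sum_norm_le)
      fix j assume "j \<in> {..<N}"
      then have j: "j < N" by simp
      show "norm (\<alpha> j * integral\<^sup>L lborel (T a j) + \<beta> j * integral\<^sup>L lborel (T b j)) \<le> (norm (\<alpha> j) + norm (\<beta> j)) * (K * sqrt W)"
        unfolding distrib_right by (intro norm_triangle_le add_mono) (auto simp: norm_mult intro: mult_left_mono Ta[OF j] Tb[OF j])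
    qed
    have "norm (LINT v|lborel. D v * cnj (fourier w v)) \<le> (LINT v|lborel. norm (D v * cnj (fourier w v)))" by (rule integral_norm_bound)
    also have "\<dots> \<le> sqrt (sq_norm D) * sqrt (LINT v|lborel. (norm (cnj (fourier w v)))\<^sup>2)"
      by (rule Cauchy_Schwarz_L2[OF _ _ D2 w2]) measurable
    finally show "norm (LINT v|lborel. D v * cnj (fourier w v)) \<le> sqrt (sq_norm D) * sqrt (sq_norm (fourier w))" by simp
  qed
  finally have "\<bar>W\<bar> \<le> (\<Sum>j<N. norm (\<alpha> j) + norm (\<beta> j)) * (K * sqrt W) + sqrt (sq_norm D) * sqrt (sq_norm (fourier w))"
    by (simp only: norm_of_real sum_distrib_right)
  then show ?thesis unfolding W_def by linarith
qed

text \<open>The constant \<open>y / (1 + y)\<close> does not depend on the step length, because \<open>gap N (c * t)\<close> is at least \<open>t\<close>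
  times \<open>z / (1 + z)\<close> with \<open>z = c * u ^ (2 * N)\<close>.\<close>

lemma (in step_law) Poincare_gap:
  assumes w: "L1_bdd w" and supp: "\<And>x. x \<notin> {a<..<b} \<Longrightarrow> w x = 0" and ab: "a < b"
    and c: "c > 0" and t: "0 < t" "t \<le> 1" and rt: "r = c * t"
  defines "y \<equiv> c * (pi / (2 * (b - a))) ^ (2 * N)"
  shows "t * (y / (1 + y)) / 2 * sq_norm (fourier w) \<le> gap_energy N r w"
proof (rule Poincare_fourier[OF w supp ab])
  have y: "y \<ge> 0" using c by (simp add: y_def even_power_nonneg)
  show "0 \<le> gap N r u" "gap N r u \<le> 1" for u using r by (auto simp: gap_nonneg gap_le_1)
  show "0 \<le> t * (y / (1 + y))" using t y by simp
  fix u assume u: "pi / (2 * (b - a)) \<le> \<bar>u\<bar>"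
  have "0 \<le> pi / (2 * (b - a))" using ab by simp
  then have "(pi / (2 * (b - a))) ^ (2 * N) \<le> \<bar>u\<bar> ^ (2 * N)" using u by (intro power_mono) auto
  then have "(pi / (2 * (b - a))) ^ (2 * N) \<le> u ^ (2 * N)" by (simp add: power_even_abs)
  then have yu: "y \<le> c * u ^ (2 * N)" unfolding y_def using c by (intro mult_left_mono) auto
  define z where "z = c * u ^ (2 * N)"
  have z: "y \<le> z" "0 \<le> z" using yu y by (auto simp: z_def)
  have "t * (y / (1 + y)) \<le> t * (z / (1 + z))"
  proof (intro mult_left_mono)
    show "y / (1 + y) \<le> z / (1 + z)" using z y by (simp add: field_simps add_pos_nonneg)
  qed (use t in auto)
  also have "\<dots> = t * z / (1 + z)" by simp
  also have "\<dots> \<le> t * z / (1 + t * z)"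
    using t z by (intro divide_left_mono) (auto simp: mult_left_le_one_le add_pos_nonneg intro!: mult_pos_pos add_pos_nonneg)
  also have "\<dots> = r * u ^ (2 * N) / (1 + r * u ^ (2 * N))" by (simp add: rt z_def mult_ac)
  also have "\<dots> \<le> gap N r u" using r by (intro gap_ge) auto
  finally show "t * (y / (1 + y)) \<le> gap N r u" .
qed measurable

text \<open>Divided by \<open>t\<close>, both gaps converge to \<open>c\<close> times the power \<open>2 * N\<close> of their frequency, so the two terms
  cancel.\<close>

lemma defect_tendsto_0:
  assumes N: "N \<ge> 1" and c: "c > 0" and t: "\<And>n. 0 < t n" "\<And>n. t n \<le> 1" "t \<longlonglongrightarrow> 0" and E: "L1_bdd E"
  shows "(\<lambda>n. sqrt (LINT v|lborel. (norm (\<kappa> * complex_of_real (gap N (c * t n) \<mu> - \<mu> ^ (2 * N) * (gap N (c * t n) v / v ^ (2 * N))) * fourier E v))\<^sup>2) / t n) \<longlonglongrightarrow> 0"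
proof -
  have [measurable]: "E \<in> borel_measurable borel" using L1_bddD[OF E] by auto
  define d where "d n v = (gap N (c * t n) \<mu> - \<mu> ^ (2 * N) * (gap N (c * t n) v / v ^ (2 * N))) / t n" for n v
  have [measurable]: "d n \<in> borel_measurable borel" for n unfolding d_def[abs_def] by measurable
  have lim: "(\<lambda>n. gap N (c * t n) v / t n) \<longlonglongrightarrow> c * v ^ (2 * N)" for v
  proof -
    define y where "y = c * v ^ (2 * N)"
    have y: "y \<ge> 0" using c by (simp add: y_def even_power_nonneg)
    have "\<bar>gap N (c * t n) v / t n - y\<bar> \<le> y\<^sup>2 * t n" for n
    proof -
      have "\<bar>gap N (c * t n) v - c * t n * v ^ (2 * N)\<bar> \<le> (c * t n * v ^ (2 * N))\<^sup>2"
        using c t(1)[of n] by (intro gap_approx) auto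
      then have "\<bar>gap N (c * t n) v - t n * y\<bar> \<le> (t n * y)\<^sup>2" by (simp add: y_def mult_ac)
      then have "\<bar>gap N (c * t n) v - t n * y\<bar> / t n \<le> (t n * y)\<^sup>2 / t n"
        using t(1)[of n] by (intro divide_right_mono) auto
      moreover have "\<bar>gap N (c * t n) v / t n - y\<bar> = \<bar>gap N (c * t n) v - t n * y\<bar> / t n"
      proof -
        have "gap N (c * t n) v / t n - y = (gap N (c * t n) v - t n * y) / t n"
          using t(1)[of n] by (simp add: diff_divide_distrib)
        then show ?thesis using t(1)[of n] by (simp add: abs_divide)
      qed
      moreover have "(t n * y)\<^sup>2 / t n = y\<^sup>2 * t n" using t(1)[of n] by (simp add: power2_eq_square)
      ultimately show ?thesis by simp
    qed
    moreover have "(\<lambda>n. y\<^sup>2 * t n) \<longlonglongrightarrow> 0" using tendsto_mult[OF tendsto_const t(3), of "y\<^sup>2"] by simp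
    ultimately have "(\<lambda>n. gap N (c * t n) v / t n - y) \<longlonglongrightarrow> 0"
      by (rule_tac Lim_null_comparison[where g = "\<lambda>n. y\<^sup>2 * t n"]) simp_all
    then show ?thesis by (simp add: LIM_zero_iff y_def)
  qed
  have le: "0 \<le> gap N (c * t n) v / t n" "gap N (c * t n) v / t n \<le> c * v ^ (2 * N)" for n v
    using gap_nonneg[of "c * t n" N v] gap_le[of N "c * t n" v] c t(1)[of n] by (auto simp: divide_le_eq mult_ac)
  have dform: "d n v = gap N (c * t n) \<mu> / t n - \<mu> ^ (2 * N) * ((gap N (c * t n) v / t n) / v ^ (2 * N))" for n v
    by (simp add: d_def diff_divide_distrib)
  have d_bound: "\<bar>d n v\<bar> \<le> c * \<mu> ^ (2 * N)" if "v \<noteq> 0" for n v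
  proof -
    have v: "v ^ (2 * N) > 0" using that by (simp add: power_mult)
    have 1: "0 \<le> (gap N (c * t n) v / t n) / v ^ (2 * N)" "(gap N (c * t n) v / t n) / v ^ (2 * N) \<le> c"
      using divide_nonneg_pos[OF le(1) v, of n v] le(2)[of n v] by (simp, simp only: pos_divide_le_eq[OF v])
    then have "0 \<le> \<mu> ^ (2 * N) * ((gap N (c * t n) v / t n) / v ^ (2 * N))"
       "\<mu> ^ (2 * N) * ((gap N (c * t n) v / t n) / v ^ (2 * N)) \<le> \<mu> ^ (2 * N) * c"
      by (auto intro!: mult_nonneg_nonneg mult_left_mono even_power_nonneg simp del: times_divide_eq_right)
    then show ?thesis unfolding dform using le[of n \<mu>] by (simp add: mult.commute abs_le_iff)
  qed
  have "(\<lambda>n. LINT v|lborel. (norm (\<kappa> * complex_of_real (d n v) * fourier E v))\<^sup>2) \<longlonglongrightarrow> (LINT v::real|lborel. 0)"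
  proof (rule integral_dominated_convergence)
    show "integrable lborel (\<lambda>v. (norm \<kappa> * (c * \<mu> ^ (2 * N)))\<^sup>2 * (norm (fourier E v))\<^sup>2)"
      by (intro integrable_mult_right fourier_square_integrable[OF E])
    show "AE v in lborel. norm ((norm (\<kappa> * complex_of_real (d n v) * fourier E v))\<^sup>2) \<le> (norm \<kappa> * (c * \<mu> ^ (2 * N)))\<^sup>2 * (norm (fourier E v))\<^sup>2" for n
      using AE_lborel_singleton[of 0]
    proof eventually_elim
      case (elim v)
      have "norm (\<kappa> * complex_of_real (d n v) * fourier E v) \<le> norm \<kappa> * (c * \<mu> ^ (2 * N)) * norm (fourier E v)"
        unfolding norm_mult norm_of_real using d_bound[OF elim] by (intro mult_right_mono mult_left_mono) auto
      then have "(norm (\<kappa> * complex_of_real (d n v) * fourier E v))\<^sup>2 \<le> (norm \<kappa> * (c * \<mu> ^ (2 * N)) * norm (fourier E v))\<^sup>2"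
        by (intro power_mono) auto
      then show ?case by (simp add: power_mult_distrib)
    qed
    show "AE v in lborel. (\<lambda>n. (norm (\<kappa> * complex_of_real (d n v) * fourier E v))\<^sup>2) \<longlonglongrightarrow> 0"
      using AE_lborel_singleton[of 0]
    proof eventually_elim
      case (elim v)
      have "(\<lambda>n. d n v) \<longlonglongrightarrow> c * \<mu> ^ (2 * N) - \<mu> ^ (2 * N) * (c * v ^ (2 * N) / v ^ (2 * N))"
        unfolding dform by (intro tendsto_intros lim) (use elim in auto)
      then have "(\<lambda>n. d n v) \<longlonglongrightarrow> 0" using elim by (simp add: mult.commute)
      then have "(\<lambda>n. (norm (\<kappa> * complex_of_real (d n v) * fourier E v))\<^sup>2) \<longlonglongrightarrow> (norm (\<kappa> * complex_of_real 0 * fourier E v))\<^sup>2"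
        by (intro tendsto_intros)
      then show ?case by simp
    qed
  qed measurable
  then have "(\<lambda>n. sqrt (LINT v|lborel. (norm (\<kappa> * complex_of_real (d n v) * fourier E v))\<^sup>2)) \<longlonglongrightarrow> sqrt 0"
    by (intro tendsto_real_sqrt) simp
  moreover have "sqrt (LINT v|lborel. (norm (\<kappa> * complex_of_real (d n v) * fourier E v))\<^sup>2) =
     sqrt (LINT v|lborel. (norm (\<kappa> * complex_of_real (gap N (c * t n) \<mu> - \<mu> ^ (2 * N) * (gap N (c * t n) v / v ^ (2 * N))) * fourier E v))\<^sup>2) / t n" for n
  proof -
    have "(norm (\<kappa> * complex_of_real (d n v) * fourier E v))\<^sup>2 =
       (norm (\<kappa> * complex_of_real (gap N (c * t n) \<mu> - \<mu> ^ (2 * N) * (gap N (c * t n) v / v ^ (2 * N))) * fourier E v))\<^sup>2 / (t n)\<^sup>2" for v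
      unfolding d_def norm_mult norm_of_real abs_divide using t(1)[of n] by (simp add: power_mult_distrib power_divide)
    then show ?thesis using t(1)[of n] by (simp add: real_sqrt_divide)
  qed
  ultimately show ?thesis by simp
qed

text \<open>Let \<open>W\<close> be the energy of \<open>w = u - g\<close>.  The boundary estimate and the Poincare inequality bound \<open>W\<close>
  by \<open>\<epsilon> * sqrt t * sqrt W\<close> with \<open>\<epsilon> \<longlonglongrightarrow> 0\<close>.  Hence \<open>W / t \<longlonglongrightarrow> 0\<close>, and the Sobolev inequality shows that
  \<open>avg q w\<close> tends to \<open>0\<close> at \<open>x0\<close>.  The remaining part of \<open>w x0\<close> is the defect of \<open>g\<close> at \<open>x0\<close>.\<close>

theorem exit_value_tendsto:
  fixes t :: "nat \<Rightarrow> real" and q u :: "nat \<Rightarrow> real \<Rightarrow> complex" and g E :: "real \<Rightarrow> complex"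
  assumes N: "N \<ge> 1" and c: "c > 0" and ab: "a < x0" "x0 < b"
    and t: "\<And>n. 0 < t n" "\<And>n. t n \<le> 1" "t \<longlonglongrightarrow> 0"
    and law: "\<And>n. step_law N (c * t n) (q n)"
    and g: "g \<in> borel_measurable borel" "bounded (range g)"
    and u: "\<And>n. u n \<in> borel_measurable borel" "\<And>n. bounded (range (u n))" "\<And>n x. x \<notin> {a<..<b} \<Longrightarrow> u n x = g x"
       "\<And>n x. x \<in> {a<..<b} \<Longrightarrow> u n x = avg (q n) (u n) x"
    and E: "L1_bdd E"
    and rep: "\<And>n x. x \<in> {a<..<b} \<Longrightarrow> 2 * pi * (g x - avg (q n) g x) =
        (LINT v|lborel. iexp_neg (x * v) *
            residual N (c * t n) a b \<alpha> \<beta> (\<lambda>v. - (\<kappa> * complex_of_real (\<mu> ^ (2 * N)) * fourier E v)) v)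
        + 2 * pi * (\<kappa> * complex_of_real (gap N (c * t n) \<mu>) * E x)"
  shows "(\<lambda>n. u n x0) \<longlonglongrightarrow> g x0"
proof -
  have ab': "a < b" using ab by linarith
  define F where "F v = - (\<kappa> * complex_of_real (\<mu> ^ (2 * N)) * fourier E v)" for v
  define M where "M = norm (\<kappa> * complex_of_real (\<mu> ^ (2 * N))) * (LINT x|lborel. norm (E x))"
  have [measurable]: "E \<in> borel_measurable borel" "g \<in> borel_measurable borel" "u n \<in> borel_measurable borel" for n
    using L1_bddD[OF E] g u by auto
  have F: "F \<in> borel_measurable borel" "norm (F v) \<le> M" for v
    unfolding F_def[abs_def] M_def norm_minus_cancel norm_mult[of _ "fourier E v"]
    by (measurable, intro mult_left_mono norm_fourier_le) auto
  have r: "0 \<le> c * t n" "c * t n \<le> c" for n using c t(1,2)[of n] by (auto simp: mult_left_le)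
  have r0: "(\<lambda>n. c * t n) \<longlonglongrightarrow> 0" using tendsto_mult[OF tendsto_const t(3), of c] by simp
  define S where "S n = residual N (c * t n) a b \<alpha> \<beta> F" for n
  have S: "integrable lborel (S n)" for n unfolding S_def by (rule residual_integrable[OF N r(1) F])
  define w where "w n x = u n x - g x" for n x
  have wout: "w n x = 0" if "x \<notin> {a<..<b}" for n x using u(3)[OF that] by (simp add: w_def)
  define W where "W n = gap_energy N (c * t n) (w n)" for n
  define V where "V n = sq_norm (fourier (w n))" for n
  have rep': "2 * pi * (g x - avg (q n) g x) = (LINT v|lborel. iexp_neg (x * v) * S n v)
        + 2 * pi * (\<kappa> * complex_of_real (gap N (c * t n) \<mu>) * E x)" if "x \<in> {a<..<b}" for n x
    using rep[OF that] unfolding S_def F_def .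
  have en: "L1_bdd (w n)" "complex_of_real (W n) = - (LINT v|lborel. S n v * cnj (fourier (w n) v))
      - \<kappa> * complex_of_real (gap N (c * t n) \<mu>) * (LINT v|lborel. fourier E v * cnj (fourier (w n) v))" for n
    using step_law.energy_identity[OF law ab' g u(1,2,3,4) S E rep', of n] unfolding w_def W_def by auto
  obtain K where K: "K > 0" "\<And>h w a j. 0 < h \<Longrightarrow> h \<le> 1 \<Longrightarrow> L1_bdd w \<Longrightarrow> (\<forall>x\<le>a. w x = 0) \<Longrightarrow> j < N \<Longrightarrow>
     norm (end_moment N (c * h ^ (2 * N)) j a w)
      \<le> K * h ^ N * sqrt h * sqrt (gap_energy N (c * h ^ (2 * N)) w)"
    using boundary_estimate[OF N c] by blast
  \<comment> \<open>The natural unit of length for steps of duration \<open>t n\<close>.\<close>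
  define h where "h n = root (2 * N) (t n)" for n
  have h: "0 < h n" "h n \<le> 1" "h n ^ (2 * N) = t n" for n
    using t(1,2)[of n] N by (auto simp: h_def real_root_le_1_iff)
  have hN: "h n ^ N = sqrt (t n)" for n
  proof -
    have "sqrt ((h n ^ N)\<^sup>2) = h n ^ N" using h(1)[of n] by simp
    then show ?thesis using h(3)[of n] by (simp add: power_mult[symmetric] mult.commute)
  qed
  define A where "A = (\<Sum>j<N. norm (\<alpha> j) + norm (\<beta> j))"
  define D where "D n v = \<kappa> * complex_of_real (gap N (c * t n) \<mu> - \<mu> ^ (2 * N) * (gap N (c * t n) v / v ^ (2 * N))) * fourier E v" for n v
  define \<omega> where "\<omega> n = sqrt (LINT v|lborel. (norm (D n v))\<^sup>2) / t n" for n
  have \<omega>: "\<omega> \<longlonglongrightarrow> 0" unfolding \<omega>_def[abs_def] D_def by (rule defect_tendsto_0[OF N c t E])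
  have ineq: "W n \<le> A * (K * sqrt (t n) * sqrt (h n) * sqrt (W n)) + \<omega> n * t n * sqrt (V n)" for n
  proof -
    have "W n \<le> A * (K * sqrt (t n) * sqrt (h n) * sqrt (W n)) + sqrt (LINT v|lborel. (norm (D n v))\<^sup>2) * sqrt (V n)"
      unfolding A_def D_def W_def V_def
    proof (rule step_law.exit_energy_estimate[OF law en(1) wout E])
      fix w' :: "real \<Rightarrow> complex" and a' j assume "L1_bdd w'" "\<And>x. x \<le> a' \<Longrightarrow> w' x = 0" "j < N"
      then show "norm (end_moment N (c * t n) j a' w')
      \<le> K * sqrt (t n) * sqrt (h n) * sqrt (gap_energy N (c * t n) w')"
        using K(2)[of "h n" w' a' j] h[of n] by (simp only: hN) auto
    next
      show "complex_of_real (gap_energy N (c * t n) (w n)) =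
        - (LINT v|lborel. residual N (c * t n) a b \<alpha> \<beta> (\<lambda>v. - (\<kappa> * complex_of_real (\<mu> ^ (2 * N)) * fourier E v)) v * cnj (fourier (w n) v))
        - \<kappa> * complex_of_real (gap N (c * t n) \<mu>) * (LINT v|lborel. fourier E v * cnj (fourier (w n) v))"
        using en(2)[of n] unfolding W_def S_def F_def .
    qed
    then show ?thesis using t(1)[of n] by (simp add: \<omega>_def)
  qed
  define y where "y = c * (pi / (2 * (b - a))) ^ (2 * N)"
  define P where "P = 2 * (1 + y) / y"
  have y: "y > 0" using c ab' by (simp add: y_def)
  have P: "P > 0" using y by (simp add: P_def)
  have W0: "W n \<ge> 0" for n unfolding W_def using r(1)[of n] by (intro Bochner_Integration.integral_nonneg) (auto simp: gap_nonneg)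
  have V: "V n \<le> P * (W n / t n)" for n
  proof -
    have "t n * (y / (1 + y)) / 2 * V n \<le> W n"
      unfolding V_def W_def y_def by (rule step_law.Poincare_gap[OF law en(1) wout ab' c t(1,2)]) auto
    then show ?thesis using t(1)[of n] y by (simp add: P_def field_simps)
  qed
  define \<epsilon> where "\<epsilon> n = A * K * sqrt (h n) + \<omega> n * sqrt P" for n
  have A0: "A \<ge> 0" unfolding A_def by (intro sum_nonneg) auto
  have \<omega>0: "\<omega> n \<ge> 0" for n unfolding \<omega>_def using t(1)[of n] by auto
  have \<epsilon>0: "\<epsilon> n \<ge> 0" for n unfolding \<epsilon>_def using A0 K(1) \<omega>0 P h(1)[of n] by auto
  have Wt: "W n / t n \<le> (\<epsilon> n)\<^sup>2" for n
  proof (cases "W n = 0")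
    case False
    then have Wpos: "W n > 0" using W0[of n] by simp
    have "\<omega> n * t n * sqrt (V n) \<le> \<omega> n * t n * sqrt (P * (W n / t n))"
      using V[of n] \<omega>0[of n] t(1)[of n] by (intro mult_left_mono real_sqrt_le_mono) auto
    also have "\<dots> = \<omega> n * sqrt P * (sqrt (t n) * sqrt (W n))"
    proof -
      define s where "s = sqrt (t n)"
      have s: "s > 0" "t n = s * s" using t(1)[of n] by (auto simp: s_def)
      have "sqrt (P * (W n / t n)) = sqrt P * (sqrt (W n) / s)" by (simp add: real_sqrt_mult real_sqrt_divide s_def)
      then show ?thesis unfolding s_def[symmetric] using s by simp
    qed
    finally have "W n \<le> \<epsilon> n * (sqrt (t n) * sqrt (W n))"
      using ineq[of n] unfolding \<epsilon>_def by (simp add: algebra_simps)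
    then have "sqrt (W n) * sqrt (W n) \<le> \<epsilon> n * sqrt (t n) * sqrt (W n)" using W0[of n] by (simp add: mult.assoc)
    moreover have "0 < sqrt (W n)" using Wpos by simp
    ultimately have "sqrt (W n) \<le> \<epsilon> n * sqrt (t n)" by (rule mult_right_le_imp_le)
    then have "(sqrt (W n))\<^sup>2 \<le> (\<epsilon> n * sqrt (t n))\<^sup>2" using W0[of n] by (intro power_mono) auto
    then have "W n \<le> (\<epsilon> n)\<^sup>2 * t n" using W0[of n] t(1)[of n] by (simp add: power_mult_distrib)
    then show ?thesis using t(1)[of n] by (simp add: divide_le_eq)
  qed simp
  have h0: "h \<longlonglongrightarrow> 0"
    unfolding h_def[abs_def] using tendsto_real_root[OF t(3), of "2 * N"] by simp
  have "(\<lambda>n. A * K * sqrt (h n) + \<omega> n * sqrt P) \<longlonglongrightarrow> A * K * sqrt 0 + 0 * sqrt P"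
    by (intro tendsto_intros h0 \<omega>)
  then have \<epsilon>: "\<epsilon> \<longlonglongrightarrow> 0" unfolding \<epsilon>_def[abs_def] by simp
  define I where "I = sqrt (LINT v|lborel. 1 / (1 + c * v ^ (2 * N)))"
  have Qw: "norm (avg (q n) (w n) x0) \<le> I * sqrt (P + 1) * \<epsilon> n" for n
  proof -
    have "norm (avg (q n) (w n) x0) \<le> I * sqrt (V n + W n / t n)"
      unfolding I_def V_def W_def by (rule step_law.norm_avg_q_le_energy[OF law c t(1) _ en(1)]) auto
    also have "\<dots> \<le> I * sqrt ((P + 1) * (\<epsilon> n)\<^sup>2)"
    proof (intro mult_left_mono real_sqrt_le_mono)
      have "V n + W n / t n \<le> (P + 1) * (W n / t n)" using V[of n] by (simp only: distrib_right mult_1 add_right_mono)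
      also have "\<dots> \<le> (P + 1) * (\<epsilon> n)\<^sup>2" using Wt P by (intro mult_left_mono) auto
      finally show "V n + W n / t n \<le> (P + 1) * (\<epsilon> n)\<^sup>2" .
      have "0 \<le> (LINT v|lborel. 1 / (1 + c * v ^ (2 * N)))" using c
        by (intro Bochner_Integration.integral_nonneg) (auto simp: even_power_nonneg)
      then show "0 \<le> I" by (simp add: I_def)
    qed
    also have "\<dots> = I * sqrt (P + 1) * \<epsilon> n" using \<epsilon>0[of n] by (simp add: real_sqrt_mult)
    finally show ?thesis .
  qed
  have lim1: "(\<lambda>n. avg (q n) (w n) x0) \<longlonglongrightarrow> 0"
  proof (rule Lim_null_comparison)
    show "\<forall>\<^sub>F n in sequentially. norm (avg (q n) (w n) x0) \<le> I * sqrt (P + 1) * \<epsilon> n" using Qw by simp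
    show "(\<lambda>n. I * sqrt (P + 1) * \<epsilon> n) \<longlonglongrightarrow> 0" using tendsto_mult[OF tendsto_const \<epsilon>] by simp
  qed
  have x0: "x0 \<in> {a<..<b}" using ab by simp
  have lim2: "(\<lambda>n. g x0 - avg (q n) g x0) \<longlonglongrightarrow> 0"
  proof -
    have S': "(\<lambda>n. LINT v|lborel. iexp_neg (x0 * v) * S n v) \<longlonglongrightarrow> 0"
    proof -
      \<comment> \<open>The phase \<open>iexp_neg (x0 * v)\<close> moves the end points to \<open>a - x0\<close> and \<open>b - x0\<close>.\<close>
      define G where "G v = iexp_neg (x0 * v) * F v" for v
      have "iexp_neg (x0 * v) * S n v =
         residual N (c * t n) (a - x0) (b - x0) \<alpha> \<beta> G v" for n v
        unfolding S_def residual_def G_def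
        by (simp add: algebra_simps sum_distrib_left exp_diff exp_minus divide_inverse)
      moreover have "(\<lambda>n. LINT v|lborel. residual N (c * t n) (a - x0) (b - x0) \<alpha> \<beta> G v) \<longlonglongrightarrow> 0"
      proof (rule residual_integral_tendsto_0[OF N r r0])
        have [measurable]: "F \<in> borel_measurable borel" by (rule F)
        show "G \<in> borel_measurable borel" unfolding G_def[abs_def] by measurable
        show "norm (G v) \<le> M" for v using F(2)[of v] by (simp add: G_def norm_mult)
      qed
      ultimately show ?thesis by simp
    qed
    have gapmu: "(\<lambda>n. gap N (c * t n) \<mu>) \<longlonglongrightarrow> 0"
    proof -
      have "(\<lambda>n. 1 - exp (- (c * t n * \<mu> ^ (2 * N)))) \<longlonglongrightarrow> 1 - exp (- (0 * \<mu> ^ (2 * N)))"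
        by (intro tendsto_intros r0)
      then show ?thesis by (simp add: gap_def)
    qed
    have "(\<lambda>n. ((LINT v|lborel. iexp_neg (x0 * v) * S n v)
        + 2 * pi * (\<kappa> * complex_of_real (gap N (c * t n) \<mu>) * E x0)) / (2 * pi)) \<longlonglongrightarrow> (0 + 2 * pi * (\<kappa> * complex_of_real 0 * E x0)) / (2 * pi)"
      by (intro tendsto_intros S' gapmu) auto
    moreover have "((LINT v|lborel. iexp_neg (x0 * v) * S n v)
        + 2 * pi * (\<kappa> * complex_of_real (gap N (c * t n) \<mu>) * E x0)) / (2 * pi) = g x0 - avg (q n) g x0" for n
      unfolding rep'[OF x0, symmetric] by simp
    ultimately have "(\<lambda>n. g x0 - avg (q n) g x0) \<longlonglongrightarrow> (0 + 2 * pi * (\<kappa> * complex_of_real 0 * E x0)) / (2 * pi)"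
      by (simp only:)
    then show ?thesis by simp
  qed
  have "u n x0 = g x0 + avg (q n) (w n) x0 - (g x0 - avg (q n) g x0)" for n
    using u(4)[OF x0, of n] avg_diff[OF step_law.q[OF law[of n]] u(1)[of n] g(1) u(2)[of n] g(2), where x = x0] by (simp add: w_def[abs_def])
  moreover have "(\<lambda>n. g x0 + avg (q n) (w n) x0 - (g x0 - avg (q n) g x0)) \<longlonglongrightarrow> g x0 + 0 - 0"
    by (intro tendsto_intros lim1 lim2)
  ultimately show ?thesis by simp
qed

section \<open>Step paths and the killed step operator\<close>

lemma nat_floor_dyadic: "nat \<lfloor>2 ^ n * (real k / 2 ^ n)\<rfloor> = k"
  by simp

lemma step_path_dyadic: "step_path n x (real k / 2 ^ n) = x k"
  unfolding step_path_def nat_floor_dyadic ..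

lemma hitting_time_step_path:
  assumes "x m \<in> A" "\<And>j. j < m \<Longrightarrow> x j \<notin> A"
  shows "hitting_time A (step_path n x) = ereal (real m / 2 ^ n)"
  unfolding hitting_time_def
proof (rule antisym)
  show "(INF t\<in>{t. 0 \<le> t \<and> step_path n x t \<in> A}. ereal t) \<le> ereal (real m / 2 ^ n)"
    by (rule INF_lower) (simp add: step_path_dyadic assms(1))
  show "ereal (real m / 2 ^ n) \<le> (INF t\<in>{t. 0 \<le> t \<and> step_path n x t \<in> A}. ereal t)"
  proof (rule INF_greatest)
    fix t assume "t \<in> {t. 0 \<le> t \<and> step_path n x t \<in> A}"
    then have t: "0 \<le> t" "x (nat \<lfloor>2 ^ n * t\<rfloor>) \<in> A" by (auto simp: step_path_def)
    then have "m \<le> nat \<lfloor>2 ^ n * t\<rfloor>" using assms(2) by (meson not_le)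
    then have "int m \<le> \<lfloor>2 ^ n * t\<rfloor>" using t(1) by (simp add: le_nat_iff)
    then have "real m \<le> 2 ^ n * t" by (simp add: le_floor_iff)
    then show "ereal (real m / 2 ^ n) \<le> ereal t" by (simp add: field_simps)
  qed
qed

lemma hitting_time_step_path_never:
  assumes "\<And>j. x j \<notin> A"
  shows "hitting_time A (step_path n x) = \<infinity>"
proof -
  have "{t. 0 \<le> t \<and> step_path n x t \<in> A} = {}" using assms by (auto simp: step_path_def)
  then show ?thesis unfolding hitting_time_def by (simp only: image_empty Inf_empty top_ereal_def)
qed

text \<open>The infimum is attained because a step path is constant on intervals that are closed on the left.\<close>

lemma hitting_time_step_path_eq_iff:
  "hitting_time A (step_path n x) = ereal (real k / 2 ^ n) \<longleftrightarrow> x k \<in> A \<and> (\<forall>j<k. x j \<notin> A)"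
proof (cases "\<exists>j. x j \<in> A")
  case True
  define m where "m = (LEAST j. x j \<in> A)"
  have m: "x m \<in> A" "\<And>j. j < m \<Longrightarrow> x j \<notin> A"
    unfolding m_def using LeastI_ex[OF True] not_less_Least by blast+
  have "real m / 2 ^ n = real k / 2 ^ n \<longleftrightarrow> m = k" by simp
  moreover have "m = k \<longleftrightarrow> x k \<in> A \<and> (\<forall>j<k. x j \<notin> A)"
    using m by (metis nat_neq_iff)
  ultimately show ?thesis using hitting_time_step_path[of x m A n, OF m] by simp
next
  case False
  then show ?thesis using hitting_time_step_path_never[of x A n] by auto
qed

lemma hitting_time_step_path_less_iff:
  "ereal (real k / 2 ^ n) < hitting_time A (step_path n x) \<longleftrightarrow> (\<forall>j\<le>k. x j \<notin> A)"
proof (cases "\<exists>j. x j \<in> A")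
  case True
  define m where "m = (LEAST j. x j \<in> A)"
  have m: "x m \<in> A" "\<And>j. j < m \<Longrightarrow> x j \<notin> A"
    unfolding m_def using LeastI_ex[OF True] not_less_Least by blast+
  have "real k / 2 ^ n < real m / 2 ^ n \<longleftrightarrow> k < m" by (simp add: divide_less_cancel)
  moreover have "k < m \<longleftrightarrow> (\<forall>j\<le>k. x j \<notin> A)"
    using m by (meson le_less_trans not_le)
  ultimately show ?thesis using hitting_time_step_path[of x m A n, OF m] by simp
next
  case False
  then show ?thesis using hitting_time_step_path_never[of x A n] by auto
qed

text \<open>A product of indicators, so that the last factor can be split off.\<close>

definition survival_weight :: "real \<Rightarrow> real \<Rightarrow> nat \<Rightarrow> (nat \<Rightarrow> real) \<Rightarrow> complex" where
  "survival_weight a b k x = (\<Prod>j<k. indicator {a<..<b} (x j))"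

lemma survival_weight_eq: "survival_weight a b k x = (if \<forall>j<k. x j \<in> {a<..<b} then 1 else 0)"
  unfolding survival_weight_def by (auto simp: indicator_def)

lemma exit_functional_eq:
  assumes f0: "\<And>x. f0 x = (if x \<in> {a<..<b} then 0 else f x)"
  shows "(if tau_exit a b (step_path n x) = ereal (real k / 2 ^ n)
            then f (exit_location a b (step_path n x)) else 0) = survival_weight a b k x * f0 (x k)"
proof (cases "tau_exit a b (step_path n x) = ereal (real k / 2 ^ n)")
  case True
  then have "x k \<notin> {a<..<b}" "\<forall>j<k. x j \<in> {a<..<b}"
    unfolding tau_exit_def hitting_time_step_path_eq_iff by auto
  moreover have "exit_location a b (step_path n x) = x k"
    unfolding exit_location_def True real_of_ereal.simps step_path_dyadic ..
  ultimately show ?thesis using True by (simp add: f0 survival_weight_eq del: greaterThanLessThan_iff)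
next
  case False
  then have "x k \<in> {a<..<b} \<or> \<not> (\<forall>j<k. x j \<in> {a<..<b})"
    unfolding tau_exit_def hitting_time_step_path_eq_iff by auto
  then show ?thesis using False by (auto simp: f0 survival_weight_eq)
qed

text \<open>Given that \<open>x k \<le> a\<close> is the first value at or below \<open>a\<close>, the barrier \<open>b\<close> is hit later or never exactly if no
  value up to time \<open>k\<close> has reached it; so the event is an exit from \<open>(a, b)\<close> at step \<open>k\<close>.\<close>

lemma minus_first_functional_eq:
  assumes ab: "a < b"
  shows "(if tau_minus a (step_path n x) = ereal (real k / 2 ^ n)
            then (if tau_minus a (step_path n x) < tau_plus b (step_path n x) then 1 else 0) else 0)
     = survival_weight a b k x * (if x k \<in> {a<..<b} then 0 else if x k \<le> a then 1 else 0)"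
proof (cases "tau_minus a (step_path n x) = ereal (real k / 2 ^ n)")
  case True
  then have k: "x k \<le> a" "\<forall>j<k. a < x j"
    unfolding tau_minus_def hitting_time_step_path_eq_iff by auto
  have "tau_minus a (step_path n x) < tau_plus b (step_path n x) \<longleftrightarrow> (\<forall>j\<le>k. x j < b)"
    unfolding True tau_plus_def hitting_time_step_path_less_iff by (auto simp: not_le)
  also have "\<dots> \<longleftrightarrow> (\<forall>j<k. x j \<in> {a<..<b})"
    using k ab by (auto simp: le_less)
  finally show ?thesis using True k by (auto simp: survival_weight_eq)
next
  case False
  then have "a < x k \<or> \<not> (\<forall>j<k. a < x j)"
    unfolding tau_minus_def hitting_time_step_path_eq_iff by auto
  then show ?thesis using False by (auto simp: survival_weight_eq)
qed

lemma plus_first_functional_eq: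
  assumes ab: "a < b"
  shows "(if tau_plus b (step_path n x) = ereal (real k / 2 ^ n)
            then (if tau_plus b (step_path n x) < tau_minus a (step_path n x) then 1 else 0) else 0)
     = survival_weight a b k x * (if x k \<in> {a<..<b} then 0 else if b \<le> x k then 1 else 0)"
proof (cases "tau_plus b (step_path n x) = ereal (real k / 2 ^ n)")
  case True
  then have k: "b \<le> x k" "\<forall>j<k. x j < b"
    unfolding tau_plus_def hitting_time_step_path_eq_iff by auto
  have "tau_plus b (step_path n x) < tau_minus a (step_path n x) \<longleftrightarrow> (\<forall>j\<le>k. a < x j)"
    unfolding True tau_minus_def hitting_time_step_path_less_iff by (auto simp: not_le)
  also have "\<dots> \<longleftrightarrow> (\<forall>j<k. x j \<in> {a<..<b})"
    using k ab by (auto simp: le_less)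
  finally show ?thesis using True k by (auto simp: survival_weight_eq)
next
  case False
  then have "x k < b \<or> \<not> (\<forall>j<k. x j < b)"
    unfolding tau_plus_def hitting_time_step_path_eq_iff by auto
  then show ?thesis using False by (auto simp: survival_weight_eq)
qed

interpretation lborel_product: product_sigma_finite "\<lambda>_::nat. lborel :: real measure"
  by (rule product_sigma_finite.intro) (rule sigma_finite_lborel)

lemma partial_sum_measurable:
  assumes "j \<le> k"
  shows "(\<lambda>y. \<Sum>i<j. y i) \<in> borel_measurable (PiM {..<k} (\<lambda>_::nat. lborel :: real measure))"
proof (rule borel_measurable_sum)
  fix i assume "i \<in> {..<j}"
  then have "i \<in> {..<k}" using assms by auto
  then have "(\<lambda>y. y i) \<in> measurable (PiM {..<k} (\<lambda>_. lborel)) (lborel :: real measure)"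
    by (rule measurable_component_singleton)
  then show "(\<lambda>y. y i) \<in> borel_measurable (PiM {..<k} (\<lambda>_. lborel :: real measure))" by simp
qed

lemma survival_measurable:
  assumes [measurable]: "\<phi> \<in> borel_measurable borel"
  shows "(\<lambda>y. survival_weight a b k (\<lambda>j. \<Sum>i<j. y i) * \<phi> (\<Sum>i<k. y i)) \<in> borel_measurable (PiM {..<k} (\<lambda>_::nat. lborel :: real measure))"
  unfolding survival_weight_def
proof (intro borel_measurable_times borel_measurable_prod)
  fix j assume "j \<in> {..<k}"
  then have "(\<lambda>y. \<Sum>i<j. y i) \<in> borel_measurable (PiM {..<k} (\<lambda>_::nat. lborel :: real measure))"
    by (intro partial_sum_measurable) auto
  then show "(\<lambda>y. indicator {a<..<b} (\<Sum>i<j. y i) :: complex) \<in> borel_measurable (PiM {..<k} (\<lambda>_::nat. lborel :: real measure))"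
    by (rule measurable_compose) measurable
next
  show "(\<lambda>y. \<phi> (\<Sum>i<k. y i)) \<in> borel_measurable (PiM {..<k} (\<lambda>_::nat. lborel :: real measure))"
    by (rule measurable_compose[OF partial_sum_measurable[OF order_refl]]) measurable
qed

text \<open>Integrating out the last increment replaces the function of the final position by its
  killed one-step average.\<close>

lemma (in step_law) obs_expect_survival:
  assumes qr: "\<And>y. q y = complex_of_real (qr y)" and \<phi>: "\<phi> \<in> borel_measurable borel" "bounded (range \<phi>)"
  shows "obs_expect qr k (\<lambda>x. survival_weight a b k x * \<phi> (x k)) = (kill a b ^^ k) \<phi> 0"
  using \<phi>
proof (induction k arbitrary: \<phi>)
  case 0
  then show ?case
    by (simp add: obs_expect_def survival_weight_def PiM_empty lebesgue_integral_count_space_finite)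
next
  case (Suc k)
  note \<phi> [measurable] = Suc.prems(1)
  let ?F = "\<lambda>y. survival_weight a b (Suc k) (\<lambda>j. \<Sum>i<j. y i) * \<phi> (\<Sum>i<Suc k. y i) * complex_of_real (\<Prod>i<Suc k. qr (y i))"
  have qi: "integrable lborel qr"
    using integrable_Re[OF q] by (simp add: qr)
  obtain B where B: "\<And>x. norm (\<phi> x) \<le> B" using Suc.prems(2) by (auto simp: bounded_iff)
  have B0: "B \<ge> 0" using B[of 0] norm_ge_zero order_trans by blast
  have [measurable]: "qr \<in> borel_measurable borel" using qi by (auto dest: borel_measurable_integrable)
  have int: "integrable (PiM {..<Suc k} (\<lambda>_. lborel)) ?F"
  proof (rule Bochner_Integration.integrable_bound)
    show "integrable (PiM {..<Suc k} (\<lambda>_. lborel)) (\<lambda>y. B * (\<Prod>i<Suc k. qr (y i)))"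
      by (intro integrable_mult_right lborel_product.product_integrable_prod qi) auto
    show "?F \<in> borel_measurable (PiM {..<Suc k} (\<lambda>_. lborel))"
    proof (rule borel_measurable_times)
      show "(\<lambda>y. survival_weight a b (Suc k) (\<lambda>j. \<Sum>i<j. y i) * \<phi> (\<Sum>i<Suc k. y i)) \<in> borel_measurable (PiM {..<Suc k} (\<lambda>_. lborel))"
        by (rule survival_measurable[OF \<phi>])
      have "(\<lambda>y. qr (y i)) \<in> borel_measurable (PiM {..<Suc k} (\<lambda>_::nat. lborel :: real measure))" if "i \<in> {..<Suc k}" for i
        by (rule measurable_compose[OF measurable_component_singleton[OF that]]) simp
      then have "(\<lambda>y. \<Prod>i<Suc k. qr (y i)) \<in> borel_measurable (PiM {..<Suc k} (\<lambda>_::nat. lborel :: real measure))"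
        by (rule borel_measurable_prod)
      then show "(\<lambda>y. complex_of_real (\<Prod>i<Suc k. qr (y i))) \<in> borel_measurable (PiM {..<Suc k} (\<lambda>_. lborel))"
        by (rule measurable_compose) measurable
    qed
    have "norm (?F y) \<le> norm (B * (\<Prod>i<Suc k. qr (y i)))" for y
    proof -
      have "norm (?F y) \<le> 1 * B * norm (complex_of_real (\<Prod>i<Suc k. qr (y i)))"
        unfolding norm_mult using B B0 by (intro mult_right_mono mult_mono) (auto simp: survival_weight_eq)
      then show ?thesis unfolding real_norm_def norm_of_real abs_mult mult_1 using B0 by (simp only: abs_of_nonneg)
    qed
    then show "AE y in PiM {..<Suc k} (\<lambda>_. lborel). norm (?F y) \<le> norm (B * (\<Prod>i<Suc k. qr (y i)))" by simp
  qed
  have "obs_expect qr (Suc k) (\<lambda>x. survival_weight a b (Suc k) x * \<phi> (x (Suc k))) = integral\<^sup>L (PiM (insert k {..<k}) (\<lambda>_. lborel)) ?F"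
    by (simp add: obs_expect_def lessThan_Suc)
  also have "\<dots> = (LINT x|PiM {..<k} (\<lambda>_. lborel). LINT y|lborel. ?F (x(k := y)))"
    using int by (intro lborel_product.product_integral_insert) (auto simp: lessThan_Suc)
  also have "\<dots> = (LINT x|PiM {..<k} (\<lambda>_. lborel). survival_weight a b k (\<lambda>j. \<Sum>i<j. x i) * kill a b \<phi> (\<Sum>i<k. x i) * complex_of_real (\<Prod>i<k. qr (x i)))"
  proof (rule Bochner_Integration.integral_cong[OF refl])
    fix x :: "nat \<Rightarrow> real"
    have s: "(\<Sum>i<j. (x(k := y)) i) = (\<Sum>i<j. x i)" if "j \<le> k" for j y
      using that by (intro sum.cong) auto
    have p: "(\<Prod>i<k. qr ((x(k := y)) i)) = (\<Prod>i<k. qr (x i))" for y by (intro prod.cong) auto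
    have w: "survival_weight a b (Suc k) (\<lambda>j. \<Sum>i<j. (x(k := y)) i) = survival_weight a b k (\<lambda>j. \<Sum>i<j. x i) * indicator {a<..<b} (\<Sum>i<k. x i)" for y
      unfolding survival_weight_def prod.lessThan_Suc by (simp add: s del: fun_upd_apply)
    have F: "?F (x(k := y)) = (survival_weight a b k (\<lambda>j. \<Sum>i<j. x i) * indicator {a<..<b} (\<Sum>i<k. x i) * complex_of_real (\<Prod>i<k. qr (x i)))
        * (\<phi> ((\<Sum>i<k. x i) + y) * q y)" for y
      unfolding w sum.lessThan_Suc prod.lessThan_Suc s[OF order_refl] p qr by simp
    show "(LINT y|lborel. ?F (x(k := y))) = survival_weight a b k (\<lambda>j. \<Sum>i<j. x i) * kill a b \<phi> (\<Sum>i<k. x i) * complex_of_real (\<Prod>i<k. qr (x i))"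
      unfolding F Bochner_Integration.integral_mult_right_zero avg_def[symmetric] by (simp add: kill_def indicator_def)
  qed
  also have "\<dots> = obs_expect qr k (\<lambda>x. survival_weight a b k x * kill a b \<phi> (x k))"
    by (simp add: obs_expect_def)
  also have "\<dots> = (kill a b ^^ k) (kill a b \<phi>) 0"
    using L1_bdd_kill[OF Suc.prems, of a b] by (intro Suc.IH L1_bddD(2)) (auto simp: L1_bdd_def)
  finally show ?case by (simp add: funpow_swap1)
qed

section \<open>Two-point Hermite interpolation\<close>

lemma truncated_neg_binomial_step:
  fixes s :: "'a :: comm_ring_1"
  shows "(1 - s) * (\<Sum>k<m. of_nat ((k + n) choose k) * s ^ k) =
     (\<Sum>k<m. of_nat ((k + n - 1) choose k) * s ^ k) - (if m = 0 then 0 else of_nat ((m - 1 + n) choose (m - 1)) * s ^ m)"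
proof (induction m)
  case (Suc m)
  have pascal: "(of_nat ((m + n) choose m) :: 'a) = of_nat ((m + n - 1) choose m) + (if m = 0 then 0 else of_nat ((m - 1 + n) choose (m - 1)))"
    by (cases m) (simp_all add: add.commute)
  have "(1 - s) * (\<Sum>k<Suc m. of_nat ((k + n) choose k) * s ^ k)
     = (\<Sum>k<m. of_nat ((k + n - 1) choose k) * s ^ k) - (if m = 0 then 0 else of_nat ((m - 1 + n) choose (m - 1)) * s ^ m)
       + (of_nat ((m + n) choose m) * s ^ m - of_nat ((m + n) choose m) * s ^ Suc m)"
    by (simp only: sum.lessThan_Suc distrib_left Suc.IH) (simp add: algebra_simps)
  also have "\<dots> = (\<Sum>k<Suc m. of_nat ((k + n - 1) choose k) * s ^ k) - of_nat ((m + n) choose m) * s ^ Suc m"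
    by (subst (1) pascal) (simp add: algebra_simps)
  finally show ?case by simp
qed simp

text \<open>The sum is the truncation of the power series of \<open>(1 - s) ^ - n\<close>.\<close>

lemma truncated_neg_binomial:
  fixes s :: "'a :: comm_ring_1"
  shows "s ^ m dvd (1 - s) ^ n * (\<Sum>k<m. of_nat ((k + n - 1) choose k) * s ^ k) - 1"
proof (induction n)
  case 0
  have "(\<Sum>k<m. of_nat ((k - 1) choose k) * s ^ k) = (\<Sum>k<m. if k = 0 then 1 else 0)"
    by (intro sum.cong) (auto simp: binomial_eq_0)
  then show ?case by (cases m) auto
next
  case (Suc n)
  define c where "c = (if m = 0 then 0 else (of_nat ((m - 1 + n) choose (m - 1)) :: 'a))"
  have "(1 - s) ^ Suc n * (\<Sum>k<m. of_nat ((k + Suc n - 1) choose k) * s ^ k)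
     = (1 - s) ^ n * ((1 - s) * (\<Sum>k<m. of_nat ((k + n) choose k) * s ^ k))"
    by (simp add: mult_ac)
  also have "\<dots> = (1 - s) ^ n * ((\<Sum>k<m. of_nat ((k + n - 1) choose k) * s ^ k) - c * s ^ m)"
    unfolding truncated_neg_binomial_step c_def by simp
  finally have "(1 - s) ^ Suc n * (\<Sum>k<m. of_nat ((k + Suc n - 1) choose k) * s ^ k) - 1
     = ((1 - s) ^ n * (\<Sum>k<m. of_nat ((k + n - 1) choose k) * s ^ k) - 1) - s ^ m * ((1 - s) ^ n * c)"
    by (simp add: algebra_simps)
  then show ?case by (simp only:) (rule dvd_diff[OF Suc.IH dvd_triv_left])
qed

lemma pderiv_linear_power_dvd:
  fixes p :: "'a :: idom poly"
  assumes "[:- x, 1:] ^ n dvd p"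
  shows "[:- x, 1:] ^ (n - 1) dvd pderiv p"
proof (cases n)
  case (Suc m)
  from assms obtain p' where p: "p = [:- x, 1:] ^ Suc m * p'" unfolding Suc by (auto simp: dvd_def)
  have "pderiv p = [:- x, 1:] ^ m * ([:- x, 1:] * pderiv p' + smult (of_nat (Suc m)) p')"
    unfolding p pderiv_mult pderiv_power_Suc by (simp add: pderiv_pCons algebra_simps)
  then show ?thesis unfolding Suc by simp
qed simp

lemma higher_pderiv_linear_power_dvd:
  fixes p :: "'a :: idom poly"
  assumes "[:- x, 1:] ^ n dvd p"
  shows "[:- x, 1:] ^ (n - i) dvd (pderiv ^^ i) p"
proof (induction i)
  case (Suc i)
  then show ?case using pderiv_linear_power_dvd[OF Suc] by simp
qed (use assms in simp)

lemma higher_pderiv_eq_0_if_dvd: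
  fixes p :: "'a :: idom poly"
  assumes "[:- x, 1:] ^ n dvd p" "i < n"
  shows "poly ((pderiv ^^ i) p) x = 0"
proof -
  have "[:- x, 1:] dvd [:- x, 1:] ^ (n - i)" using assms(2) by (intro dvd_power) simp
  then have "[:- x, 1:] dvd (pderiv ^^ i) p"
    using higher_pderiv_linear_power_dvd[OF assms(1), of i] by (rule dvd_trans)
  then show ?thesis by (simp add: poly_eq_0_iff_dvd)
qed

lemma higher_pderiv_linear_power:
  fixes x :: "'a :: {idom, semiring_char_0}"
  shows "poly ((pderiv ^^ i) ([:- x, 1:] ^ j)) x = (if i = j then fact j else 0)"
proof (induction i arbitrary: j)
  case 0
  then show ?case by (cases j) auto
next
  case (Suc i)
  show ?case
  proof (cases j)
    case 0
    have "(pderiv ^^ i) (0 :: 'a poly) = 0" by (induction i) auto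
    then show ?thesis using 0 by (simp add: funpow_swap1 pderiv_1)
  next
    case (Suc k)
    have "pderiv ([:- x, 1:] ^ Suc k) = smult (of_nat (Suc k)) ([:- x, 1:] ^ k)"
      unfolding pderiv_power_Suc by (simp add: pderiv_pCons)
    then have "(pderiv ^^ Suc i) ([:- x, 1:] ^ Suc k) = smult (of_nat (Suc k)) ((pderiv ^^ i) ([:- x, 1:] ^ k))"
      by (simp add: funpow_swap1 higher_pderiv_smult del: power_Suc)
    then show ?thesis using Suc.IH[of k] Suc by (simp del: power_Suc funpow.simps)
  qed
qed

text \<open>With \<open>s = (x - a) / (b - a)\<close>, so that \<open>1 - s = (b - x) / (b - a)\<close>, this is \<open>(x - a)^j / j!\<close> times \<open>(1 - s)^N\<close> times a
  truncation of \<open>(1 - s)^-N\<close>.  The last two factors have a product that is \<open>1\<close> up to order \<open>N - j\<close> at \<open>a\<close> and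
  that vanishes to order \<open>N\<close> at \<open>b\<close>.  The binomial sum of the truncation is the one in the coefficients
  of the exit distribution.\<close>

definition hermite_basis :: "nat \<Rightarrow> complex \<Rightarrow> complex \<Rightarrow> nat \<Rightarrow> complex poly" where
  "hermite_basis N a b j =
     (let X = [:- a, 1:]; s = smult (1 / (b - a)) X
      in smult (1 / fact j) (X ^ j * ((1 - s) ^ N * (\<Sum>k<N - j. of_nat ((k + N - 1) choose k) * s ^ k))))"

lemma hermite_basis_jets:
  assumes ab: "a \<noteq> b" and j: "j < N" and i: "i < N"
  shows "poly ((pderiv ^^ i) (hermite_basis N a b j)) a = (if i = j then 1 else 0)"
    and "poly ((pderiv ^^ i) (hermite_basis N a b j)) b = 0"
proof -
  define X where "X = [:- a, 1:]"
  define s where "s = smult (1 / (b - a)) X"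
  define R where "R = (1 - s) ^ N * (\<Sum>k<N - j. of_nat ((k + N - 1) choose k) * s ^ k)"
  have H: "hermite_basis N a b j = smult (1 / fact j) (X ^ j * R)"
    by (simp add: hermite_basis_def X_def s_def R_def Let_def)
  have "X ^ (N - j) dvd s ^ (N - j)" unfolding s_def smult_power by (simp add: dvd_smult)
  then have "X ^ (N - j) dvd R - 1" unfolding R_def using truncated_neg_binomial dvd_trans by blast
  then have "X ^ j * X ^ (N - j) dvd X ^ j * (R - 1)" by (rule mult_dvd_mono[OF dvd_refl])
  then have "X ^ N dvd X ^ j * (R - 1)" using j by (simp add: power_add[symmetric])
  then have "poly ((pderiv ^^ i) (X ^ j * (R - 1))) a = 0"
    unfolding X_def using i by (rule higher_pderiv_eq_0_if_dvd)
  moreover have "X ^ j * R = X ^ j + X ^ j * (R - 1)" by (simp add: algebra_simps)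
  ultimately show "poly ((pderiv ^^ i) (hermite_basis N a b j)) a = (if i = j then 1 else 0)"
    unfolding H by (simp add: higher_pderiv_smult higher_pderiv_add higher_pderiv_linear_power X_def)
  have "1 - s = smult (1 / (a - b)) [:- b, 1:]"
  proof -
    have "1 + a / (b - a) = b / (b - a)" "- (1 / (b - a)) = 1 / (a - b)" "- b / (a - b) = b / (b - a)"
      using ab by (simp_all add: field_simps)
    then show ?thesis by (simp add: s_def X_def one_pCons)
  qed
  then have "(1 - s) ^ N = smult ((1 / (a - b)) ^ N) ([:- b, 1:] ^ N)" by (simp only: smult_power)
  then have "[:- b, 1:] ^ N dvd (1 - s) ^ N" by (simp only:) (rule dvd_smult[OF dvd_refl])
  then have "[:- b, 1:] ^ N dvd hermite_basis N a b j"
    unfolding H R_def by (intro dvd_smult dvd_mult dvd_mult2)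
  then show "poly ((pderiv ^^ i) (hermite_basis N a b j)) b = 0"
    using i by (rule higher_pderiv_eq_0_if_dvd)
qed

lemma hermite_basis_degree:
  assumes j: "j < N"
  shows "degree (hermite_basis N a b j) < 2 * N"
proof -
  define X where "X = [:- a, 1:]"
  define s where "s = smult (1 / (b - a)) X"
  have dX: "degree X \<le> 1" by (simp add: X_def)
  have ds: "degree s \<le> 1" unfolding s_def using degree_smult_le dX by (rule order_trans)
  have d1s: "degree (1 - s) \<le> 1" using ds by (intro degree_diff_le) auto
  have dp: "degree (p ^ n) \<le> n" if "degree p \<le> 1" for p :: "complex poly" and n
    using order_trans[OF degree_power_le mult_le_mono1[OF that]] by simp
  have "degree (\<Sum>k<N - j. of_nat ((k + N - 1) choose k) * s ^ k) \<le> N - j - 1"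
  proof (rule degree_sum_le)
    fix k assume "k \<in> {..<N - j}"
    then have "k \<le> N - j - 1" by auto
    moreover have "degree (of_nat ((k + N - 1) choose k) * s ^ k) \<le> k"
      using order_trans[OF degree_mult_le add_mono[OF eq_refl[OF degree_of_nat] dp[OF ds]]] by simp
    ultimately show "degree (of_nat ((k + N - 1) choose k) * s ^ k) \<le> N - j - 1" by simp
  qed simp
  from order_trans[OF degree_mult_le add_mono[OF dp[OF d1s] this]]
  have "degree ((1 - s) ^ N * (\<Sum>k<N - j. of_nat ((k + N - 1) choose k) * s ^ k)) \<le> N + (N - j - 1)" .
  from order_trans[OF degree_mult_le add_mono[OF dp[OF dX] this]]
  have "degree (X ^ j * ((1 - s) ^ N * (\<Sum>k<N - j. of_nat ((k + N - 1) choose k) * s ^ k))) \<le> j + (N + (N - j - 1))" .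
  then have "degree (hermite_basis N a b j) \<le> j + (N + (N - j - 1))"
    unfolding hermite_basis_def Let_def X_def[symmetric] s_def[symmetric]
    by (intro order_trans[OF degree_smult_le])
  then show ?thesis using j by linarith
qed

text \<open>Exchanging \<open>a\<close> and \<open>b\<close> turns the basis polynomials for the jets at \<open>a\<close> into those for the jets at \<open>b\<close>.\<close>

lemma hermite_basis_at_0:
  assumes ab: "a \<noteq> b"
  shows "poly (hermite_basis N (complex_of_real a) (complex_of_real b) j) 0 = complex_of_real (I_minus N a b j)"
    and "poly (hermite_basis N (complex_of_real b) (complex_of_real a) j) 0 = complex_of_real (I_plus N a b j)"
proof -
  have A: "poly (hermite_basis N (complex_of_real a) (complex_of_real b) j) 0 = complex_of_real (I_minus N a b j)" if "a \<noteq> b" for a b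
  proof -
    have "1 + a / (b - a) = b / (b - a)" using that by (simp add: field_simps)
    then have e: "1 + complex_of_real a / (complex_of_real b - complex_of_real a) = complex_of_real (b / (b - a))"
      by (metis of_real_1 of_real_add of_real_diff of_real_divide)
    show ?thesis
      unfolding hermite_basis_def Let_def I_minus_def
      by (simp add: poly_sum e mult_ac)
  qed
  show "poly (hermite_basis N (complex_of_real a) (complex_of_real b) j) 0 = complex_of_real (I_minus N a b j)"
    by (rule A[OF ab])
  have "I_minus N b a j = I_plus N a b j"
  proof -
    have "a / (a - b) = - a / (b - a)" "- b / (a - b) = b / (b - a)" using ab by (simp_all add: field_simps)
    then show ?thesis unfolding I_minus_def I_plus_def by simp
  qed
  then show "poly (hermite_basis N (complex_of_real b) (complex_of_real a) j) 0 = complex_of_real (I_plus N a b j)"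
    using A[of b a] ab by simp
qed

proposition hermite_interpolation:
  fixes A B :: "nat \<Rightarrow> complex"
  assumes ab: "a \<noteq> b"
  shows "\<exists>p. (pderiv ^^ (2 * N)) p = 0 \<and>
     (\<forall>i<N. poly ((pderiv ^^ i) p) (complex_of_real a) = A i) \<and> (\<forall>i<N. poly ((pderiv ^^ i) p) (complex_of_real b) = B i) \<and>
     poly p 0 = (\<Sum>j<N. A j * complex_of_real (I_minus N a b j)) + (\<Sum>j<N. B j * complex_of_real (I_plus N a b j))"
proof -
  let ?a = "complex_of_real a" and ?b = "complex_of_real b"
  define p where "p = (\<Sum>j<N. smult (A j) (hermite_basis N ?a ?b j)) + (\<Sum>j<N. smult (B j) (hermite_basis N ?b ?a j))"
  have ab': "?a \<noteq> ?b" "?b \<noteq> ?a" using ab by auto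
  have jet: "poly ((pderiv ^^ i) p) x = (\<Sum>j<N. A j * poly ((pderiv ^^ i) (hermite_basis N ?a ?b j)) x)
      + (\<Sum>j<N. B j * poly ((pderiv ^^ i) (hermite_basis N ?b ?a j)) x)" for i x
    unfolding p_def by (simp add: higher_pderiv_add higher_pderiv_sum higher_pderiv_smult poly_sum)
  have "poly ((pderiv ^^ i) p) ?a = A i" if "i < N" for i
  proof -
    have "poly ((pderiv ^^ i) p) ?a = (\<Sum>j<N. if j = i then A j else 0)"
      unfolding jet using that ab' by (simp add: hermite_basis_jets if_distrib eq_commute cong: if_cong)
    then show ?thesis using that by simp
  qed
  moreover have "poly ((pderiv ^^ i) p) ?b = B i" if "i < N" for i
  proof -
    have "poly ((pderiv ^^ i) p) ?b = (\<Sum>j<N. if j = i then B j else 0)"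
      unfolding jet using that ab' by (simp add: hermite_basis_jets if_distrib eq_commute cong: if_cong)
    then show ?thesis using that by simp
  qed
  moreover have "poly p 0 = (\<Sum>j<N. A j * complex_of_real (I_minus N a b j)) + (\<Sum>j<N. B j * complex_of_real (I_plus N a b j))"
    using jet[of 0 0] hermite_basis_at_0[OF ab, of N] by simp
  moreover have "(pderiv ^^ (2 * N)) p = 0"
  proof (cases "N = 0")
    case True
    then show ?thesis by (simp add: p_def)
  next
    case False
    have "degree p \<le> 2 * N - 1"
      unfolding p_def
    proof (intro degree_add_le degree_sum_le)
      fix j assume "j \<in> {..<N}"
      then show "degree (smult (A j) (hermite_basis N ?a ?b j)) \<le> 2 * N - 1" "degree (smult (B j) (hermite_basis N ?b ?a j)) \<le> 2 * N - 1"
        using hermite_basis_degree[of j N ?a ?b] hermite_basis_degree[of j N ?b ?a] by auto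
    qed auto
    then show ?thesis using False
      by (intro poly_eqI) (simp add: coeff_higher_pderiv coeff_eq_0)
  qed
  ultimately show ?thesis by blast
qed

section \<open>The defect of the interpolation\<close>

text \<open>The boundary terms of integration by parts against \<open>iexp (x * u)\<close>.\<close>

definition bracket :: "(nat \<Rightarrow> real \<Rightarrow> complex) \<Rightarrow> real \<Rightarrow> real \<Rightarrow> real \<Rightarrow> nat \<Rightarrow> complex" where
  "bracket F a b u j = F j b * iexp (b * u) - F j a * iexp (a * u)"

lemma L1_bdd_indicator_mult:
  fixes f :: "real \<Rightarrow> complex"
  assumes "continuous_on {a..b} f"
  shows "L1_bdd (\<lambda>x. indicator {a..b} x * f x)"
proof -
  have i: "integrable lborel (\<lambda>x. indicator {a..b} x *\<^sub>R f x)"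
    by (rule borel_integrable_compact[OF _ assms]) simp
  moreover have "(\<lambda>x. indicator {a..b} x *\<^sub>R f x) = (\<lambda>x. indicator {a..b} x * f x)"
    by (auto simp: indicator_def)
  moreover have "bounded (f ` {a..b})" by (intro compact_imp_bounded compact_continuous_image assms compact_Icc)
  then obtain B where "\<forall>y\<in>f ` {a..b}. norm y \<le> B" unfolding bounded_iff by blast
  then have B: "norm (f x) \<le> B" if "x \<in> {a..b}" for x using that by simp
  have "norm (indicator {a..b} x * f x) \<le> \<bar>B\<bar>" for x
    using B[of x] by (auto simp: indicator_def)
  ultimately show ?thesis by (auto intro: L1_bddI)
qed

lemma fourier_parts_step:
  assumes ab: "a \<le> b"
    and der: "\<And>x. (F has_vector_derivative F' x) (at x)" and cont: "continuous_on {a..b} F'"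
  shows "\<i> * complex_of_real u * fourier (\<lambda>x. indicator {a..b} x * F x) u =
     F b * iexp (b * u) - F a * iexp (a * u) - fourier (\<lambda>x. indicator {a..b} x * F' x) u"
proof -
  have cF: "continuous_on {a..b} F"
    using der by (meson continuous_at_imp_continuous_on has_vector_derivative_continuous)
  let ?e = "\<lambda>x. iexp (x * u)"
  have d: "((\<lambda>x. F x * ?e x) has_vector_derivative (F' x * ?e x + F x * (\<i> * complex_of_real u * ?e x))) (at x within {a..b})" for x
  proof -
    have "(?e has_vector_derivative (\<i> * complex_of_real u * ?e x)) (at x within {a..b})"
      by (auto intro!: derivative_eq_intros has_vector_derivative_real_field simp: mult_ac)
    from has_vector_derivative_mult[OF has_vector_derivative_at_within[OF der[of x]] this]
    show ?thesis by (simp only: add.commute)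
  qed
  have "(LINT x|lborel. indicator {a..b} x *\<^sub>R (F' x * ?e x + F x * (\<i> * complex_of_real u * ?e x))) = F b * ?e b - F a * ?e a"
    by (rule integral_FTC_Icc[OF ab d]) (intro continuous_intros cF cont)
  also have "(LINT x|lborel. indicator {a..b} x *\<^sub>R (F' x * ?e x + F x * (\<i> * complex_of_real u * ?e x))) =
      (LINT x|lborel. ?e x * (indicator {a..b} x * F' x) + \<i> * complex_of_real u * (?e x * (indicator {a..b} x * F x)))"
    by (intro Bochner_Integration.integral_cong) (auto simp: indicator_def algebra_simps)
  also have "\<dots> = fourier (\<lambda>x. indicator {a..b} x * F' x) u + \<i> * complex_of_real u * fourier (\<lambda>x. indicator {a..b} x * F x) u"
    unfolding fourier_def
    using integrable_exp_i[OF L1_bddD(1)[OF L1_bdd_indicator_mult[OF cont]], of u]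
      integrable_exp_i[OF L1_bddD(1)[OF L1_bdd_indicator_mult[OF cF]], of u]
    by simp
  finally show ?thesis by (simp add: algebra_simps)
qed

lemma fourier_parts:
  assumes ab: "a \<le> b"
    and der: "\<And>j x. j < M \<Longrightarrow> (F j has_vector_derivative F (Suc j) x) (at x)" and cont: "continuous_on {a..b} (F M)"
  shows "(\<i> * complex_of_real u) ^ M * fourier (\<lambda>x. indicator {a..b} x * F 0 x) u =
     (\<Sum>j<M. (- 1) ^ j * (\<i> * complex_of_real u) ^ (M - 1 - j) * bracket F a b u j)
     + (- 1) ^ M * fourier (\<lambda>x. indicator {a..b} x * F M x) u"
  using der cont
proof (induction M)
  case (Suc M)
  have cM: "continuous_on {a..b} (F M)"
    using Suc.prems(1)[of M] by (meson continuous_at_imp_continuous_on has_vector_derivative_continuous lessI)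
  define w where "w = \<i> * complex_of_real u"
  have step: "w * fourier (\<lambda>x. indicator {a..b} x * F M x) u = bracket F a b u M - fourier (\<lambda>x. indicator {a..b} x * F (Suc M) x) u"
    unfolding bracket_def w_def by (rule fourier_parts_step[OF ab Suc.prems(1) Suc.prems(2)]) simp
  have "w ^ Suc M * fourier (\<lambda>x. indicator {a..b} x * F 0 x) u = w * (w ^ M * fourier (\<lambda>x. indicator {a..b} x * F 0 x) u)"
    by (simp add: mult_ac)
  also have "\<dots> = w * (\<Sum>j<M. (- 1) ^ j * w ^ (M - 1 - j) * bracket F a b u j) + (- 1) ^ M * (w * fourier (\<lambda>x. indicator {a..b} x * F M x) u)"
    unfolding w_def by (subst Suc.IH) (use Suc.prems(1) cM in \<open>auto simp: algebra_simps\<close>)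
  also have "w * (\<Sum>j<M. (- 1) ^ j * w ^ (M - 1 - j) * bracket F a b u j) = (\<Sum>j<M. (- 1) ^ j * w ^ (Suc M - 1 - j) * bracket F a b u j)"
    unfolding sum_distrib_left
  proof (rule sum.cong[OF refl])
    fix j assume "j \<in> {..<M}"
    then have "Suc M - 1 - j = Suc (M - 1 - j)" by auto
    then show "w * ((- 1) ^ j * w ^ (M - 1 - j) * bracket F a b u j) = (- 1) ^ j * w ^ (Suc M - 1 - j) * bracket F a b u j"
      by (simp only: power_Suc mult_ac)
  qed
  finally show ?case unfolding step w_def[symmetric] by (simp add: algebra_simps)
qed simp

text \<open>The coefficient of \<open>u ^ i\<close> belongs to the derivative of order \<open>2 * N - 1 - i\<close>; the signs come from
  \<open>2 * N\<close> integrations by parts and from \<open>(\<i> * u) ^ (2 * N) = (- 1) ^ N * u ^ (2 * N)\<close>.\<close>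

definition end_coeff :: "nat \<Rightarrow> (nat \<Rightarrow> real \<Rightarrow> complex) \<Rightarrow> real \<Rightarrow> nat \<Rightarrow> complex" where
  "end_coeff N F x i = (- 1) ^ N * (- 1) ^ (2 * N - 1 - i) * \<i> ^ i * F (2 * N - 1 - i) x"

text \<open>Derivatives of order below \<open>N\<close> do not jump, apart from the jump \<open>d\<close> of the function itself
  at \<open>b\<close>; what is left are powers of \<open>u\<close> below \<open>N\<close>, the range of the boundary estimate.\<close>

lemma fourier_contact:
  assumes ab: "a \<le> b" and N: "N \<ge> 1"
    and der: "\<And>j x. (F j has_vector_derivative F (Suc j) x) (at x)"
    and contact: "\<And>j. j < N \<Longrightarrow> F j a = 0" "\<And>j. j < N \<Longrightarrow> F j b = (if j = 0 then d else 0)"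
  shows "complex_of_real (u ^ (2 * N)) * fourier (\<lambda>x. indicator {a..b} x * F 0 x) u =
     end_terms N a b (\<lambda>i. - end_coeff N F a i) (end_coeff N F b) u
     + (- 1) ^ N * ((\<i> * complex_of_real u) ^ (2 * N - 1) * d * iexp (b * u) + fourier (\<lambda>x. indicator {a..b} x * F (2 * N) x) u)"
proof -
  define w where "w = \<i> * complex_of_real u"
  define f where "f j = (- 1) ^ j * w ^ (2 * N - 1 - j) * bracket F a b u j" for j
  have cont: "continuous_on {a..b} (F (2 * N))"
    using der by (meson continuous_at_imp_continuous_on has_vector_derivative_continuous)
  have sgn: "w ^ (2 * N) = (- 1) ^ N * complex_of_real (u ^ (2 * N))"
    by (simp add: w_def power_mult_distrib power_mult power_minus[of "(complex_of_real u)\<^sup>2" N])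
  have "w ^ (2 * N) * fourier (\<lambda>x. indicator {a..b} x * F 0 x) u = (\<Sum>j<2 * N. f j) + (- 1) ^ (2 * N) * fourier (\<lambda>x. indicator {a..b} x * F (2 * N) x) u"
    unfolding f_def w_def by (rule fourier_parts[OF ab der cont])
  also have "(\<Sum>j<2 * N. f j) = (\<Sum>j<N. f j) + (\<Sum>j=N..<2 * N. f j)"
    unfolding lessThan_atLeast0 by (rule sum.atLeastLessThan_concat[symmetric]) auto
  also have "(\<Sum>j<N. f j) = (\<Sum>j<N. if j = 0 then w ^ (2 * N - 1) * d * iexp (b * u) else 0)"
    by (intro sum.cong) (auto simp: f_def bracket_def contact)
  also have "\<dots> = w ^ (2 * N - 1) * d * iexp (b * u)"
    using N by simp
  also have "(\<Sum>j=N..<2 * N. f j) = (\<Sum>i<N. f (2 * N - 1 - i))"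
    by (rule sum.reindex_bij_witness[of _ "\<lambda>i. 2 * N - 1 - i" "\<lambda>j. 2 * N - 1 - j"]) auto
  also have "\<dots> = (- 1) ^ N * end_terms N a b (\<lambda>i. - end_coeff N F a i) (end_coeff N F b) u"
    unfolding sum_distrib_left
  proof (rule sum.cong[OF refl])
    fix i assume "i \<in> {..<N}"
    then have e: "2 * N - 1 - (2 * N - 1 - i) = i" by auto
    have s: "(- 1) ^ N * ((- 1) ^ N * z) = z" for z :: complex
      by (simp flip: mult.assoc power_mult_distrib)
    show "f (2 * N - 1 - i) = (- 1) ^ N * (complex_of_real (u ^ i) * (- end_coeff N F a i * iexp (a * u) + end_coeff N F b i * iexp (b * u)))"
      unfolding f_def e w_def end_coeff_def bracket_def
      by (simp add: power_mult_distrib algebra_simps s)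
  qed
  finally have "(- 1) ^ N * (w ^ (2 * N) * fourier (\<lambda>x. indicator {a..b} x * F 0 x) u) = (- 1) ^ N *
     ((- 1) ^ N * end_terms N a b (\<lambda>i. - end_coeff N F a i) (end_coeff N F b) u
      + (w ^ (2 * N - 1) * d * iexp (b * u) + fourier (\<lambda>x. indicator {a..b} x * F (2 * N) x) u))"
    by (simp add: add_ac)
  moreover have s: "(- 1) ^ N * ((- 1) ^ N * z) = z" for z :: complex
    by (simp flip: mult.assoc power_mult_distrib)
  ultimately show ?thesis unfolding sgn w_def[symmetric] by (simp only: distrib_left[of "(- 1) ^ N"] mult.assoc s)
qed

lemma poly_of_real_has_vector_derivative:
  "((\<lambda>x. poly p (complex_of_real x)) has_vector_derivative poly (pderiv p) (complex_of_real x)) (at x)"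
  by (rule has_vector_derivative_real_field[OF poly_DERIV])

context step_law
begin

text \<open>The values of \<open>S\<close> are prescribed only for \<open>v \<noteq> 0\<close>, since the transforms below are known up to a
  division by a power of \<open>v\<close>.\<close>

lemma defect_inversion:
  assumes G: "L1_bdd G" and cont: "isCont G x"
    and S: "integrable lborel S" "\<And>v. v \<noteq> 0 \<Longrightarrow> complex_of_real (gap N r v) * fourier G v = S v"
  shows "2 * pi * (G x - avg q G x) = (LINT v|lborel. iexp_neg (x * v) * S v)"
proof -
  have [measurable]: "G \<in> borel_measurable borel" "S \<in> borel_measurable borel"
    using L1_bddD[OF G] S(1) by (auto dest: borel_measurable_integrable)
  note Gi = L1_bddD(1)[OF G]
  have Q: "L1_bdd (avg q G)" by (rule L1_bdd_avg[OF q G])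
  have D: "L1_bdd (\<lambda>x. G x - avg q G x)"
  proof -
    obtain B C where "\<And>x. norm (G x) \<le> B" "\<And>x. norm (avg q G x) \<le> C" using L1_bddD(3)[OF G] L1_bddD(3)[OF Q] by blast
    then have "norm (G x - avg q G x) \<le> B + C" for x
      using norm_triangle_ineq4[of "G x" "avg q G x"] add_mono order_trans by blast
    then show ?thesis using Gi L1_bddD(1)[OF Q] by (intro L1_bddI[where B = "B + C"]) auto
  qed
  have F: "fourier (\<lambda>x. G x - avg q G x) v = complex_of_real (gap N r v) * fourier G v" for v
    using Gi L1_bddD(1)[OF Q] fourier_avg_q[OF Gi] by (simp add: fourier_diff gap_def algebra_simps)
  have AE: "AE v in lborel. fourier (\<lambda>x. G x - avg q G x) v = S v"
    using AE_lborel_singleton[of 0] by eventually_elim (simp add: F S(2))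
  have "2 * pi * (G x - avg q G x) = (LINT v|lborel. iexp_neg (x * v) * fourier (\<lambda>x. G x - avg q G x) v)"
  proof (rule fourier_inversion[OF D, symmetric])
    have "isCont (avg q G) x" using G by (intro avg_q_isCont) (auto simp: L1_bdd_def)
    then show "isCont (\<lambda>x. G x - avg q G x) x" using cont by (intro continuous_diff)
    show "integrable lborel (fourier (\<lambda>x. G x - avg q G x))"
      using S(1) by (subst integrable_cong_AE[OF _ _ AE]) auto
  qed
  also have "\<dots> = (LINT v|lborel. iexp_neg (x * v) * S v)"
    by (rule integral_cong_AE) (use AE in \<open>auto elim: eventually_mono\<close>)
  finally show ?thesis .
qed

lemma avg_q_exp:
  "avg q (\<lambda>x. iexp (\<mu> * x)) x = complex_of_real (exp (- (r * \<mu> ^ (2 * N)))) * iexp (\<mu> * x)"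
proof -
  have "avg q (\<lambda>x. iexp (\<mu> * x)) x = (LINT y|lborel. iexp (\<mu> * x) * (iexp (y * \<mu>) * q y))"
    unfolding avg_def by (intro Bochner_Integration.integral_cong) (auto simp: algebra_simps exp_add)
  also have "\<dots> = iexp (\<mu> * x) * fourier q \<mu>" unfolding fourier_def by simp
  finally show ?thesis by (simp add: fourier_q mult.commute)
qed


text \<open>The exponential is an eigenfunction of the step, so it is split off, and \<open>G = g - iexp (\<mu> * x)\<close> is supported in
  \<open>{a..b}\<close> with contact of order \<open>N\<close> at both ends.\<close>

lemma defect_exp:
  fixes p :: "complex poly"
  assumes ab: "a < b" and p: "(pderiv ^^ (2 * N)) p = 0"
    and jets: "\<And>j. j < N \<Longrightarrow> poly ((pderiv ^^ j) p) (complex_of_real a) = (\<i> * complex_of_real \<mu>) ^ j * iexp (\<mu> * a)"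
       "\<And>j. j < N \<Longrightarrow> poly ((pderiv ^^ j) p) (complex_of_real b) = (\<i> * complex_of_real \<mu>) ^ j * iexp (\<mu> * b)"
  defines "g \<equiv> \<lambda>x. if x \<in> {a<..<b} then poly p (complex_of_real x) else iexp (\<mu> * x)"
    and "E \<equiv> \<lambda>x. indicator {a..b} x * iexp (\<mu> * x)"
    and "F \<equiv> \<lambda>j x. poly ((pderiv ^^ j) p) (complex_of_real x) - (\<i> * complex_of_real \<mu>) ^ j * iexp (\<mu> * x)"
  assumes x: "x \<in> {a<..<b}"
  shows "2 * pi * (g x - avg q g x) = (LINT v|lborel. iexp_neg (x * v) *
            residual N r a b (\<lambda>i. - end_coeff N F a i) (end_coeff N F b) (\<lambda>v. - (1 * complex_of_real (\<mu> ^ (2 * N)) * fourier E v)) v)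
        + 2 * pi * (1 * complex_of_real (gap N r \<mu>) * E x)"
proof -
  let ?e = "\<lambda>x. iexp (\<mu> * x)"
  let ?R = "residual N r a b (\<lambda>i. - end_coeff N F a i) (end_coeff N F b) (\<lambda>v. - (1 * complex_of_real (\<mu> ^ (2 * N)) * fourier E v))"
  define G where "G x = indicator {a..b} x * F 0 x" for x
  have der: "(F j has_vector_derivative F (Suc j) x) (at x)" for j x
    unfolding F_def
    by (auto intro!: derivative_eq_intros poly_of_real_has_vector_derivative has_vector_derivative_real_field simp: mult_ac)
  have F0: "F j a = 0" "F j b = (if j = 0 then 0 else 0)" if "j < N" for j using jets[OF that] by (auto simp: F_def)
  have cont: "continuous_on A (F j)" for A j
    using der by (meson continuous_at_imp_continuous_on has_vector_derivative_continuous)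
  have E: "L1_bdd E" unfolding E_def by (rule L1_bdd_indicator_mult) (intro continuous_intros)
  have G: "L1_bdd G" unfolding G_def by (rule L1_bdd_indicator_mult[OF cont])
  have [measurable]: "E \<in> borel_measurable borel" "G \<in> borel_measurable borel" using L1_bddD E G by auto
  have gG: "g = (\<lambda>x. ?e x + G x)"
  proof
    fix x
    show "g x = ?e x + G x"
      using F0[of 0] N by (cases "x = a \<or> x = b") (auto simp: g_def G_def F_def indicator_def)
  qed
  have eb: "?e \<in> borel_measurable borel" "bounded (range ?e)" by (auto simp: bounded_iff)
  have S: "integrable lborel ?R"
    by (rule residual_integrable[OF N, where M = "norm (complex_of_real (\<mu> ^ (2 * N))) * (LINT x|lborel. norm (E x))"])
       (use r in \<open>auto simp: norm_mult intro!: mult_left_mono norm_fourier_le\<close>)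
  have FS: "complex_of_real (gap N r v) * fourier G v = ?R v" if v: "v \<noteq> 0" for v
  proof -
    have F2: "fourier (\<lambda>x. indicator {a..b} x * F (2 * N) x) v = - ((- 1) ^ N * complex_of_real (\<mu> ^ (2 * N)) * fourier E v)"
    proof -
      have "(\<lambda>x. indicator {a..b} x * F (2 * N) x) = (\<lambda>x. - ((- 1) ^ N * complex_of_real (\<mu> ^ (2 * N))) * E x)"
        by (auto simp: F_def p E_def power_mult_distrib power_mult[of _ 2] power_minus[of "(complex_of_real \<mu>)\<^sup>2" N])
      then show ?thesis by (simp only: fourier_cmult) simp
    qed
    have "complex_of_real (v ^ (2 * N)) * fourier G v = end_terms N a b (\<lambda>i. - end_coeff N F a i) (end_coeff N F b) v
     + (- 1) ^ N * ((\<i> * complex_of_real v) ^ (2 * N - 1) * 0 * iexp (b * v) + fourier (\<lambda>x. indicator {a..b} x * F (2 * N) x) v)"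
      unfolding G_def by (rule fourier_contact[OF less_imp_le[OF ab] N der F0])
    also have "(- 1) ^ N * ((\<i> * complex_of_real v) ^ (2 * N - 1) * 0 * iexp (b * v) + fourier (\<lambda>x. indicator {a..b} x * F (2 * N) x) v)
       = - (1 * complex_of_real (\<mu> ^ (2 * N)) * fourier E v)"
      unfolding F2 by (simp flip: mult.assoc power_mult_distrib)
    finally have *: "end_terms N a b (\<lambda>i. - end_coeff N F a i) (end_coeff N F b) v
       + - (1 * complex_of_real (\<mu> ^ (2 * N)) * fourier E v) = complex_of_real (v ^ (2 * N)) * fourier G v" by simp
    show ?thesis unfolding residual_def * using v by simp
  qed
  have "isCont G x"
  proof -
    have "continuous_on {a<..<b} G"
      by (rule continuous_on_eq[OF cont[of _ 0]]) (auto simp: G_def)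
    then show ?thesis using x continuous_on_eq_continuous_at open_greaterThanLessThan by blast
  qed
  from defect_inversion[OF G this S FS]
  have "2 * pi * (G x - avg q G x) = (LINT v|lborel. iexp_neg (x * v) * ?R v)" .
  moreover have "avg q g x = avg q ?e x + avg q G x"
    unfolding gG by (rule avg_add[OF q eb(1) L1_bddD(2)[OF G] eb(2)]) (use G in \<open>simp add: L1_bdd_def\<close>)
  moreover have "?e x - avg q ?e x = complex_of_real (gap N r \<mu>) * E x"
    unfolding avg_q_exp gap_def E_def using x by (simp add: algebra_simps)
  moreover have "2 * pi * (g x - avg q g x) = 2 * pi * (G x - avg q G x) + 2 * pi * (?e x - avg q ?e x)"
    unfolding \<open>avg q g x = avg q ?e x + avg q G x\<close> by (simp add: gG algebra_simps)
  ultimately show ?thesis by simp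
qed

text \<open>Near \<open>0\<close> the gap vanishes at least like \<open>v ^ 2\<close>, and at infinity it is bounded.\<close>

lemma gap_over_square_integrable:
  "integrable lborel (\<lambda>v. (norm (complex_of_real (gap N r v / v)))\<^sup>2)"
proof (rule Bochner_Integration.integrable_bound)
  show "integrable lborel (\<lambda>v. 2 * (r + 1)\<^sup>2 * (1 / (1 + v\<^sup>2)))"
    by (intro integrable_mult_right integrable_inverse_1_plus_square_lborel)
  have "(gap N r v / v)\<^sup>2 \<le> 2 * (r + 1)\<^sup>2 * (1 / (1 + v\<^sup>2))" for v
  proof (cases "\<bar>v\<bar> \<le> 1")
    case True
    have "\<bar>gap N r v\<bar> \<le> r * \<bar>v\<bar>"
    proof -
      have "v ^ (2 * N) = \<bar>v\<bar> ^ (2 * N)" by (simp add: power_even_abs)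
      also have "\<dots> \<le> \<bar>v\<bar> ^ 1" using True N by (intro power_decreasing) auto
      finally have "r * v ^ (2 * N) \<le> r * \<bar>v\<bar>" using r by (intro mult_left_mono) auto
      then show ?thesis using gap_le[of N r v] gap_nonneg[of r N v] r by linarith
    qed
    then have "\<bar>gap N r v / v\<bar> \<le> r" using r by (cases "v = 0") (auto simp: abs_divide divide_le_eq)
    then have "(gap N r v / v)\<^sup>2 \<le> (r + 1)\<^sup>2" using r by (intro power2_le_iff_abs_le[THEN iffD2]) auto
    also have "\<dots> = 2 * (r + 1)\<^sup>2 * (1 / 2)" by simp
    also have "\<dots> \<le> 2 * (r + 1)\<^sup>2 * (1 / (1 + v\<^sup>2))"
      using True by (intro mult_left_mono divide_left_mono) (auto simp: abs_square_le_1 add_pos_nonneg)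
    finally show ?thesis .
  next
    case False
    then have v: "1 \<le> v\<^sup>2" using abs_le_square_iff[of 1 v] by simp
    have "(gap N r v / v)\<^sup>2 \<le> 1 / v\<^sup>2"
      unfolding power_divide using gap_nonneg[of r N v] gap_le_1[of N r v] r by (intro divide_right_mono) (auto simp: power_le_one)
    also have "\<dots> = 2 * 1\<^sup>2 * (1 / (2 * v\<^sup>2))" by simp
    also have "\<dots> \<le> 2 * (r + 1)\<^sup>2 * (1 / (1 + v\<^sup>2))"
      using v r by (intro mult_mono divide_left_mono power_mono) (auto intro!: mult_pos_pos add_pos_nonneg)
    finally show ?thesis .
  qed
  then show "AE v in lborel. norm ((norm (complex_of_real (gap N r v / v)))\<^sup>2) \<le> norm (2 * (r + 1)\<^sup>2 * (1 / (1 + v\<^sup>2)))"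
    by (intro AE_I2) (simp only: norm_of_real power2_abs real_norm_def abs_power2 order_trans[OF _ abs_ge_self])
qed measurable

text \<open>The half line \<open>{b..}\<close> has no transform.  It is cut off by a ramp on \<open>{R..R + 1}\<close>, whose contribution
  oscillates faster and faster as \<open>R\<close> grows.  A ramp, unlike a jump, keeps that contribution integrable.\<close>

lemma defect_right_half_line:
  fixes p :: "complex poly"
  assumes ab: "a < b" and p: "(pderiv ^^ (2 * N)) p = 0"
    and jets: "\<And>j. j < N \<Longrightarrow> poly ((pderiv ^^ j) p) (complex_of_real a) = 0"
       "\<And>j. j < N \<Longrightarrow> poly ((pderiv ^^ j) p) (complex_of_real b) = (if j = 0 then 1 else 0)"
  defines "g \<equiv> \<lambda>x. if x \<in> {a<..<b} then poly p (complex_of_real x) else if b \<le> x then 1 else 0"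
    and "F \<equiv> \<lambda>j x. poly ((pderiv ^^ j) p) (complex_of_real x)"
  assumes x: "x \<in> {a<..<b}"
  shows "2 * pi * (g x - avg q g x) = (LINT v|lborel. iexp_neg (x * v) *
            residual N r a b (\<lambda>i. - end_coeff N F a i) (end_coeff N F b) (\<lambda>v. 0) v)"
proof -
  let ?R = "residual N r a b (\<lambda>i. - end_coeff N F a i) (end_coeff N F b) (\<lambda>v. 0)"
  have der: "(F j has_vector_derivative F (Suc j) x) (at x)" for j x
    unfolding F_def using poly_of_real_has_vector_derivative by simp
  have F0: "F j a = 0" "F j b = (if j = 0 then 1 else 0)" if "j < N" for j using jets[OF that] by (auto simp: F_def)
  have cont: "continuous_on A (F j)" for A j
    using der by (meson continuous_at_imp_continuous_on has_vector_derivative_continuous)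
  define R where "R n = real n + b" for n :: nat
  define G0 where "G0 x = indicator {a..b} x * F 0 x" for x
  \<comment> \<open>The three pieces overlap in single points, which no integral sees.\<close>
  define G1 where "G1 n x = indicator {b..R n} x * (1 :: complex)" for n x
  define G2 where "G2 n x = indicator {R n..R n + 1} x * complex_of_real (R n + 1 - x)" for n x
  define G where "G n x = G0 x + (G1 n x + G2 n x)" for n x
  define J where "J x = indicator {0..1} x * (1 :: complex)" for x :: real
  have G0: "L1_bdd G0" unfolding G0_def by (rule L1_bdd_indicator_mult[OF cont])
  have G1: "L1_bdd (G1 n)" and G2: "L1_bdd (G2 n)" and J: "L1_bdd J" for n
    unfolding G1_def G2_def J_def by (rule L1_bdd_indicator_mult, intro continuous_intros)+
  have iG: "integrable lborel G0" "integrable lborel (G1 n)" "integrable lborel (G2 n)" for n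
    using G0 G1 G2 L1_bddD(1) by auto
  have [measurable]: "G0 \<in> borel_measurable borel" "G1 n \<in> borel_measurable borel" "G2 n \<in> borel_measurable borel" "J \<in> borel_measurable borel" for n
    using L1_bddD(2) G0 G1 G2 J by auto
  obtain B0 where B0: "\<And>x. norm (G0 x) \<le> B0" using L1_bddD(3)[OF G0] by blast
  have G_bound: "norm (G n x) \<le> B0 + 2" for n x
  proof -
    have "norm (G1 n x) \<le> 1" by (simp add: G1_def indicator_def)
    moreover have "norm (G2 n x) = indicator {R n..R n + 1} x * \<bar>R n + 1 - x\<bar>"
      unfolding G2_def norm_mult norm_of_real by (simp add: indicator_def)
    then have "norm (G2 n x) \<le> 1" by (simp add: indicator_def)
    moreover have "norm (G n x) \<le> norm (G0 x) + (norm (G1 n x) + norm (G2 n x))"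
      unfolding G_def by (intro order_trans[OF norm_triangle_ineq] add_left_mono norm_triangle_ineq)
    ultimately show ?thesis using B0[of x] by linarith
  qed
  have GL: "L1_bdd (G n)" for n
    using G_bound by (intro L1_bddI[where B = "B0 + 2"]) (auto simp: G_def[abs_def] iG)
  have [measurable]: "G n \<in> borel_measurable borel" for n using L1_bddD(2)[OF GL] .
  have gm [measurable]: "g \<in> borel_measurable borel"
  proof -
    have [measurable]: "(\<lambda>x. poly p (complex_of_real x)) \<in> borel_measurable borel"
      by (intro borel_measurable_continuous_onI) (use cont[of UNIV 0] in \<open>simp add: F_def\<close>)
    show ?thesis unfolding g_def by measurable
  qed
  define H where "H v = complex_of_real (gap N r v / v) * (- \<i> * fourier J v)" for v
  have H: "integrable lborel H"
    unfolding H_def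
    by (rule integrable_mult_L2[OF _ _ gap_over_square_integrable]) (use fourier_square_integrable[OF J] in \<open>auto simp: norm_mult\<close>)
  have S: "integrable lborel ?R"
    by (rule residual_integrable[OF N, where M = 0]) (use r in auto)
  have eH: "integrable lborel (\<lambda>v. iexp (v * R n) * H v)" for n by (rule integrable_exp_i[OF H])
  have FS: "complex_of_real (gap N r v) * fourier (G n) v = ?R v + iexp (v * R n) * H v" if v: "v \<noteq> 0" for v n
  proof -
    define w where "w = \<i> * complex_of_real v"
    have w: "w \<noteq> 0" using v by (simp add: w_def)
    define \<Sigma> where "\<Sigma> = end_terms N a b (\<lambda>i. - end_coeff N F a i) (end_coeff N F b) v"
    have sgn: "complex_of_real (v ^ (2 * N)) = (- 1) ^ N * w ^ (2 * N)"
      by (simp add: w_def power_mult_distrib power_mult power_minus[of "(complex_of_real v)\<^sup>2" N] flip: mult.assoc)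
    have w2: "w ^ (2 * N) = w ^ (2 * N - 1) * w" using N by (metis Suc_diff_1 mult_pos_pos less_le_trans pos2 zero_less_one power_Suc2)
    have f0: "complex_of_real (v ^ (2 * N)) * fourier G0 v = \<Sigma> + (- 1) ^ N * (w ^ (2 * N - 1) * iexp (b * v))"
      using fourier_contact[OF less_imp_le[OF ab] N der F0, of v] unfolding G0_def \<Sigma>_def w_def
      by (simp add: F_def p fourier_def)
    have f1: "w * fourier (G1 n) v = iexp (R n * v) - iexp (b * v)"
    proof -
      have "w * fourier (G1 n) v = 1 * iexp (R n * v) - 1 * iexp (b * v) - fourier (\<lambda>x. indicator {b..R n} x * 0) v"
        unfolding G1_def w_def by (rule fourier_parts_step) (auto simp: R_def)
      then show ?thesis by (simp add: fourier_def)
    qed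
    have f2: "w * fourier (G2 n) v = - iexp (R n * v) + iexp (v * R n) * fourier J v"
    proof -
      have "w * fourier (G2 n) v = complex_of_real (R n + 1 - (R n + 1)) * iexp ((R n + 1) * v) - complex_of_real (R n + 1 - R n) * iexp (R n * v) - fourier (\<lambda>x. indicator {R n..R n + 1} x * (- 1)) v"
        unfolding G2_def w_def by (rule fourier_parts_step) (auto intro!: derivative_eq_intros simp: has_vector_derivative_of_real[THEN has_vector_derivative_eq_rhs])
      also have "fourier (\<lambda>x. indicator {R n..R n + 1} x * (- 1)) v = - fourier (\<lambda>x. J (x + - R n)) v"
      proof -
        have "(\<lambda>x. indicator {R n..R n + 1} x * (- 1)) = (\<lambda>x. (- 1) * J (x + - R n))"
          by (rule ext) (auto simp: J_def indicator_def)
        then show ?thesis by (simp only: fourier_cmult) simp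
      qed
      also have "fourier (\<lambda>x. J (x + - R n)) v = iexp (v * R n) * fourier J v"
        unfolding fourier_shift by (simp add: mult.commute)
      finally show ?thesis by simp
    qed
    have "fourier (G n) v = fourier G0 v + (fourier (G1 n) v + fourier (G2 n) v)"
      unfolding G_def using iG by (simp add: fourier_add)
    then have "complex_of_real (v ^ (2 * N)) * fourier (G n) v
       = complex_of_real (v ^ (2 * N)) * fourier G0 v + (- 1) ^ N * w ^ (2 * N - 1) * (w * fourier (G1 n) v + w * fourier (G2 n) v)"
      by (simp only: distrib_left sgn w2) (simp add: algebra_simps)
    also have "\<dots> = \<Sigma> + (- 1) ^ N * w ^ (2 * N - 1) * (iexp (v * R n) * fourier J v)"
      unfolding f0 f1 f2 by (simp add: algebra_simps)
    also have "(- 1) ^ N * w ^ (2 * N - 1) = complex_of_real (v ^ (2 * N)) / w"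
      unfolding sgn w2 using w by simp
    finally have "complex_of_real (v ^ (2 * N)) * fourier (G n) v = \<Sigma> + complex_of_real (v ^ (2 * N)) / w * (iexp (v * R n) * fourier J v)" .
    then have "complex_of_real (gap N r v / v ^ (2 * N)) * (complex_of_real (v ^ (2 * N)) * fourier (G n) v)
       = complex_of_real (gap N r v / v ^ (2 * N)) * (\<Sigma> + 0) + complex_of_real (gap N r v) / w * (iexp (v * R n) * fourier J v)"
      using v by (simp add: distrib_left)
    also have "complex_of_real (gap N r v) / w = complex_of_real (gap N r v / v) * (- \<i>)"
      by (simp add: w_def divide_inverse)
    finally show ?thesis using v unfolding residual_def \<Sigma>_def[symmetric] H_def by (simp add: mult_ac)
  qed
  have Gx: "G n x = g x" for n
  proof -
    have "R n \<ge> b" by (simp add: R_def)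
    then show ?thesis using x by (auto simp: G_def G0_def G1_def G2_def g_def F_def)
  qed
  have inv: "2 * pi * (G n x - avg q (G n) x) = (LINT v|lborel. iexp_neg (x * v) * ?R v) + fourier H (real n + (b - x))" for n
  proof -
    have "isCont (G n) x"
    proof -
      have "continuous_on {a<..<b} (G n)"
        by (rule continuous_on_eq[OF cont[of _ 0]]) (auto simp: G_def G0_def G1_def G2_def R_def)
      then show ?thesis using x continuous_on_eq_continuous_at open_greaterThanLessThan by blast
    qed
    then have "2 * pi * (G n x - avg q (G n) x) = (LINT v|lborel. iexp_neg (x * v) * (?R v + iexp (v * R n) * H v))"
      using S eH by (intro defect_inversion[OF GL] FS) auto
    also have "\<dots> = (LINT v|lborel. iexp_neg (x * v) * ?R v + iexp (v * (real n + (b - x))) * H v)"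
      by (intro Bochner_Integration.integral_cong) (auto simp: R_def algebra_simps exp_add exp_diff exp_minus divide_inverse)
    also have "\<dots> = (LINT v|lborel. iexp_neg (x * v) * ?R v) + fourier H (real n + (b - x))"
      unfolding fourier_def
      using integrable_exp_i[OF S, of "- x"] integrable_exp_i[OF H, of "real n + (b - x)"]
      by (intro Bochner_Integration.integral_add) (simp_all add: mult.commute)
    finally show ?thesis .
  qed
  have lim: "(\<lambda>n. avg q (G n) x) \<longlonglongrightarrow> avg q g x"
    unfolding avg_def
  proof (rule integral_dominated_convergence[where w = "\<lambda>y. (B0 + 2) * norm (q y)"])
    show "integrable lborel (\<lambda>y. (B0 + 2) * norm (q y))" using q by (intro integrable_mult_right integrable_norm)
    show "AE y in lborel. norm (G n (x + y) * q y) \<le> (B0 + 2) * norm (q y)" for n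
      unfolding norm_mult by (intro AE_I2 mult_right_mono G_bound) auto
    show "AE y in lborel. (\<lambda>n. G n (x + y) * q y) \<longlonglongrightarrow> g (x + y) * q y"
      using AE_lborel_singleton[of "b - x"] AE_lborel_singleton[of "a - x"]
    proof eventually_elim
      case (elim y)
      have "\<forall>\<^sub>F n in sequentially. real n > x + y - b" by real_asymp
      then have "\<forall>\<^sub>F n in sequentially. G n (x + y) * q y = g (x + y) * q y"
      proof eventually_elim
        case (elim n)
        then show ?case
          using \<open>y \<noteq> b - x\<close> \<open>y \<noteq> a - x\<close> ab by (auto simp: G_def G0_def G1_def G2_def R_def g_def F_def indicator_def)
      qed
      then show ?case by (rule tendsto_eventually)
    qed
  qed measurable
  have "(\<lambda>n. 2 * pi * (G n x - avg q (G n) x)) \<longlonglongrightarrow> 2 * pi * (g x - avg q g x)"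
    unfolding Gx by (intro tendsto_intros lim)
  moreover have "(\<lambda>n. (LINT v|lborel. iexp_neg (x * v) * ?R v) + fourier H (real n + (b - x)))
     \<longlonglongrightarrow> (LINT v|lborel. iexp_neg (x * v) * ?R v) + 0"
    by (intro tendsto_intros Riemann_Lebesgue H)
  ultimately show ?thesis unfolding inv using LIMSEQ_unique by fastforce
qed

end

section \<open>Schwartz functions and their transforms\<close>

lemma nth_deriv_0 [simp]: "nth_deriv 0 \<phi> = \<phi>"
  by (simp add: nth_deriv_def)

lemma nth_deriv_Suc: "nth_deriv (Suc j) \<phi> x = vector_derivative (nth_deriv j \<phi>) (at x)"
  by (simp add: nth_deriv_def)

lemma schwartz_nth_deriv:
  assumes "schwartz \<phi>"
  shows "(nth_deriv j \<phi> has_vector_derivative nth_deriv (Suc j) \<phi> x) (at x)"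
    and "\<exists>B. \<forall>x. norm (complex_of_real (x ^ m) * nth_deriv j \<phi> x) \<le> B"
  using assms unfolding schwartz_def nth_deriv_Suc
  by (auto simp: vector_derivative_works[symmetric] bounded_iff)

text \<open>Iterated derivatives are identified by exhibiting a candidate for each of them.\<close>

lemma schwartz_chain:
  assumes G0: "\<phi> = G 0" and der: "\<And>j x. (G j has_vector_derivative G (Suc j) x) (at x)"
    and bdd: "\<And>m j. \<exists>B. \<forall>x. norm (complex_of_real (x ^ m) * G j x) \<le> B"
  shows "schwartz \<phi>" and "nth_deriv j \<phi> = G j"
proof -
  have eq: "nth_deriv j \<phi> = G j" for j
  proof (induction j)
    case (Suc j)
    show ?case
    proof
      fix x show "nth_deriv (Suc j) \<phi> x = G (Suc j) x"
        unfolding nth_deriv_Suc Suc by (rule vector_derivative_at[OF der])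
    qed
  qed (simp add: G0)
  show "nth_deriv j \<phi> = G j" by (rule eq)
  show "schwartz \<phi>"
    unfolding schwartz_def eq
  proof (intro conjI allI)
    show "G j differentiable at x" for j x using der by (rule differentiableI_vector)
    show "bounded (range (\<lambda>x. complex_of_real (x ^ m) * G j x))" for m j
      using bdd[of m j] unfolding bounded_iff by auto
  qed
qed

lemma bound_add:
  assumes "\<exists>B. \<forall>x. norm (f x) \<le> B" "\<exists>B. \<forall>x. norm (g x) \<le> B"
  shows "\<exists>B. \<forall>x. norm (f x + g x) \<le> B"
  using assms by (meson norm_triangle_mono)

lemma bound_cmult:
  fixes f :: "'a \<Rightarrow> complex"
  assumes "\<exists>B. \<forall>x. norm (f x) \<le> B"
  shows "\<exists>B. \<forall>x. norm (c * f x) \<le> B"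
  using assms by (metis mult_left_mono norm_ge_zero norm_mult)

lemma schwartz_add:
  assumes "schwartz \<phi>" "schwartz \<psi>"
  shows "schwartz (\<lambda>x. \<phi> x + \<psi> x)" and "nth_deriv j (\<lambda>x. \<phi> x + \<psi> x) = (\<lambda>x. nth_deriv j \<phi> x + nth_deriv j \<psi> x)"
proof -
  let ?G = "\<lambda>j x. nth_deriv j \<phi> x + nth_deriv j \<psi> x"
  have 1: "(?G j has_vector_derivative ?G (Suc j) x) (at x)" for j x
    by (intro has_vector_derivative_add schwartz_nth_deriv assms)
  have 2: "\<exists>B. \<forall>x. norm (complex_of_real (x ^ m) * ?G j x) \<le> B" for m j
    unfolding distrib_left by (intro bound_add schwartz_nth_deriv assms)
  show "schwartz (\<lambda>x. \<phi> x + \<psi> x)" by (rule schwartz_chain(1)[where G = ?G, OF _ 1 2]) simp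
  show "nth_deriv j (\<lambda>x. \<phi> x + \<psi> x) = ?G j" by (rule schwartz_chain(2)[where G = ?G, OF _ 1 2]) simp
qed

lemma schwartz_cmult:
  assumes "schwartz \<phi>"
  shows "schwartz (\<lambda>x. c * \<phi> x)" and "nth_deriv j (\<lambda>x. c * \<phi> x) = (\<lambda>x. c * nth_deriv j \<phi> x)"
proof -
  let ?G = "\<lambda>j x. c * nth_deriv j \<phi> x"
  have 1: "(?G j has_vector_derivative ?G (Suc j) x) (at x)" for j x
    by (intro has_vector_derivative_mult_right schwartz_nth_deriv assms)
  have 2: "\<exists>B. \<forall>x. norm (complex_of_real (x ^ m) * ?G j x) \<le> B" for m j
    using bound_cmult[OF schwartz_nth_deriv(2)[OF assms]] by (simp add: mult.left_commute)
  show "schwartz (\<lambda>x. c * \<phi> x)" by (rule schwartz_chain(1)[where G = ?G, OF _ 1 2]) simp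
  show "nth_deriv j (\<lambda>x. c * \<phi> x) = ?G j" by (rule schwartz_chain(2)[where G = ?G, OF _ 1 2]) simp
qed

lemma schwartz_deriv:
  assumes "schwartz \<phi>"
  shows "schwartz (nth_deriv 1 \<phi>)"
  by (rule schwartz_chain(1)[where G = "\<lambda>j. nth_deriv (Suc j) \<phi>"])
     (use schwartz_nth_deriv[OF assms] in auto)

lemma schwartz_times_x:
  assumes "schwartz \<phi>"
  shows "schwartz (\<lambda>x. complex_of_real x * \<phi> x)"
proof (rule schwartz_chain(1))
  let ?G = "\<lambda>j x. complex_of_real x * nth_deriv j \<phi> x + of_nat j * nth_deriv (j - 1) \<phi> x"
  show "(\<lambda>x. complex_of_real x * \<phi> x) = ?G 0" by simp
  show "(?G j has_vector_derivative ?G (Suc j) x) (at x)" for j x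
  proof -
    have "((\<lambda>x. of_nat j * nth_deriv (j - 1) \<phi> x) has_vector_derivative of_nat j * nth_deriv j \<phi> x) (at x)"
    proof (cases j)
      case (Suc k)
      then show ?thesis using schwartz_nth_deriv(1)[OF assms, of k x] by (auto intro: has_vector_derivative_mult_right)
    qed simp
    moreover have "((\<lambda>x. complex_of_real x) has_vector_derivative 1) (at x)"
      by (rule has_vector_derivative_real_field) (auto intro!: derivative_eq_intros)
    from has_vector_derivative_mult[OF this schwartz_nth_deriv(1)[OF assms, of j x]]
    have "((\<lambda>x. complex_of_real x * nth_deriv j \<phi> x) has_vector_derivative complex_of_real x * nth_deriv (Suc j) \<phi> x + 1 * nth_deriv j \<phi> x) (at x)" .
    ultimately have "(?G j has_vector_derivative (complex_of_real x * nth_deriv (Suc j) \<phi> x + 1 * nth_deriv j \<phi> x) + of_nat j * nth_deriv j \<phi> x) (at x)"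
      by (intro has_vector_derivative_add)
    then show ?thesis by (simp add: algebra_simps)
  qed
  show "\<exists>B. \<forall>x. norm (complex_of_real (x ^ m) * ?G j x) \<le> B" for m j
  proof -
    have "\<exists>B. \<forall>x. norm (complex_of_real (x ^ Suc m) * nth_deriv j \<phi> x + of_nat j * (complex_of_real (x ^ m) * nth_deriv (j - 1) \<phi> x)) \<le> B"
      by (intro bound_add bound_cmult schwartz_nth_deriv assms)
    then show ?thesis by (simp add: algebra_simps)
  qed
qed

lemma schwartz_reflect:
  assumes "schwartz \<phi>"
  shows "schwartz (\<lambda>x. \<phi> (- x))"
proof (rule schwartz_chain(1))
  let ?G = "\<lambda>j x. (- 1) ^ j * nth_deriv j \<phi> (- x)"
  show "(\<lambda>x. \<phi> (- x)) = ?G 0" by simp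
  show "(?G j has_vector_derivative ?G (Suc j) x) (at x)" for j x
  proof -
    have "((\<lambda>x. - x) has_real_derivative - 1) (at x)" by (auto intro!: derivative_eq_intros)
    then have "((\<lambda>x. - x) has_vector_derivative - 1) (at x)" by (simp add: has_real_derivative_iff_has_vector_derivative)
    from vector_diff_chain_at[OF this schwartz_nth_deriv(1)[OF assms, of j "- x"]]
    have "((\<lambda>x. nth_deriv j \<phi> (- x)) has_vector_derivative - nth_deriv (Suc j) \<phi> (- x)) (at x)" by (simp add: comp_def)
    from has_vector_derivative_mult_right[OF this, of "(- 1) ^ j"] show ?thesis by simp
  qed
  show "\<exists>B. \<forall>x. norm (complex_of_real (x ^ m) * ?G j x) \<le> B" for m j
  proof -
    obtain B where B: "\<And>x. norm (complex_of_real (x ^ m) * nth_deriv j \<phi> x) \<le> B" using schwartz_nth_deriv(2)[OF assms] by blast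
    have "norm (complex_of_real (x ^ m) * ?G j x) \<le> B" for x
      using B[of "- x"] by (simp add: norm_mult norm_power)
    then show ?thesis by blast
  qed
qed

lemma schwartz_continuous: "schwartz \<phi> \<Longrightarrow> continuous_on A \<phi>"
  using schwartz_nth_deriv(1)[of \<phi> 0] by (auto intro!: continuous_at_imp_continuous_on has_vector_derivative_continuous)

lemma schwartz_L1_bdd:
  assumes "schwartz \<phi>"
  shows "L1_bdd \<phi>"
proof -
  have [measurable]: "\<phi> \<in> borel_measurable borel" by (intro borel_measurable_continuous_onI schwartz_continuous assms)
  obtain B0 B2 where B: "\<And>x. norm (complex_of_real (x ^ 0) * nth_deriv 0 \<phi> x) \<le> B0" "\<And>x. norm (complex_of_real (x ^ 2) * nth_deriv 0 \<phi> x) \<le> B2"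
    using schwartz_nth_deriv(2)[OF assms] by metis
  have "integrable lborel \<phi>"
  proof (rule Bochner_Integration.integrable_bound)
    show "integrable lborel (\<lambda>x. (B0 + B2) * (1 / (1 + x\<^sup>2)))" by (intro integrable_mult_right integrable_inverse_1_plus_square_lborel)
    have "norm (\<phi> x) \<le> norm ((B0 + B2) * (1 / (1 + x\<^sup>2)))" for x
    proof -
      have "norm (\<phi> x) + x\<^sup>2 * norm (\<phi> x) \<le> B0 + B2"
        using add_mono[OF B(1)[of x] B(2)[of x]] by (simp add: norm_mult norm_power)
      then have "norm (\<phi> x) * (1 + x\<^sup>2) \<le> B0 + B2" by (simp add: algebra_simps)
      then have "norm (\<phi> x) \<le> (B0 + B2) * (1 / (1 + x\<^sup>2))" by (simp add: pos_le_divide_eq add_pos_nonneg)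
      then show ?thesis unfolding real_norm_def by (rule order_trans[OF _ abs_ge_self])
    qed
    then show "AE x in lborel. norm (\<phi> x) \<le> norm ((B0 + B2) * (1 / (1 + x\<^sup>2)))" by simp
  qed measurable
  then show ?thesis using B(1) by (intro L1_bddI[where B = B0]) auto
qed

lemma schwartz_times_power:
  assumes "schwartz \<phi>"
  shows "schwartz (\<lambda>x. (\<i> * complex_of_real x) ^ j * \<phi> x)"
proof (induction j)
  case (Suc j)
  have "schwartz (\<lambda>x. \<i> * (complex_of_real x * ((\<i> * complex_of_real x) ^ j * \<phi> x)))"
    by (intro schwartz_cmult(1) schwartz_times_x Suc)
  then show ?case by (simp add: mult_ac)
qed (use assms in simp)

text \<open>The second order Taylor remainder of the exponential is dominated by \<open>x\<^sup>2 * norm (\<phi> x)\<close>, which is integrable.\<close>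

lemma fourier_has_vector_derivative:
  assumes \<phi>: "schwartz \<phi>"
  shows "(fourier \<phi> has_vector_derivative fourier (\<lambda>x. \<i> * complex_of_real x * \<phi> x) z) (at z)"
proof -
  define \<phi>1 where "\<phi>1 x = \<i> * complex_of_real x * \<phi> x" for x
  have i0: "integrable lborel \<phi>" by (rule L1_bddD(1)[OF schwartz_L1_bdd[OF \<phi>]])
  have i1: "integrable lborel \<phi>1"
    using L1_bddD(1)[OF schwartz_L1_bdd[OF schwartz_times_power[OF \<phi>, of 1]]] by (simp add: \<phi>1_def[abs_def])
  have i2: "integrable lborel (\<lambda>x. norm ((\<i> * complex_of_real x)\<^sup>2 * \<phi> x))"
    using L1_bddD(1)[OF schwartz_L1_bdd[OF schwartz_times_power[OF \<phi>, of 2]]] by simp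
  define C where "C = (LINT x|lborel. norm ((\<i> * complex_of_real x)\<^sup>2 * \<phi> x))"
  have main: "norm (fourier \<phi> y - fourier \<phi> z - (y - z) *\<^sub>R fourier \<phi>1 z) \<le> (y - z)\<^sup>2 * C" for y
  proof -
    define h where "h = y - z"
    have "fourier \<phi> y - fourier \<phi> z - h *\<^sub>R fourier \<phi>1 z =
       (LINT x|lborel. iexp (x * y) * \<phi> x - iexp (x * z) * \<phi> x - h *\<^sub>R (iexp (x * z) * \<phi>1 x))"
      unfolding fourier_def
      using integrable_exp_i[OF i0, of y] integrable_exp_i[OF i0, of z] integrable_exp_i[OF i1, of z]
      by simp
    also have "\<dots> = (LINT x|lborel. iexp (x * z) * \<phi> x * (iexp (x * h) - 1 - \<i> * complex_of_real (x * h)))"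
    proof (rule Bochner_Integration.integral_cong[OF refl])
      fix x
      have "iexp (x * y) = iexp (x * z) * iexp (x * h)"
        by (simp add: h_def exp_add[symmetric] algebra_simps)
      then show "iexp (x * y) * \<phi> x - iexp (x * z) * \<phi> x - h *\<^sub>R (iexp (x * z) * \<phi>1 x)
         = iexp (x * z) * \<phi> x * (iexp (x * h) - 1 - \<i> * complex_of_real (x * h))"
        by (simp add: \<phi>1_def scaleR_conv_of_real algebra_simps)
    qed
    also have "norm \<dots> \<le> (LINT x|lborel. h\<^sup>2 * norm ((\<i> * complex_of_real x)\<^sup>2 * \<phi> x))"
    proof (rule order_trans[OF integral_norm_bound], rule integral_mono)
      have [measurable]: "\<phi> \<in> borel_measurable borel" using i0 by (auto dest: borel_measurable_integrable)
      have b: "norm (iexp (x * z) * \<phi> x * (iexp (x * h) - 1 - \<i> * complex_of_real (x * h))) \<le> h\<^sup>2 * norm ((\<i> * complex_of_real x)\<^sup>2 * \<phi> x)" for x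
      proof -
        have "norm (iexp (x * h) - 1 - \<i> * complex_of_real (x * h)) \<le> \<bar>x * h\<bar>\<^sup>2 / 2"
          using iexp_approx1[of "x * h" 1] by (simp add: diff_diff_eq power2_eq_square)
        also have "\<dots> \<le> (x * h)\<^sup>2" by simp
        finally have "norm (\<phi> x) * norm (iexp (x * h) - 1 - \<i> * complex_of_real (x * h)) \<le> norm (\<phi> x) * (x * h)\<^sup>2"
          by (rule mult_left_mono) simp
        then show ?thesis by (simp add: norm_mult norm_power power_mult_distrib mult_ac)
      qed
      then show "norm (iexp (x * z) * \<phi> x * (iexp (x * h) - 1 - \<i> * complex_of_real (x * h))) \<le> h\<^sup>2 * norm ((\<i> * complex_of_real x)\<^sup>2 * \<phi> x)" for x .
      show "integrable lborel (\<lambda>x. h\<^sup>2 * norm ((\<i> * complex_of_real x)\<^sup>2 * \<phi> x))" by (intro integrable_mult_right i2)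
      show "integrable lborel (\<lambda>x. norm (iexp (x * z) * \<phi> x * (iexp (x * h) - 1 - \<i> * complex_of_real (x * h))))"
      proof (rule integrable_norm, rule Bochner_Integration.integrable_bound[of _ "\<lambda>x. h\<^sup>2 * norm ((\<i> * complex_of_real x)\<^sup>2 * \<phi> x)"])
        show "integrable lborel (\<lambda>x. h\<^sup>2 * norm ((\<i> * complex_of_real x)\<^sup>2 * \<phi> x))" by (intro integrable_mult_right i2)
        show "AE x in lborel. norm (iexp (x * z) * \<phi> x * (iexp (x * h) - 1 - \<i> * complex_of_real (x * h))) \<le> norm (h\<^sup>2 * norm ((\<i> * complex_of_real x)\<^sup>2 * \<phi> x))"
          unfolding real_norm_def by (intro AE_I2 order_trans[OF b abs_ge_self])
      qed measurable
    qed
    finally show ?thesis by (simp add: h_def C_def)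
  qed
  have "(fourier \<phi> has_derivative (\<lambda>h. h *\<^sub>R fourier \<phi>1 z)) (at z)"
  proof (rule has_derivativeI_sandwich[of 1])
    show "bounded_linear (\<lambda>h. h *\<^sub>R fourier \<phi>1 z)" by (rule bounded_linear_scaleR_left)
    fix y assume "y \<noteq> z"
    then show "norm ((fourier \<phi> y - fourier \<phi> z) - (y - z) *\<^sub>R fourier \<phi>1 z) / norm (y - z) \<le> \<bar>y - z\<bar> * C"
      using main[of y] by (simp add: divide_le_eq power2_eq_square mult_ac)
  next
    have "((\<lambda>y. \<bar>y - z\<bar> * C) \<longlongrightarrow> \<bar>z - z\<bar> * C) (at z)" by (intro tendsto_intros)
    then show "((\<lambda>y. \<bar>y - z\<bar> * C) \<longlongrightarrow> 0) (at z)" by simp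
  qed simp
  then show ?thesis unfolding has_vector_derivative_def \<phi>1_def .
qed

lemma fourier_schwartz_deriv:
  assumes \<phi>: "schwartz \<phi>"
  shows "complex_of_real z * fourier \<phi> z = \<i> * fourier (nth_deriv 1 \<phi>) z"
proof -
  note \<phi>' = schwartz_deriv[OF \<phi>]
  have trunc: "(\<lambda>n. fourier (\<lambda>x. indicator {- real n..real n} x * \<psi> x) z) \<longlonglongrightarrow> fourier \<psi> z" if \<psi>: "schwartz \<psi>" for \<psi>
    unfolding fourier_def
  proof (rule integral_dominated_convergence[where w = "\<lambda>x. norm (\<psi> x)"])
    have i: "integrable lborel \<psi>" by (rule L1_bddD(1)[OF schwartz_L1_bdd[OF \<psi>]])
    then have [measurable]: "\<psi> \<in> borel_measurable borel" by (auto dest: borel_measurable_integrable)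
    show "integrable lborel (\<lambda>x. norm (\<psi> x))" using i by simp
    show "(\<lambda>x. iexp (x * z) * \<psi> x) \<in> borel_measurable lborel" by measurable
    show "(\<lambda>x. iexp (x * z) * (indicator {- real n..real n} x * \<psi> x)) \<in> borel_measurable lborel" for n by measurable
    show "AE x in lborel. norm (iexp (x * z) * (indicator {- real n..real n} x * \<psi> x)) \<le> norm (\<psi> x)" for n
      by (intro AE_I2) (simp add: norm_mult indicator_def)
    have "(\<lambda>n. iexp (x * z) * (indicator {- real n..real n} x * \<psi> x)) \<longlonglongrightarrow> iexp (x * z) * \<psi> x" for x
    proof (rule tendsto_eventually)
      have "\<forall>\<^sub>F n in sequentially. real n > \<bar>x\<bar>" by real_asymp
      then show "\<forall>\<^sub>F n in sequentially. iexp (x * z) * (indicator {- real n..real n} x * \<psi> x) = iexp (x * z) * \<psi> x"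
        by eventually_elim (auto simp: indicator_def)
    qed
    then show "AE x in lborel. (\<lambda>n. iexp (x * z) * (indicator {- real n..real n} x * \<psi> x)) \<longlonglongrightarrow> iexp (x * z) * \<psi> x" by simp
  qed
  obtain B where B: "\<And>x. norm (complex_of_real (x ^ 1) * nth_deriv 0 \<phi> x) \<le> B" using schwartz_nth_deriv(2)[OF \<phi>] by metis
  have ends: "(\<lambda>n. \<phi> (s * real n) * iexp (s * real n * z)) \<longlonglongrightarrow> 0" if s: "\<bar>s\<bar> = 1" for s
  proof (rule Lim_null_comparison)
    show "(\<lambda>n. B / real n) \<longlonglongrightarrow> 0" by (rule lim_const_over_n)
    show "\<forall>\<^sub>F n in sequentially. norm (\<phi> (s * real n) * iexp (s * real n * z)) \<le> B / real n"
      using eventually_gt_at_top[of 0]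
    proof eventually_elim
      case (elim n)
      then show ?case using B[of "s * real n"] s by (simp add: norm_mult abs_mult pos_le_divide_eq mult.commute)
    qed
  qed
  have step: "\<i> * complex_of_real z * fourier (\<lambda>x. indicator {- real n..real n} x * \<phi> x) z =
     \<phi> (1 * real n) * iexp (1 * real n * z) - \<phi> (- 1 * real n) * iexp (- 1 * real n * z)
      - fourier (\<lambda>x. indicator {- real n..real n} x * nth_deriv 1 \<phi> x) z" for n
    using fourier_parts_step[of "- real n" "real n" \<phi> "nth_deriv 1 \<phi>" z] schwartz_nth_deriv(1)[OF \<phi>, of 0] schwartz_continuous[OF \<phi>']
    by simp
  have "(\<lambda>n. \<i> * complex_of_real z * fourier (\<lambda>x. indicator {- real n..real n} x * \<phi> x) z) \<longlonglongrightarrow> \<i> * complex_of_real z * fourier \<phi> z"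
    by (intro tendsto_intros trunc \<phi>)
  moreover have "(\<lambda>n. \<i> * complex_of_real z * fourier (\<lambda>x. indicator {- real n..real n} x * \<phi> x) z) \<longlonglongrightarrow> 0 - 0 - fourier (nth_deriv 1 \<phi>) z"
    unfolding step by (intro tendsto_diff ends trunc \<phi>') auto
  ultimately have "\<i> * complex_of_real z * fourier \<phi> z = - fourier (nth_deriv 1 \<phi>) z"
    using LIMSEQ_unique by fastforce
  then have "\<i> * (\<i> * complex_of_real z * fourier \<phi> z) = \<i> * (- fourier (nth_deriv 1 \<phi>) z)" by (rule arg_cong)
  then show ?thesis by (simp flip: mult.assoc)
qed

lemma fourier_rapidly_decreasing:
  assumes "schwartz \<phi>"
  shows "\<exists>B. \<forall>z. norm (complex_of_real (z ^ m) * fourier \<phi> z) \<le> B"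
  using assms
proof (induction m arbitrary: \<phi>)
  case 0
  then show ?case using norm_fourier_le[of \<phi>] by (auto simp del: One_nat_def)
next
  case (Suc m)
  have "complex_of_real (z ^ Suc m) * fourier \<phi> z = \<i> * (complex_of_real (z ^ m) * fourier (nth_deriv 1 \<phi>) z)" for z
  proof -
    have "complex_of_real (z ^ Suc m) * fourier \<phi> z = complex_of_real (z ^ m) * (complex_of_real z * fourier \<phi> z)" by simp
    then show ?thesis unfolding fourier_schwartz_deriv[OF Suc.prems] by simp
  qed
  then show ?case using bound_cmult[OF Suc.IH[OF schwartz_deriv[OF Suc.prems]], of \<i>] by (simp only:)
qed

lemma schwartz_fourier:
  assumes \<phi>: "schwartz \<phi>"
  shows "schwartz (fourier \<phi>)" and "nth_deriv j (fourier \<phi>) = fourier (\<lambda>x. (\<i> * complex_of_real x) ^ j * \<phi> x)"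
proof -
  let ?G = "\<lambda>j. fourier (\<lambda>x. (\<i> * complex_of_real x) ^ j * \<phi> x)"
  have 1: "(?G j has_vector_derivative ?G (Suc j) z) (at z)" for j z
    using fourier_has_vector_derivative[OF schwartz_times_power[OF \<phi>, of j], of z] by (simp add: mult_ac)
  have 2: "\<exists>B. \<forall>z. norm (complex_of_real (z ^ m) * ?G j z) \<le> B" for m j
    by (rule fourier_rapidly_decreasing[OF schwartz_times_power[OF \<phi>]])
  show "schwartz (fourier \<phi>)" by (rule schwartz_chain(1)[where G = ?G, OF _ 1 2]) simp
  show "nth_deriv j (fourier \<phi>) = ?G j" by (rule schwartz_chain(2)[where G = ?G, OF _ 1 2]) simp
qed

text \<open>The transform maps Schwartz functions to Schwartz functions, so Fourier inversion yields a preimage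
  within the class.  A tempered distribution is therefore determined by its values on transforms.\<close>

lemma schwartz_eq_fourier:
  assumes \<phi>: "schwartz \<phi>"
  shows "\<exists>\<psi>. schwartz \<psi> \<and> fourier \<psi> = \<phi>"
proof (intro exI conjI)
  let ?\<psi> = "\<lambda>\<mu>. 1 / complex_of_real (2 * pi) * fourier \<phi> (- \<mu>)"
  show "schwartz ?\<psi>" by (intro schwartz_cmult(1) schwartz_reflect schwartz_fourier \<phi>)
  show "fourier ?\<psi> = \<phi>"
  proof
    fix x
    have c: "isCont \<phi> x" using schwartz_continuous[OF \<phi>, of UNIV] by (simp add: continuous_on_eq_continuous_at)
    have "2 * pi * \<phi> x = (LINT u|lborel. iexp_neg (x * u) * fourier \<phi> u)"
      by (rule fourier_inversion[OF schwartz_L1_bdd[OF \<phi>] c L1_bddD(1)[OF schwartz_L1_bdd[OF schwartz_fourier(1)[OF \<phi>]]], symmetric])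
    also have "\<dots> = fourier (fourier \<phi>) (- x)" unfolding fourier_def[of _ "- x"] by (simp add: mult.commute)
    also have "\<dots> = fourier (\<lambda>u. fourier \<phi> (- u)) x" by (simp add: fourier_uminus)
    finally show "fourier ?\<psi> x = \<phi> x" by (simp only: fourier_cmult) (simp add: field_simps)
  qed
qed

section \<open>The exit distribution\<close>

lemma pseudo_brownian_step_law:
  assumes "N \<ge> 1" "c > 0" "pseudo_brownian N c p" "t > 0"
  shows "step_law N (c * t) (\<lambda>x. complex_of_real (p t x))"
proof
  show "N \<ge> 1" "c * t > 0" using assms by auto
  show "integrable lborel (\<lambda>x. complex_of_real (p t x))"
    using assms(3,4) by (auto simp: pseudo_brownian_def)
  show "fourier (\<lambda>x. complex_of_real (p t x)) u = complex_of_real (exp (- (c * t * u ^ (2 * N))))" for u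
  proof -
    have e: "complex_of_real (x * u) = complex_of_real (u * x)" for x by (simp add: mult.commute)
    show ?thesis using assms(3,4) unfolding pseudo_brownian_def fourier_def e by blast
  qed
qed

lemma (in step_law) kill_funpow_diff:
  assumes f: "f \<in> borel_measurable borel" "bounded (range f)" and g: "g \<in> borel_measurable borel" "bounded (range g)"
  shows "(kill a b ^^ k) (\<lambda>x. f x - g x) = (\<lambda>x. (kill a b ^^ k) f x - (kill a b ^^ k) g x)"
proof (induction k)
  case (Suc k)
  have m: "(kill a b ^^ k) h \<in> borel_measurable borel" "bounded (range ((kill a b ^^ k) h))"
    if "h \<in> borel_measurable borel" "bounded (range h)" for h
  proof -
    have "L1_bdd ((kill a b ^^ Suc l) h)" for l using kill_funpow_L1_bdd[OF that] by blast
    then show "(kill a b ^^ k) h \<in> borel_measurable borel" "bounded (range ((kill a b ^^ k) h))"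
      using that L1_bddD(2) by (cases k, auto simp: L1_bdd_def)+
  qed
  have "kill a b (\<lambda>x. F x - G x) = (\<lambda>x. kill a b F x - kill a b G x)"
    if "F \<in> borel_measurable borel" "G \<in> borel_measurable borel" "bounded (range F)" "bounded (range G)" for F G
    by (rule ext) (simp add: kill_def avg_diff[OF q that])
  from this[OF m(1)[OF f] m(1)[OF g] m(2)[OF f] m(2)[OF g]]
  show ?case by (simp only: funpow.simps o_apply Suc)
qed simp

text \<open>The sum over the step at which the path leaves \<open>(a, b)\<close> is the value at the starting point of the solution of
  the exit problem.\<close>

lemma (in step_law) exit_sums:
  assumes qr: "\<And>y. q y = complex_of_real (qr y)" and ab: "a < b"
    and f: "f \<in> borel_measurable borel" "bounded (range f)"
  shows "\<exists>u. u \<in> borel_measurable borel \<and> bounded (range u) \<and> (\<forall>x. x \<notin> {a<..<b} \<longrightarrow> u x = f x) \<and>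
     (\<forall>x\<in>{a<..<b}. u x = avg q u x) \<and>
     (\<lambda>k. obs_expect qr k (\<lambda>x. survival_weight a b k x * (if x k \<in> {a<..<b} then 0 else f (x k)))) sums u 0"
proof -
  define f0 where "f0 x = (if x \<in> {a<..<b} then 0 else f x)" for x
  have f0: "f0 \<in> borel_measurable borel" "bounded (range f0)"
  proof -
    have [measurable]: "f \<in> borel_measurable borel" by (rule f)
    show "f0 \<in> borel_measurable borel" unfolding f0_def[abs_def] by measurable
    obtain B where "\<And>x. norm (f x) \<le> B" using f(2) by (auto simp: bounded_iff)
    then have "norm (f0 x) \<le> \<bar>B\<bar>" for x by (auto simp: f0_def intro: order_trans[OF _ abs_ge_self])
    then show "bounded (range f0)" by (auto simp: bounded_iff)
  qed
  have "obs_expect qr k (\<lambda>x. survival_weight a b k x * (if x k \<in> {a<..<b} then 0 else f (x k))) = (kill a b ^^ k) f0 0" for k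
    unfolding f0_def[symmetric] by (rule obs_expect_survival[OF qr f0])
  then show ?thesis
    using exit_solution[OF ab f] unfolding f0_def[symmetric, abs_def] by auto
qed

text \<open>The exit distribution applied to the exponential with frequency \<open>\<mu>\<close>; also the value at \<open>0\<close> of the
  polynomial that interpolates this exponential at \<open>a\<close> and \<open>b\<close>.\<close>

definition exit_char :: "nat \<Rightarrow> real \<Rightarrow> real \<Rightarrow> real \<Rightarrow> complex" where
  "exit_char N a b \<mu> =
     (\<Sum>j<N. (\<i> * complex_of_real \<mu>) ^ j * iexp (\<mu> * a) * complex_of_real (I_minus N a b j)) +
     (\<Sum>j<N. (\<i> * complex_of_real \<mu>) ^ j * iexp (\<mu> * b) * complex_of_real (I_plus N a b j))"

context
  fixes N :: nat and c a b :: real and p :: "real \<Rightarrow> real \<Rightarrow> real"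
  assumes N: "N \<ge> 1" and c: "c > 0" and a: "a < 0" and b: "0 < b" and pb: "pseudo_brownian N c p"
begin

private definition t :: "nat \<Rightarrow> real" where "t n = 1 / 2 ^ n"
private definition q :: "nat \<Rightarrow> real \<Rightarrow> complex" where "q n x = complex_of_real (p (t n) x)"

private lemma t: "0 < t n" "t n \<le> 1" "t \<longlonglongrightarrow> 0"
proof -
  show "0 < t n" "t n \<le> 1" by (auto simp: t_def)
  show "t \<longlonglongrightarrow> 0" unfolding t_def[abs_def] by real_asymp
qed

private lemma law: "step_law N (c * t n) (q n)"
  unfolding q_def[abs_def] by (rule pseudo_brownian_step_law[OF N c pb t(1)])

private lemma ab: "a < b" using a b by linarith

text \<open>Any polynomial that fits the boundary function well enough for the defect to have the right form gives
  the limit by its value at the starting point.\<close>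

lemma exit_limit:
  fixes f g E :: "real \<Rightarrow> complex" and P :: "complex poly"
  assumes f: "f \<in> borel_measurable borel" "\<And>x. norm (f x) \<le> 1" and E: "L1_bdd E"
  defines "g \<equiv> \<lambda>x. if x \<in> {a<..<b} then poly P (complex_of_real x) else f x"
  assumes rep: "\<And>n x. x \<in> {a<..<b} \<Longrightarrow> 2 * pi * (g x - avg (q n) g x) =
        (LINT v|lborel. iexp_neg (x * v) *
            residual N (c * t n) a b \<alpha> \<beta> (\<lambda>v. - (\<kappa> * complex_of_real (\<mu> ^ (2 * N)) * fourier E v)) v)
        + 2 * pi * (\<kappa> * complex_of_real (gap N (c * t n) \<mu>) * E x)"
  shows "\<exists>E. (\<forall>n. (\<lambda>k. obs_expect (p (1 / 2 ^ n)) k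
       (\<lambda>x. survival_weight a b k x * (if x k \<in> {a<..<b} then 0 else f (x k)))) sums E n)
     \<and> E \<longlonglongrightarrow> poly P 0"
proof -
  have fb: "bounded (range f)" using f(2) by (auto simp: bounded_iff)
  have "\<exists>u. \<forall>n. u n \<in> borel_measurable borel \<and> bounded (range (u n)) \<and> (\<forall>x. x \<notin> {a<..<b} \<longrightarrow> u n x = f x) \<and>
     (\<forall>x\<in>{a<..<b}. u n x = avg (q n) (u n) x) \<and>
     (\<lambda>k. obs_expect (p (t n)) k (\<lambda>x. survival_weight a b k x * (if x k \<in> {a<..<b} then 0 else f (x k)))) sums u n 0"
    by (rule choice, rule allI, rule step_law.exit_sums[OF law _ ab f(1) fb]) (rule q_def)
  then obtain u where u: "\<And>n. u n \<in> borel_measurable borel" "\<And>n. bounded (range (u n))" "\<And>n x. x \<notin> {a<..<b} \<Longrightarrow> u n x = f x"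
     "\<And>n x. x \<in> {a<..<b} \<Longrightarrow> u n x = avg (q n) (u n) x"
     "\<And>n. (\<lambda>k. obs_expect (p (t n)) k (\<lambda>x. survival_weight a b k x * (if x k \<in> {a<..<b} then 0 else f (x k)))) sums u n 0"
    by blast
  have g: "g \<in> borel_measurable borel" "bounded (range g)"
  proof -
    have [measurable]: "f \<in> borel_measurable borel" by (rule f)
    have c: "continuous_on A (\<lambda>x. poly P (complex_of_real x))" for A by (intro continuous_intros)
    then have [measurable]: "(\<lambda>x. poly P (complex_of_real x)) \<in> borel_measurable borel" by (intro borel_measurable_continuous_onI)
    show "g \<in> borel_measurable borel" unfolding g_def by measurable
    obtain B where B: "\<And>x. norm (indicator {a..b} x * poly P (complex_of_real x)) \<le> B"
      using L1_bddD(3)[OF L1_bdd_indicator_mult[OF c]] by blast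
    have "norm (g x) \<le> max B 1" for x using B[of x] f(2)[of x] by (auto simp: g_def)
    then show "bounded (range g)" by (auto simp: bounded_iff)
  qed
  have "(\<lambda>n. u n 0) \<longlonglongrightarrow> g 0"
    by (rule exit_value_tendsto[OF N c a b t law g u(1,2) _ u(4) E rep]) (use u(3) in \<open>auto simp: g_def\<close>)
  moreover have "g 0 = poly P 0" using a b by (simp add: g_def)
  ultimately show ?thesis using u(5) by (intro exI[of _ "\<lambda>n. u n 0"]) (simp add: t_def)
qed

lemma exit_char_limit:
  "\<exists>E. (\<forall>n. (\<lambda>k. obs_expect (p (1 / 2 ^ n)) k
       (\<lambda>x. survival_weight a b k x * (if x k \<in> {a<..<b} then 0 else iexp (\<mu> * x k)))) sums E n)
     \<and> E \<longlonglongrightarrow> exit_char N a b \<mu>"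
proof -
  let ?w = "\<i> * complex_of_real \<mu>"
  obtain P where P: "(pderiv ^^ (2 * N)) P = 0"
     "\<And>j. j < N \<Longrightarrow> poly ((pderiv ^^ j) P) (complex_of_real a) = ?w ^ j * iexp (\<mu> * a)"
     "\<And>j. j < N \<Longrightarrow> poly ((pderiv ^^ j) P) (complex_of_real b) = ?w ^ j * iexp (\<mu> * b)"
     "poly P 0 = exit_char N a b \<mu>"
    using hermite_interpolation[of a b N "\<lambda>j. ?w ^ j * iexp (\<mu> * a)" "\<lambda>j. ?w ^ j * iexp (\<mu> * b)"] ab
    unfolding exit_char_def by auto
  have E: "L1_bdd (\<lambda>x. indicator {a..b} x * iexp (\<mu> * x))" by (rule L1_bdd_indicator_mult) (intro continuous_intros)
  show ?thesis
    unfolding P(4)[symmetric]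
    by (rule exit_limit[OF _ _ E step_law.defect_exp[OF law ab P(1) P(2) P(3)]]) simp_all
qed

lemma plus_first_limit:
  "\<exists>E. (\<forall>n. (\<lambda>k. obs_expect (p (1 / 2 ^ n)) k
       (\<lambda>x. survival_weight a b k x * (if x k \<in> {a<..<b} then 0 else if b \<le> x k then 1 else 0))) sums E n)
     \<and> E \<longlonglongrightarrow> complex_of_real (I_plus N a b 0)"
proof -
  obtain P where P: "(pderiv ^^ (2 * N)) P = 0"
     "\<And>j. j < N \<Longrightarrow> poly ((pderiv ^^ j) P) (complex_of_real a) = 0"
     "\<And>j. j < N \<Longrightarrow> poly ((pderiv ^^ j) P) (complex_of_real b) = (if j = 0 then 1 else 0)"
     "poly P 0 = (\<Sum>j<N. (if j = 0 then 1 else 0) * complex_of_real (I_plus N a b j))"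
    using hermite_interpolation[of a b N "\<lambda>j. 0" "\<lambda>j. if j = 0 then 1 else 0"] ab by auto
  have "(\<Sum>j<N. (if j = 0 then 1 else 0) * complex_of_real (I_plus N a b j)) = (\<Sum>j<N. if j = 0 then complex_of_real (I_plus N a b 0) else 0)"
    by (intro sum.cong) auto
  then have P0: "complex_of_real (I_plus N a b 0) = poly P 0" using P(4) N by simp
  have E: "L1_bdd (\<lambda>x. 0)" by (intro L1_bddI[where B = 0]) auto
  show ?thesis
    unfolding P0
  proof (rule exit_limit[OF _ _ E])
    show "2 * pi * ((if x \<in> {a<..<b} then poly P (complex_of_real x) else if b \<le> x then 1 else 0) -
          avg (q n) (\<lambda>x. if x \<in> {a<..<b} then poly P (complex_of_real x) else if b \<le> x then 1 else 0) x) =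
        (LINT v|lborel. iexp_neg (x * v) *
            residual N (c * t n) a b
              (\<lambda>i. - end_coeff N (\<lambda>j x. poly ((pderiv ^^ j) P) (complex_of_real x)) a i)
              (end_coeff N (\<lambda>j x. poly ((pderiv ^^ j) P) (complex_of_real x)) b)
              (\<lambda>v. - (0 * complex_of_real (0 ^ (2 * N)) * fourier (\<lambda>x. 0) v)) v)
        + 2 * pi * (0 * complex_of_real (gap N (c * t n) 0) * 0)" if "x \<in> {a<..<b}" for n x
      using step_law.defect_right_half_line[OF law ab P(1) P(2) P(3) that]
      unfolding mult_zero_left minus_zero mult_zero_right add_0_right .
  qed simp_all
qed

lemma exit_char_0: "exit_char N a b 0 = complex_of_real (I_minus N a b 0) + complex_of_real (I_plus N a b 0)"
proof -
  have "(\<Sum>j<N. (0::complex) ^ j * complex_of_real (I j)) = complex_of_real (I 0)" for I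
  proof -
    have "(\<Sum>j<N. (0::complex) ^ j * complex_of_real (I j)) = (\<Sum>j<N. if j = 0 then complex_of_real (I 0) else 0)"
      by (intro sum.cong) (auto simp: power_0_left)
    then show ?thesis using N by simp
  qed
  then show ?thesis by (simp add: exit_char_def)
qed

text \<open>The indicator of leaving at \<open>a\<close> is \<open>1\<close>, the exponential with \<open>\<mu> = 0\<close>, minus the indicator of leaving at \<open>b\<close>.\<close>

lemma minus_first_limit:
  "\<exists>E. (\<forall>n. (\<lambda>k. obs_expect (p (1 / 2 ^ n)) k
       (\<lambda>x. survival_weight a b k x * (if x k \<in> {a<..<b} then 0 else if x k \<le> a then 1 else 0))) sums E n)
     \<and> E \<longlonglongrightarrow> complex_of_real (I_minus N a b 0)"
proof -
  define f1 where "f1 x = (if x \<in> {a<..<b} then 0 else iexp (0 * x))" for x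
  define f2 where "f2 x = (if x \<in> {a<..<b} then 0 else if b \<le> x then 1 else 0 :: complex)" for x
  define f3 where "f3 x = (if x \<in> {a<..<b} then 0 else if x \<le> a then 1 else 0 :: complex)" for x
  have f: "f1 \<in> borel_measurable borel" "f2 \<in> borel_measurable borel" "f3 \<in> borel_measurable borel"
    unfolding f1_def[abs_def] f2_def[abs_def] f3_def[abs_def] by measurable
  have bd: "bounded (range f1)" "bounded (range f2)" "bounded (range f3)"
    by (auto simp: bounded_iff f1_def f2_def f3_def intro!: exI[of _ 1])
  obtain E1 where E1: "\<And>n. (\<lambda>k. obs_expect (p (t n)) k (\<lambda>x. survival_weight a b k x * f1 (x k))) sums E1 n"
      "E1 \<longlonglongrightarrow> exit_char N a b 0"
    using exit_char_limit[of 0] unfolding f1_def t_def by blast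
  obtain E2 where E2: "\<And>n. (\<lambda>k. obs_expect (p (t n)) k (\<lambda>x. survival_weight a b k x * f2 (x k))) sums E2 n"
      "E2 \<longlonglongrightarrow> complex_of_real (I_plus N a b 0)"
    using plus_first_limit unfolding f2_def t_def by blast
  have f3: "f3 = (\<lambda>x. f1 x - f2 x)" using ab by (auto simp: f1_def f2_def f3_def fun_eq_iff)
  have "obs_expect (p (t n)) k (\<lambda>x. survival_weight a b k x * f3 (x k)) =
      obs_expect (p (t n)) k (\<lambda>x. survival_weight a b k x * f1 (x k)) - obs_expect (p (t n)) k (\<lambda>x. survival_weight a b k x * f2 (x k))" for n k
  proof -
    note sv = step_law.obs_expect_survival[OF law[of n] q_def, where k = k and a = a and b = b]
    show ?thesis
      unfolding sv[OF f(1) bd(1)] sv[OF f(2) bd(2)] sv[OF f(3) bd(3)]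
      unfolding f3 step_law.kill_funpow_diff[OF law f(1) bd(1) f(2) bd(2)] ..
  qed
  then have "(\<lambda>k. obs_expect (p (t n)) k (\<lambda>x. survival_weight a b k x * f3 (x k))) sums (E1 n - E2 n)" for n
    using sums_diff[OF E1(1) E2(1)] by simp
  moreover have "(\<lambda>n. E1 n - E2 n) \<longlonglongrightarrow> complex_of_real (I_minus N a b 0)"
    using tendsto_diff[OF E1(2) E2(2)] by (simp add: exit_char_0)
  ultimately show ?thesis unfolding f3_def t_def by (intro exI[of _ "\<lambda>n. E1 n - E2 n"]) auto
qed

lemma has_exit_char_exit_char: "has_exit_char p a b \<mu> (exit_char N a b \<mu>)"
  unfolding has_exit_char_def has_stopped_expectation_def
  using exit_char_limit[of \<mu>]
  by (subst exit_functional_eq[where f = "\<lambda>y. iexp (\<mu> * y)", OF refl])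

lemma has_prob_minus_first_I_minus: "has_prob_minus_first p a b (I_minus N a b 0)"
  unfolding has_prob_minus_first_def has_stopped_expectation_def minus_first_functional_eq[OF ab]
  by (rule minus_first_limit)

lemma has_prob_plus_first_I_plus: "has_prob_plus_first p a b (I_plus N a b 0)"
  unfolding has_prob_plus_first_def has_stopped_expectation_def plus_first_functional_eq[OF ab]
  by (rule plus_first_limit)

end

lemma has_exit_char_unique:
  assumes "has_exit_char p a b \<mu> v" "has_exit_char p a b \<mu> w"
  shows "v = w"
proof -
  obtain E where E: "\<And>n. (\<lambda>k. obs_expect (p (1 / 2 ^ n)) k
       (\<lambda>x. if tau_exit a b (step_path n x) = ereal (real k / 2 ^ n)
            then iexp (\<mu> * exit_location a b (step_path n x)) else 0)) sums E n" "E \<longlonglongrightarrow> v"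
    using assms(1) unfolding has_exit_char_def has_stopped_expectation_def by blast
  obtain F where F: "\<And>n. (\<lambda>k. obs_expect (p (1 / 2 ^ n)) k
       (\<lambda>x. if tau_exit a b (step_path n x) = ereal (real k / 2 ^ n)
            then iexp (\<mu> * exit_location a b (step_path n x)) else 0)) sums F n" "F \<longlonglongrightarrow> w"
    using assms(2) unfolding has_exit_char_def has_stopped_expectation_def by blast
  have "E = F" using sums_unique2[OF E(1) F(1)] by (rule ext)
  then show ?thesis using E(2) F(2) LIMSEQ_unique by blast
qed

definition exit_distribution :: "nat \<Rightarrow> real \<Rightarrow> real \<Rightarrow> (real \<Rightarrow> complex) \<Rightarrow> complex" where
  "exit_distribution N a b \<phi> =
     (\<Sum>j<N. complex_of_real (I_minus N a b j) * nth_deriv j \<phi> a) + (\<Sum>j<N. complex_of_real (I_plus N a b j) * nth_deriv j \<phi> b)"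

lemma exit_distribution_dirac:
  "exit_distribution N a b \<phi> =
     (\<Sum>j<N. (- 1) ^ j * complex_of_real (I_minus N a b j) * dirac_deriv a j \<phi>)
   + (\<Sum>j<N. (- 1) ^ j * complex_of_real (I_plus N a b j) * dirac_deriv b j \<phi>)"
proof -
  have sgn: "(- 1) ^ j * z * ((- 1) ^ j * w) = z * w" for j and z w :: complex
    by (simp add: mult_ac)
  show ?thesis unfolding exit_distribution_def dirac_deriv_def sgn ..
qed

lemma nth_deriv_le_seminorms:
  assumes \<phi>: "schwartz \<phi>" and j: "j \<le> m"
  shows "norm (nth_deriv j \<phi> x) \<le> (\<Sum>i\<le>m. \<Sum>j\<le>m. SUP x. \<bar>x\<bar> ^ i * norm (nth_deriv j \<phi> x))"
proof -
  define s where "s i j = (SUP x. \<bar>x\<bar> ^ i * norm (nth_deriv j \<phi> x))" for i j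
  have bdd: "bdd_above (range (\<lambda>x. \<bar>x\<bar> ^ i * norm (nth_deriv j \<phi> x)))" for i j
  proof -
    obtain B where "\<And>x. norm (complex_of_real (x ^ i) * nth_deriv j \<phi> x) \<le> B" using schwartz_nth_deriv(2)[OF \<phi>] by blast
    then have "\<bar>x\<bar> ^ i * norm (nth_deriv j \<phi> x) \<le> B" for x by (simp add: norm_mult norm_power)
    then show ?thesis by (auto simp: bdd_above_def)
  qed
  have up: "\<bar>x\<bar> ^ i * norm (nth_deriv j \<phi> x) \<le> s i j" for i j x
    unfolding s_def by (rule cSUP_upper[OF UNIV_I bdd])
  have s0: "0 \<le> s i j" for i j using up[of 0 i j] by (rule order_trans[rotated]) simp
  have "norm (nth_deriv j \<phi> x) \<le> s 0 j" using up[of x 0 j] by simp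
  also have "\<dots> \<le> (\<Sum>j\<le>m. s 0 j)" using j s0 by (intro member_le_sum) auto
  also have "\<dots> \<le> (\<Sum>i\<le>m. \<Sum>j\<le>m. s i j)" using s0 by (intro member_le_sum[of 0 _ "\<lambda>i. \<Sum>j\<le>m. s i j"] sum_nonneg) auto
  finally show ?thesis by (simp only: s_def)
qed

lemma exit_distribution_tempered: "tempered_distribution (exit_distribution N a b)"
  unfolding tempered_distribution_def
proof (intro conjI allI impI)
  show "exit_distribution N a b (\<lambda>x. \<phi> x + \<psi> x) = exit_distribution N a b \<phi> + exit_distribution N a b \<psi>"
    if "schwartz \<phi>" "schwartz \<psi>" for \<phi> \<psi>
    unfolding exit_distribution_def schwartz_add(2)[OF that] by (simp add: distrib_left sum.distrib)
  show "exit_distribution N a b (\<lambda>x. s * \<phi> x) = s * exit_distribution N a b \<phi>" if "schwartz \<phi>" for s \<phi>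
    unfolding exit_distribution_def schwartz_cmult(2)[OF that] by (simp add: distrib_left sum_distrib_left mult_ac)
  define C where "C = (\<Sum>j<N. \<bar>I_minus N a b j\<bar>) + (\<Sum>j<N. \<bar>I_plus N a b j\<bar>)"
  have "norm (exit_distribution N a b \<phi>) \<le> C * (\<Sum>i\<le>N. \<Sum>j\<le>N. SUP x. \<bar>x\<bar> ^ i * norm (nth_deriv j \<phi> x))" if \<phi>: "schwartz \<phi>" for \<phi>
  proof -
    define s where "s = (\<Sum>i\<le>N. \<Sum>j\<le>N. SUP x. \<bar>x\<bar> ^ i * norm (nth_deriv j \<phi> x))"
    have b: "norm (nth_deriv j \<phi> x) \<le> s" if "j \<in> {..<N}" for j x
      unfolding s_def using that by (intro nth_deriv_le_seminorms[OF \<phi>]) auto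
    have "norm (\<Sum>j<N. complex_of_real (I j) * nth_deriv j \<phi> x) \<le> (\<Sum>j<N. \<bar>I j\<bar> * s)" for I x
      by (rule sum_norm_le) (auto simp: norm_mult intro!: mult_left_mono b)
    then have "norm (exit_distribution N a b \<phi>) \<le> (\<Sum>j<N. \<bar>I_minus N a b j\<bar> * s) + (\<Sum>j<N. \<bar>I_plus N a b j\<bar> * s)"
      unfolding exit_distribution_def by (intro order_trans[OF norm_triangle_ineq] add_mono)
    then show ?thesis unfolding C_def s_def[symmetric] by (simp add: sum_distrib_right distrib_right)
  qed
  then show "\<exists>C m. \<forall>\<phi>. schwartz \<phi> \<longrightarrow> norm (exit_distribution N a b \<phi>) \<le> C * (\<Sum>i\<le>m. \<Sum>j\<le>m. SUP x. \<bar>x\<bar> ^ i * norm (nth_deriv j \<phi> x))"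
    by blast
qed

lemma exit_distribution_fourier: "has_fourier_transform (exit_distribution N a b) (exit_char N a b)"
  unfolding has_fourier_transform_def
proof (intro allI impI)
  fix \<phi> assume \<phi>: "schwartz \<phi>"
  define T where "T x j \<mu> = iexp (\<mu> * x) * ((\<i> * complex_of_real \<mu>) ^ j * \<phi> \<mu>)" for x j \<mu>
  have T: "integrable lborel (T x j)" "integral\<^sup>L lborel (T x j) = nth_deriv j (fourier \<phi>) x" for x j
  proof -
    show "integrable lborel (T x j)"
      unfolding T_def by (intro integrable_exp_i L1_bddD(1) schwartz_L1_bdd schwartz_times_power \<phi>)
    show "integral\<^sup>L lborel (T x j) = nth_deriv j (fourier \<phi>) x"
      unfolding schwartz_fourier(2)[OF \<phi>] T_def fourier_def ..
  qed
  define S where "S I x \<mu> = (\<Sum>j<N. complex_of_real (I j) * T x j \<mu>)" for I x \<mu>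
  have S: "integrable lborel (S I x)" "integral\<^sup>L lborel (S I x) = (\<Sum>j<N. complex_of_real (I j) * nth_deriv j (fourier \<phi>) x)" for I x
  proof -
    show "integrable lborel (S I x)" unfolding S_def by (intro Bochner_Integration.integrable_sum integrable_mult_right T)
    show "integral\<^sup>L lborel (S I x) = (\<Sum>j<N. complex_of_real (I j) * nth_deriv j (fourier \<phi>) x)"
      unfolding S_def by (subst Bochner_Integration.integral_sum) (auto intro!: integrable_mult_right T simp: T(2))
  qed
  have eq: "(\<lambda>\<mu>. exit_char N a b \<mu> * \<phi> \<mu>) = (\<lambda>\<mu>. S (I_minus N a b) a \<mu> + S (I_plus N a b) b \<mu>)"
    unfolding exit_char_def S_def T_def by (rule ext) (simp only: distrib_right sum_distrib_right, simp only: mult_ac)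
  show "integrable lborel (\<lambda>\<mu>. exit_char N a b \<mu> * \<phi> \<mu>) \<and>
        exit_distribution N a b (fourier \<phi>) = (LINT \<mu>|lborel. exit_char N a b \<mu> * \<phi> \<mu>)"
    unfolding eq exit_distribution_def using S by simp
qed

theorem corollary10p3:
  fixes N :: nat and c a b :: real and p :: "real \<Rightarrow> real \<Rightarrow> real"
  assumes "N \<ge> 1" and "c > 0" and "a < 0" and "0 < b"
    and "pseudo_brownian N c p"
  shows "(\<exists>D. is_exit_pseudo_density p a b D) \<and>
         (\<forall>D. is_exit_pseudo_density p a b D \<longrightarrow>
            (\<forall>\<phi>. schwartz \<phi> \<longrightarrow>
               D \<phi> = (\<Sum>j<N. (- 1) ^ j * complex_of_real (I_minus N a b j) * dirac_deriv a j \<phi>)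
                    + (\<Sum>j<N. (- 1) ^ j * complex_of_real (I_plus N a b j) * dirac_deriv b j \<phi>))) \<and>
         has_prob_minus_first p a b (I_minus N a b 0) \<and>
         has_prob_plus_first p a b (I_plus N a b 0)"
proof (intro conjI allI impI)
  have char: "has_exit_char p a b \<mu> (exit_char N a b \<mu>)" for \<mu>
    using assms by (rule has_exit_char_exit_char)
  have "is_exit_pseudo_density p a b (exit_distribution N a b)"
    unfolding is_exit_pseudo_density_def
    using exit_distribution_tempered exit_distribution_fourier char by blast
  then show "\<exists>D. is_exit_pseudo_density p a b D" by blast
  show "has_prob_minus_first p a b (I_minus N a b 0)" using assms by (rule has_prob_minus_first_I_minus)
  show "has_prob_plus_first p a b (I_plus N a b 0)" using assms by (rule has_prob_plus_first_I_plus)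
  fix D \<phi> assume D: "is_exit_pseudo_density p a b D" and \<phi>: "schwartz \<phi>"
  obtain \<Phi> where \<Phi>: "\<And>\<mu>. has_exit_char p a b \<mu> (\<Phi> \<mu>)" "has_fourier_transform D \<Phi>"
    using D unfolding is_exit_pseudo_density_def by blast
  have "\<Phi> = exit_char N a b" using has_exit_char_unique[OF \<Phi>(1) char] by (rule ext)
  obtain \<psi> where \<psi>: "schwartz \<psi>" "fourier \<psi> = \<phi>" using schwartz_eq_fourier[OF \<phi>] by blast
  have "D (fourier \<psi>) = exit_distribution N a b (fourier \<psi>)"
    using \<Phi>(2) exit_distribution_fourier[of N a b] \<psi>(1) unfolding has_fourier_transform_def \<open>\<Phi> = exit_char N a b\<close> by simp
  then show "D \<phi> = (\<Sum>j<N. (- 1) ^ j * complex_of_real (I_minus N a b j) * dirac_deriv a j \<phi>)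
                    + (\<Sum>j<N. (- 1) ^ j * complex_of_real (I_plus N a b j) * dirac_deriv b j \<phi>)"
    unfolding \<psi>(2) exit_distribution_dirac .
qed

end
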